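(* Let $\{X_n\}_{n\in\mathbb{Z}}\subset L_H^4$ be an $L^4$--$m$-approximable sequence, where each $X_n$ is jointly measurable in $(t,\omega)$ and $\sup_{t\in[0,1]}E|X_1(t)|^2<\infty$. Let $C$ be its covariance operator with eigenvalues $\lambda_1\ge\lambda_2\ge\cdots$ and corresponding orthonormal eigenfunctions $v_1,v_2,\ldots$, and assume that $$\lambda_1>\lambda_2>\cdots>\lambda_d>\lambda_{d+1}.$$ Let $\hat\lambda_1\ge\hat\lambda_2\ge\cdots$ and $\hat v_1,\hat v_2,\ldots$ be the eigenvalues and corresponding orthonormal eigenfunctions of the empirical covariance operator $\hat C$ computed from $X_1,\dots,X_N$, and let $\hat c_j=\mathrm{sign}(\langle \hat v_j,v_j\rangle)$. Then, for $1\le j\le d$, $$\limsup_{N\to\infty}N\,E\bigl[|\lambda_j-\hat\lambda_j|^2\bigr]<\infty,\qquad \limsup_{N\to\infty}N\,E\bigl[\|\hat c_j\hat v_j-v_j\|^2\bigr]<\infty .$$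
   Context: $H=L^2([0,1],\mathcal B_{[0,1]},\lambda)$ with inner product $\langle\cdot,\cdot\rangle$ and norm $\|f\|^2=\int_0^1|f(t)|^2dt$. $L_H^p$ is the space of $H$-valued random elements $X$ with $\nu_p(X)=(E\|X\|^p)^{1/p}<\infty$. $L^p$--$m$-approximability: a sequence $\{X_n\}_{n\in\mathbb Z}\subset L_H^p$ is $L^p$--$m$-approximable if $X_n=f(\varepsilon_n,\varepsilon_{n-1},\ldots)$ for all $n$, where $\{\varepsilon_i\}_{i\in\mathbb Z}$ are i.i.d. elements with values in a measurable space $S$ and $f:S^\infty\to H$ is measurable, and moreover $\sum_{m=1}^\infty\nu_p(X_m-X_m^{(m)})<\infty$, where $$X_n^{(m)}=f\bigl(\varepsilon_n,\ldots,\varepsilon_{n-m+1},\varepsilon_{n-m}^{(n)},\varepsilon_{n-m-1}^{(n)},\ldots\bigr)$$ and, for each $n$, $\{\varepsilon_k^{(n)}\}_{k}$ is an independent copy of $\{\varepsilon_k\}_k$ (these copies for different $n$ being independent of each other and of $\{\varepsilon_k\}$). The covariance operator $C$ is the integral operator on $H$ with kernel $c(t,s)=\mathrm{Cov}(X_1(t),X_1(s))$. The empirical covariance operator $\hat C$ is the integral operator with kernel $$\hat c(t,s)=N^{-1}\sum_{n=1}^N\bigl(X_n(t)-\bar X_N(t)\bigr)\bigl(X_n(s)-\bar X_N(s)\bigr),\qquad \bar X_N=N^{-1}\sum_{n=1}^N X_n .$$ *)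

theory Defs
  imports "HOL-Probability.Probability"
begin

section \<open>The Hilbert space \<open>H = L\<^sup>2([0,1])\<close>\<close>

abbreviation unit_interval :: "real measure" where
  "unit_interval \<equiv> restrict_space lborel {0..1}"

definition square_integrable :: "(real \<Rightarrow> real) \<Rightarrow> bool" where
  "square_integrable f \<longleftrightarrow>
     f \<in> borel_measurable unit_interval \<and> integrable unit_interval (\<lambda>t. (f t)\<^sup>2)"

lemma square_integrable_mult:
  assumes "square_integrable f" "square_integrable g"
  shows "integrable unit_interval (\<lambda>t. f t * g t)"
proof (rule Bochner_Integration.integrable_bound)
  show "integrable unit_interval (\<lambda>t. (f t)\<^sup>2 + (g t)\<^sup>2)"
    using assms by (auto simp: square_integrable_def)
  show "(\<lambda>t. f t * g t) \<in> borel_measurable unit_interval"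
    using assms by (auto simp: square_integrable_def)
  have "\<bar>x * y\<bar> \<le> x\<^sup>2 + y\<^sup>2" for x y :: real
  proof -
    have "2 * (\<bar>x\<bar> * \<bar>y\<bar>) \<le> x\<^sup>2 + y\<^sup>2"
      using sum_squares_bound[of "\<bar>x\<bar>" "\<bar>y\<bar>"] by (simp add: mult.assoc)
    moreover have "0 \<le> \<bar>x\<bar> * \<bar>y\<bar>" by simp
    ultimately show ?thesis unfolding abs_mult by linarith
  qed
  then show "AE t in unit_interval. norm (f t * g t) \<le> norm ((f t)\<^sup>2 + (g t)\<^sup>2)"
    by (auto simp: abs_of_nonneg)
qed

lemma square_integrable_zero: "square_integrable (\<lambda>t. 0)"
  by (simp add: square_integrable_def)

lemma square_integrable_add:
  assumes "square_integrable f" "square_integrable g"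
  shows "square_integrable (\<lambda>t. f t + g t)"
proof -
  have "integrable unit_interval (\<lambda>t. (f t)\<^sup>2 + 2 * (f t * g t) + (g t)\<^sup>2)"
    using assms square_integrable_mult[OF assms] by (auto simp: square_integrable_def)
  then have "integrable unit_interval (\<lambda>t. (f t + g t)\<^sup>2)"
    by (simp add: power2_sum algebra_simps)
  then show ?thesis using assms by (auto simp: square_integrable_def)
qed

lemma square_integrable_scale:
  "square_integrable f \<Longrightarrow> square_integrable (\<lambda>t. a * f t)"
  by (auto simp: square_integrable_def power_mult_distrib)

lemma square_integrable_diff:
  "square_integrable f \<Longrightarrow> square_integrable g \<Longrightarrow> square_integrable (\<lambda>t. f t - g t)"
  using square_integrable_add[OF _ square_integrable_scale[where a = "-1"]] by fastforce

definition L2_rel :: "(real \<Rightarrow> real) \<Rightarrow> (real \<Rightarrow> real) \<Rightarrow> bool" where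
  "L2_rel f g \<longleftrightarrow>
     square_integrable f \<and> square_integrable g \<and> (AE t in unit_interval. f t = g t)"

lemma L2_rel_part_equivp: "part_equivp L2_rel"
proof (rule part_equivpI)
  show "\<exists>f. L2_rel f f"
    using square_integrable_zero by (auto simp: L2_rel_def)
  show "symp L2_rel"
    by (auto simp: symp_def L2_rel_def elim: AE_mp)
  show "transp L2_rel"
    unfolding transp_def L2_rel_def by (auto elim!: AE_mp)
qed

text \<open>
  Elements of \<open>H\<close> are almost-everywhere classes.  The class of \<open>f\<close> is \<open>abs_L2 f\<close>, which is
  meaningful only when \<open>square_integrable f\<close>.
\<close>

quotient_type L2 = "real \<Rightarrow> real" / partial: L2_rel
  by (rule L2_rel_part_equivp)

lemma L2_inner_cong:
  assumes "L2_rel f g" "L2_rel f' g'"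
  shows "(LINT t|unit_interval. f t * f' t) = (LINT t|unit_interval. g t * g' t)"
proof (rule integral_cong_AE)
  show "AE t in unit_interval. f t * f' t = g t * g' t"
    using assms unfolding L2_rel_def by (auto elim!: AE_mp)
qed (use assms in \<open>auto simp: L2_rel_def square_integrable_def\<close>)

instantiation L2 :: real_inner
begin

lift_definition zero_L2 :: L2 is "\<lambda>t. 0"
  by (simp add: L2_rel_def square_integrable_zero)

lift_definition plus_L2 :: "L2 \<Rightarrow> L2 \<Rightarrow> L2" is "\<lambda>f g t. f t + g t"
  unfolding L2_rel_def by (auto intro!: square_integrable_add elim!: AE_mp)

lift_definition uminus_L2 :: "L2 \<Rightarrow> L2" is "\<lambda>f t. - f t"
  unfolding L2_rel_def
  by (auto intro!: square_integrable_scale[where a = "-1", simplified] elim!: AE_mp)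

lift_definition minus_L2 :: "L2 \<Rightarrow> L2 \<Rightarrow> L2" is "\<lambda>f g t. f t - g t"
  unfolding L2_rel_def by (auto intro!: square_integrable_diff elim!: AE_mp)

lift_definition scaleR_L2 :: "real \<Rightarrow> L2 \<Rightarrow> L2" is "\<lambda>a f t. a * f t"
  unfolding L2_rel_def by (auto intro!: square_integrable_scale elim!: AE_mp)

lift_definition inner_L2 :: "L2 \<Rightarrow> L2 \<Rightarrow> real"
  is "\<lambda>f g. LINT t|unit_interval. f t * g t"
  by (rule L2_inner_cong)

definition norm_L2 :: "L2 \<Rightarrow> real" where "norm_L2 x = sqrt (inner x x)"
definition dist_L2 :: "L2 \<Rightarrow> L2 \<Rightarrow> real" where "dist_L2 x y = norm (x - y)"
definition sgn_L2 :: "L2 \<Rightarrow> L2" where "sgn_L2 x = inverse (norm x) *\<^sub>R x"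
definition uniformity_L2 :: "(L2 \<times> L2) filter" where
  "uniformity_L2 = (INF e\<in>{0<..}. principal {(x, y). dist x y < e})"
definition open_L2 :: "L2 set \<Rightarrow> bool" where
  "open_L2 U \<longleftrightarrow> (\<forall>x\<in>U. eventually (\<lambda>(x', y). x' = x \<longrightarrow> y \<in> U) uniformity)"

instance
proof
  fix x y z :: L2 and a b :: real
  show "x + y + z = x + (y + z)"
    by transfer (auto simp: L2_rel_def add.assoc intro!: square_integrable_add)
  show "x + y = y + x"
    by transfer (auto simp: L2_rel_def add.commute intro!: square_integrable_add)
  show "0 + x = x"
    by transfer (auto simp: L2_rel_def)
  show "- x + x = 0"
    by transfer (auto simp: L2_rel_def square_integrable_zero)
  show "x - y = x + - y"
    by transfer (auto simp: L2_rel_def intro!: square_integrable_diff)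
  show "a *\<^sub>R (x + y) = a *\<^sub>R x + a *\<^sub>R y"
    by transfer
      (auto simp: L2_rel_def distrib_left intro!: square_integrable_add square_integrable_scale)
  show "(a + b) *\<^sub>R x = a *\<^sub>R x + b *\<^sub>R x"
    by transfer
      (auto simp: L2_rel_def distrib_right intro!: square_integrable_add square_integrable_scale)
  show "a *\<^sub>R b *\<^sub>R x = (a * b) *\<^sub>R x"
    by transfer (auto simp: L2_rel_def mult.assoc intro!: square_integrable_scale)
  show "1 *\<^sub>R x = x"
    by transfer (auto simp: L2_rel_def)
  show "dist x y = norm (x - y)"
    by (rule dist_L2_def)
  show "sgn x = inverse (norm x) *\<^sub>R x"
    by (rule sgn_L2_def)
  show "uniformity = (INF e\<in>{0<..}. principal {(x :: L2, y). dist x y < e})"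
    by (rule uniformity_L2_def)
  show "open U \<longleftrightarrow> (\<forall>x\<in>U. eventually (\<lambda>(x', y). x' = x \<longrightarrow> y \<in> U) uniformity)" for U :: "L2 set"
    by (rule open_L2_def)
  show "inner x y = inner y x"
    by transfer (simp add: mult.commute)
  show "inner (x + y) z = inner x z + inner y z"
    by transfer (auto simp: L2_rel_def distrib_right square_integrable_mult)
  show "inner (a *\<^sub>R x) y = a * inner x y"
    by transfer (auto simp: mult.assoc)
  show "0 \<le> inner x x"
    by transfer simp
  show "inner x x = 0 \<longleftrightarrow> x = 0"
  proof transfer
    fix f assume "L2_rel f f"
    then have f: "square_integrable f" by (simp add: L2_rel_def)
    have "(LINT t|unit_interval. f t * f t) = 0 \<longleftrightarrow> (AE t in unit_interval. f t * f t = 0)"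
      by (rule integral_nonneg_eq_0_iff_AE) (use square_integrable_mult[OF f f] in auto)
    then show "(LINT t|unit_interval. f t * f t) = 0 \<longleftrightarrow> L2_rel f (\<lambda>t. 0)"
      using f by (simp add: L2_rel_def square_integrable_zero)
  qed
  show "norm x = sqrt (inner x x)"
    by (rule norm_L2_def)
qed

end

lemma abs_L2_eq_iff:
  assumes "square_integrable f" "square_integrable g"
  shows "abs_L2 f = abs_L2 g \<longleftrightarrow> (AE t in unit_interval. f t = g t)"
  using Quotient3_rel[OF Quotient3_L2, of f g] assms by (auto simp: L2_rel_def)

lemma inner_abs_L2:
  assumes "square_integrable f" "square_integrable g"
  shows "inner (abs_L2 f) (abs_L2 g) = (LINT t|unit_interval. f t * g t)"
  using assms by (simp add: inner_L2.abs_eq L2_rel_def)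


section \<open>Integral operators and their eigenvalues\<close>

text \<open>
  The choice of representative of \<open>u\<close> is immaterial.  The value is meaningful for kernels
  in \<open>L\<^sup>2([0,1]\<^sup>2)\<close>.
\<close>

definition integral_operator :: "(real \<Rightarrow> real \<Rightarrow> real) \<Rightarrow> L2 \<Rightarrow> L2" where
  "integral_operator k u = abs_L2 (\<lambda>t. LINT s|unit_interval. k t s * rep_L2 u s)"

text \<open>
  \<open>l 1 \<ge> l 2 \<ge> \<dots>\<close> are the eigenvalues of \<open>T\<close>, repeated according to multiplicity, with
  corresponding orthonormal eigenvectors \<open>v 1, v 2, \<dots>\<close>; the index \<open>0\<close> is not used.  The last
  conjunct says that no nonzero eigenvalue is missed or listed with too small a multiplicity.
  It is restricted to nonzero eigenvalues because a compact positive operator of infinite rank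
  with nontrivial kernel has infinitely many positive eigenvalues, so that a nonincreasing
  enumeration cannot reach the eigenvalue \<open>0\<close>; in particular \<open>v\<close> need not be a basis.
\<close>

definition eigensystem ::
  "('a::real_inner \<Rightarrow> 'a) \<Rightarrow> (nat \<Rightarrow> real) \<Rightarrow> (nat \<Rightarrow> 'a) \<Rightarrow> bool" where
  "eigensystem T l v \<longleftrightarrow>
     (\<forall>i\<ge>1. T (v i) = l i *\<^sub>R v i) \<and>
     (\<forall>i\<ge>1. \<forall>k\<ge>1. inner (v i) (v k) = (if i = k then 1 else 0)) \<and>
     (\<forall>i\<ge>1. l (Suc i) \<le> l i) \<and>
     (\<forall>\<mu> u. \<mu> \<noteq> 0 \<longrightarrow> T u = \<mu> *\<^sub>R u \<longrightarrow> u \<in> span {v i |i. 1 \<le> i \<and> l i = \<mu>})"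


section \<open>Approximable sequences\<close>

text \<open>\<open>\<nu>\<^sub>p\<close>; used only for \<open>Y\<close> with finite \<open>p\<close>-th moment.\<close>

definition nu :: "'w measure \<Rightarrow> real \<Rightarrow> ('w \<Rightarrow> 'a::real_normed_vector) \<Rightarrow> real" where
  "nu M p Y = (LINT \<omega>|M. norm (Y \<omega>) powr p) powr (1 / p)"

definition Lp_random_element ::
  "'w measure \<Rightarrow> real \<Rightarrow> ('w \<Rightarrow> 'a::real_normed_vector) \<Rightarrow> bool" where
  "Lp_random_element M p Y \<longleftrightarrow>
     Y \<in> borel_measurable M \<and> integrable M (\<lambda>\<omega>. norm (Y \<omega>) powr p)"

definition iid_sequence :: "'w measure \<Rightarrow> 's measure \<Rightarrow> (int \<Rightarrow> 'w \<Rightarrow> 's) \<Rightarrow> bool" where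
  "iid_sequence M S \<epsilon> \<longleftrightarrow>
     prob_space.indep_vars M (\<lambda>_. S) \<epsilon> UNIV \<and> (\<forall>i j. distr M S (\<epsilon> i) = distr M S (\<epsilon> j))"

text \<open>
  \<open>\<epsilon>' n\<close> is the copy \<open>(\<epsilon>\<^sub>k\<^sup>(\<^sup>n\<^sup>))\<^sub>k\<close>.  In the joint independence statement the index \<open>None\<close> stands
  for the original sequence.
\<close>

definition independent_copies ::
  "'w measure \<Rightarrow> 's measure \<Rightarrow> (int \<Rightarrow> 'w \<Rightarrow> 's) \<Rightarrow> (int \<Rightarrow> int \<Rightarrow> 'w \<Rightarrow> 's) \<Rightarrow> bool" where
  "independent_copies M S \<epsilon> \<epsilon>' \<longleftrightarrow>
     (\<forall>n. distr M (PiM UNIV (\<lambda>_. S)) (\<lambda>\<omega> k. \<epsilon>' n k \<omega>) =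
          distr M (PiM UNIV (\<lambda>_. S)) (\<lambda>\<omega> k. \<epsilon> k \<omega>)) \<and>
     prob_space.indep_vars M (\<lambda>_::int option. PiM (UNIV :: int set) (\<lambda>_. S))
       (\<lambda>i \<omega> k. case i of None \<Rightarrow> \<epsilon> k \<omega> | Some n \<Rightarrow> \<epsilon>' n k \<omega>) UNIV"

definition coupled ::
  "((nat \<Rightarrow> 's) \<Rightarrow> 'a) \<Rightarrow> (int \<Rightarrow> 'w \<Rightarrow> 's) \<Rightarrow> (int \<Rightarrow> int \<Rightarrow> 'w \<Rightarrow> 's) \<Rightarrow> nat \<Rightarrow> int \<Rightarrow> 'w \<Rightarrow> 'a" where
  "coupled f \<epsilon> \<epsilon>' m n \<omega> =
     f (\<lambda>k. if k < m then \<epsilon> (n - int k) \<omega> else \<epsilon>' n (n - int k) \<omega>)"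

text \<open>
  \<open>L\<^sup>p\<close>-\<open>m\<close>-approximability, witnessed by \<open>S\<close>, \<open>f\<close>, \<open>\<epsilon>\<close> and the copies \<open>\<epsilon>'\<close>.  The differences
  \<open>X\<^sub>m - X\<^sub>m\<^sup>(\<^sup>m\<^sup>)\<close> have a finite \<open>p\<close>-th moment because both terms have the law of \<open>X\<^sub>m\<close>.
\<close>

definition Lp_m_approximable ::
  "'w measure \<Rightarrow> real \<Rightarrow> 's measure \<Rightarrow> ((nat \<Rightarrow> 's) \<Rightarrow> 'a::real_normed_vector) \<Rightarrow>
   (int \<Rightarrow> 'w \<Rightarrow> 's) \<Rightarrow> (int \<Rightarrow> int \<Rightarrow> 'w \<Rightarrow> 's) \<Rightarrow> (int \<Rightarrow> 'w \<Rightarrow> 'a) \<Rightarrow> bool" where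
  "Lp_m_approximable M p S f \<epsilon> \<epsilon>' X \<longleftrightarrow>
     (\<forall>n. Lp_random_element M p (X n)) \<and>
     iid_sequence M S \<epsilon> \<and>
     f \<in> borel_measurable (PiM UNIV (\<lambda>_. S)) \<and>
     (\<forall>n. AE \<omega> in M. X n \<omega> = f (\<lambda>k. \<epsilon> (n - int k) \<omega>)) \<and>
     independent_copies M S \<epsilon> \<epsilon>' \<and>
     summable (\<lambda>i. let m = Suc i in
       nu M p (\<lambda>\<omega>. X (int m) \<omega> - coupled f \<epsilon> \<epsilon>' m (int m) \<omega>))"


section \<open>Covariance kernels\<close>

definition cov_kernel :: "'w measure \<Rightarrow> ('w \<Rightarrow> real \<Rightarrow> real) \<Rightarrow> real \<Rightarrow> real \<Rightarrow> real" where
  "cov_kernel M Y t s =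
     (LINT \<omega>|M. (Y \<omega> t - (LINT \<omega>'|M. Y \<omega>' t)) * (Y \<omega> s - (LINT \<omega>'|M. Y \<omega>' s)))"

definition sample_mean :: "(int \<Rightarrow> 'w \<Rightarrow> real \<Rightarrow> real) \<Rightarrow> nat \<Rightarrow> 'w \<Rightarrow> real \<Rightarrow> real" where
  "sample_mean X N \<omega> t = (\<Sum>n=1..N. X (int n) \<omega> t) / real N"

definition emp_cov_kernel ::
  "(int \<Rightarrow> 'w \<Rightarrow> real \<Rightarrow> real) \<Rightarrow> nat \<Rightarrow> 'w \<Rightarrow> real \<Rightarrow> real \<Rightarrow> real" where
  "emp_cov_kernel X N \<omega> t s =
     (\<Sum>n=1..N. (X (int n) \<omega> t - sample_mean X N \<omega> t) *
                 (X (int n) \<omega> s - sample_mean X N \<omega> s)) / real N"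

end

theory Submission
  imports Defs
begin

text \<open>
  Let \<open>h\<close> be the Hilbert--Schmidt norm of the difference between the covariance operator and the
  empirical covariance operator of \<open>N\<close> observations.  The theorem combines a deterministic
  statement, that both errors are bounded by a constant multiple of \<open>h\<close>, with the estimate
  \<open>E h\<^sup>2 \<le> K / N\<close>.

  The eigenvalue error is at most \<open>h\<close> by Weyl's inequality (\<open>eigenvalue_perturbation\<close>).  For the
  eigenvectors, the gap \<open>\<alpha>\<close> between the \<open>j\<close>-th eigenvalue and the others gives
  \<open>\<parallel>sgn \<langle>u, v\<rangle> u - v\<parallel>\<^sup>2 \<le> 8 h\<^sup>2 / \<alpha>\<^sup>2\<close> (\<open>eigenvector_perturbation\<close>).  Both rest on the variational
  description of the eigenvalues in \<open>rayleigh_le_eigenvalue\<close>, which holds because an integral operator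
  with square-integrable kernel is compact: bounded sequences have weakly convergent subsequences,
  and dominated convergence makes their images converge in norm.

  The expectation of \<open>h\<^sup>2\<close> is reduced to mean square errors of averages.  Up to the effect of
  estimating the mean, the empirical covariance is the average of the tensors \<open>X\<^sub>n \<otimes> X\<^sub>n\<close>.  The mean
  square error of an average is \<open>1/N\<^sup>2\<close> times a double sum of autocovariances (\<open>mean_square_error\<close>), and
  these are summable over the lag (\<open>autocovariance_bound\<close>): replacing \<open>X\<^bsub>n+k\<^esub>\<close> by its coupled version of
  order \<open>k\<close> makes it independent of \<open>X\<^sub>n\<close>, at a cost proportional to the \<open>k\<close>-th term of the convergent
  series in the definition of approximability.

  Estimating the mean contributes \<open>\<parallel>\<Delta>\<parallel>\<^sup>2 \<parallel>m\<parallel>\<^sup>2\<close>, with \<open>m\<close> the sample mean and \<open>\<Delta>\<close> its error.  A fourth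
  moment bound for sums is avoided by estimating \<open>\<parallel>m\<parallel>\<^sup>2\<close> by the average of the \<open>\<parallel>X\<^sub>n\<parallel>\<^sup>2\<close>, itself
  close to its expectation in mean square (\<open>kernel_norm_error_le\<close>).  Thus the same estimate for averages
  is used three times: for the observations, for their tensor squares and for their squared norms.
\<close>

section \<open>Dominated convergence and separability of \<open>L\<^sup>2([0,1])\<close>\<close>

lemma space_unit_interval [simp]: "space unit_interval = {0..1}"
  by (simp add: space_restrict_space)

lemma finite_measure_unit_interval: "finite_measure unit_interval"
  by (rule finite_measureI) (simp add: emeasure_restrict_space)

interpretation unit_interval: finite_measure unit_interval
  by (rule finite_measure_unit_interval)

lemma L2_rel_refl [simp]: "L2_rel f f \<longleftrightarrow> square_integrable f"
  by (simp add: L2_rel_def)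

lemma square_integrable_rep_L2 [simp]: "square_integrable (rep_L2 u)"
  using Quotient3_rep_reflp[OF Quotient3_L2, of u] by simp

lemma abs_rep_L2 [simp]: "abs_L2 (rep_L2 u) = u"
  by (rule Quotient3_abs_rep[OF Quotient3_L2])

lemma abs_L2_add:
  "square_integrable f \<Longrightarrow> square_integrable g \<Longrightarrow> abs_L2 (\<lambda>t. f t + g t) = abs_L2 f + abs_L2 g"
  by (subst plus_L2.abs_eq) auto

lemma abs_L2_diff:
  "square_integrable f \<Longrightarrow> square_integrable g \<Longrightarrow> abs_L2 (\<lambda>t. f t - g t) = abs_L2 f - abs_L2 g"
  by (subst minus_L2.abs_eq) auto

lemma abs_L2_scale:
  "square_integrable f \<Longrightarrow> abs_L2 (\<lambda>t. a * f t) = a *\<^sub>R abs_L2 f"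
  by (subst scaleR_L2.abs_eq) auto

lemma abs_L2_zero: "abs_L2 (\<lambda>t. 0) = 0"
  by (simp add: zero_L2_def)

lemma power2_norm_abs_L2:
  "square_integrable f \<Longrightarrow> (norm (abs_L2 f))\<^sup>2 = (LINT t|unit_interval. (f t)\<^sup>2)"
  by (simp only: power2_norm_eq_inner inner_abs_L2) (simp add: power2_eq_square)

lemma abs_L2_sum:
  assumes "finite I" "\<And>i. i \<in> I \<Longrightarrow> square_integrable (F i)"
  shows "square_integrable (\<lambda>t. \<Sum>i\<in>I. F i t) \<and> abs_L2 (\<lambda>t. \<Sum>i\<in>I. F i t) = (\<Sum>i\<in>I. abs_L2 (F i))"
  using assms by (induction I) (auto simp: square_integrable_zero square_integrable_add abs_L2_add abs_L2_zero)

lemma square_integrable_bound: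
  assumes "f \<in> borel_measurable unit_interval" "square_integrable g"
    and "\<And>t. t \<in> {0..1} \<Longrightarrow> \<bar>f t\<bar> \<le> \<bar>g t\<bar>"
  shows "square_integrable f"
proof -
  have "integrable unit_interval (\<lambda>t. (f t)\<^sup>2)"
  proof (rule Bochner_Integration.integrable_bound)
    show "integrable unit_interval (\<lambda>t. (g t)\<^sup>2)" using assms by (simp add: square_integrable_def)
    show "AE t in unit_interval. norm ((f t)\<^sup>2) \<le> norm ((g t)\<^sup>2)"
      using assms(3) by (intro AE_I2) (auto simp: abs_le_square_iff)
  qed (use assms in simp)
  then show ?thesis using assms by (simp add: square_integrable_def)
qed

lemma square_integrable_const: "square_integrable (\<lambda>t. c)"
  by (auto simp: square_integrable_def)

lemma square_integrable_abs: "square_integrable g \<Longrightarrow> square_integrable (\<lambda>t. \<bar>g t\<bar>)"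
  by (auto simp: square_integrable_def)

text \<open>
  The limit function is given pointwise, so that limits in \<open>H\<close> are obtained without appealing to
  completeness; both separability and compactness of integral operators use this.
\<close>

lemma abs_L2_dominated_convergence:
  assumes F: "\<And>n. F n \<in> borel_measurable unit_interval"
    and f: "f \<in> borel_measurable unit_interval"
    and g: "square_integrable g"
    and bound: "\<And>n t. t \<in> {0..1} \<Longrightarrow> \<bar>F n t\<bar> \<le> g t"
    and lim: "\<And>t. t \<in> {0..1} \<Longrightarrow> (\<lambda>n. F n t) \<longlonglongrightarrow> f t"
  shows "square_integrable f" "\<And>n. square_integrable (F n)" "(\<lambda>n. abs_L2 (F n)) \<longlonglongrightarrow> abs_L2 f"
proof -
  have bf: "\<bar>f t\<bar> \<le> g t" if "t \<in> {0..1}" for t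
    by (rule LIMSEQ_le_const2[OF tendsto_rabs[OF lim[OF that]]]) (use bound[OF that] in auto)
  have bg: "\<bar>F n t\<bar> \<le> \<bar>g t\<bar>" "\<bar>f t\<bar> \<le> \<bar>g t\<bar>" if "t \<in> {0..1}" for n t
    using bound[OF that, of n] bf[OF that] by auto
  show sf: "square_integrable f" and sF: "square_integrable (F n)" for n
    by (rule square_integrable_bound[OF _ g]; use F f bg in auto)+
  have "(\<lambda>n. LINT t|unit_interval. (F n t - f t)\<^sup>2) \<longlonglongrightarrow> (LINT t|unit_interval. 0)"
  proof (rule integral_dominated_convergence)
    show "integrable unit_interval (\<lambda>t. (2 * g t)\<^sup>2)"
      using square_integrable_scale[OF g, of 2] by (simp add: square_integrable_def)
    show "AE t in unit_interval. (\<lambda>n. (F n t - f t)\<^sup>2) \<longlonglongrightarrow> 0"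
    proof (rule AE_I2)
      fix t assume "t \<in> space unit_interval"
      then have "(\<lambda>n. F n t) \<longlonglongrightarrow> f t" using lim by simp
      then show "(\<lambda>n. (F n t - f t)\<^sup>2) \<longlonglongrightarrow> 0"
        by (intro tendsto_eq_intros | simp)+
    qed
    show "AE t in unit_interval. norm ((F n t - f t)\<^sup>2) \<le> (2 * g t)\<^sup>2" for n
    proof (rule AE_I2)
      fix t assume "t \<in> space unit_interval"
      then have "\<bar>F n t\<bar> \<le> g t" "\<bar>f t\<bar> \<le> g t" using bound bf by auto
      then have "\<bar>F n t - f t\<bar> \<le> \<bar>2 * g t\<bar>" by linarith
      then show "norm ((F n t - f t)\<^sup>2) \<le> (2 * g t)\<^sup>2" by (simp add: abs_le_square_iff)
    qed
  qed (use F f in auto)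
  then have "(\<lambda>n. (norm (abs_L2 (F n) - abs_L2 f))\<^sup>2) \<longlonglongrightarrow> 0"
    by (simp add: abs_L2_diff[symmetric] sF sf power2_norm_abs_L2 square_integrable_diff)
  then have "(\<lambda>n. sqrt ((norm (abs_L2 (F n) - abs_L2 f))\<^sup>2)) \<longlonglongrightarrow> sqrt 0"
    by (rule tendsto_real_sqrt)
  then have "(\<lambda>n. norm (abs_L2 (F n) - abs_L2 f)) \<longlonglongrightarrow> 0" by simp
  then show "(\<lambda>n. abs_L2 (F n)) \<longlonglongrightarrow> abs_L2 f"
    using Lim_null tendsto_norm_zero_iff by blast
qed

text \<open>
  The countable dense set: finite rational combinations of indicators of rational half-lines.
  Lists index the combinations so that countability is immediate.
\<close>

definition L2_step :: "(rat \<times> rat) list \<Rightarrow> L2" where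
  "L2_step xs = (\<Sum>(a, q)\<leftarrow>xs. of_rat a *\<^sub>R abs_L2 (indicator {..of_rat q}))"

lemma square_integrable_indicator:
  assumes "A \<in> sets borel" shows "square_integrable (indicator A)"
  by (rule square_integrable_bound[OF _ square_integrable_const[of 1]])
    (use assms in \<open>auto simp: indicator_def measurable_restrict_space1\<close>)

lemma zero_in_closure_range_L2_step: "0 \<in> closure (range L2_step)"
proof -
  have "0 = L2_step []" by (simp add: L2_step_def)
  then have "0 \<in> range L2_step" by (rule range_eqI)
  then show ?thesis by (rule subsetD[OF closure_subset])
qed

lemma closure_range_L2_step_add:
  assumes "x \<in> closure (range L2_step)" "y \<in> closure (range L2_step)"
  shows "x + y \<in> closure (range L2_step)"
proof -
  have "L2_step xs + L2_step ys = L2_step (xs @ ys)" for xs ys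
    by (simp add: L2_step_def)
  then have "{x + y |x y. x \<in> range L2_step \<and> y \<in> range L2_step} \<subseteq> range L2_step" by auto
  moreover obtain a where a: "\<And>n. a n \<in> range L2_step" "a \<longlonglongrightarrow> x" using assms(1) closure_sequential by meson
  moreover obtain b where b: "\<And>n. b n \<in> range L2_step" "b \<longlonglongrightarrow> y" using assms(2) closure_sequential by meson
  ultimately have "\<And>n. a n + b n \<in> range L2_step" "(\<lambda>n. a n + b n) \<longlonglongrightarrow> x + y"
    by (blast, intro tendsto_add)
  then show ?thesis
    unfolding closure_sequential by (intro exI[of _ "\<lambda>n. a n + b n"]) auto
qed

lemma closure_range_L2_step_scale:
  assumes "x \<in> closure (range L2_step)"
  shows "a *\<^sub>R x \<in> closure (range L2_step)"
proof -
  have rat: "of_rat r *\<^sub>R L2_step xs = L2_step (map (\<lambda>(a, q). (r * a, q)) xs)" for r xs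
    by (induction xs) (auto simp: L2_step_def of_rat_mult scaleR_add_right)
  have "a *\<^sub>R L2_step xs \<in> closure (range L2_step)" for xs
  proof -
    have "a \<in> closure \<rat>" using Rats_closure_real by simp
    then obtain b where b: "\<And>n. b n \<in> \<rat>" "b \<longlonglongrightarrow> a" using closure_sequential by metis
    have "b n *\<^sub>R L2_step xs \<in> range L2_step" for n
    proof -
      obtain r where "b n = of_rat r" using b(1)[of n] by (rule Rats_cases)
      then show ?thesis by (simp add: rat)
    qed
    moreover have "(\<lambda>n. b n *\<^sub>R L2_step xs) \<longlonglongrightarrow> a *\<^sub>R L2_step xs"
      using b(2) by (intro tendsto_intros)
    ultimately show ?thesis unfolding closure_sequential by (intro exI[of _ "\<lambda>n. b n *\<^sub>R L2_step xs"]) auto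
  qed
  then have "(\<lambda>x. a *\<^sub>R x) ` closure (range L2_step) \<subseteq> closure (range L2_step)"
    by (intro image_closure_subset) (auto intro!: continuous_intros)
  then show ?thesis using assms by auto
qed

lemma indicator_atMost_in_closure:
  "abs_L2 (indicator {..a}) \<in> closure (range L2_step)"
proof -
  have "\<exists>q. a < real_of_rat q \<and> real_of_rat q < a + 1 / real (Suc n)" for n
    using of_rat_dense[of a "a + 1 / real (Suc n)"] by auto
  then obtain q where q: "\<And>n. a < real_of_rat (q n)" "\<And>n. real_of_rat (q n) < a + 1 / real (Suc n)"
    by metis
  have lim: "(\<lambda>n. indicat_real {..real_of_rat (q n)} t) \<longlonglongrightarrow> indicator {..a} t" for t
  proof (cases "t \<le> a")
    case True
    then have "indicat_real {..real_of_rat (q n)} t = 1" for n using q(1)[of n] by auto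
    then show ?thesis using True by simp
  next
    case False
    have "(\<lambda>n. a + 1 / real (Suc n)) \<longlonglongrightarrow> a + 0"
      by (intro tendsto_add tendsto_const LIMSEQ_Suc[OF lim_1_over_n])
    then have "\<forall>\<^sub>F n in sequentially. a + 1 / real (Suc n) < t"
      using False by (intro order_tendstoD) auto
    then have "\<forall>\<^sub>F n in sequentially. indicat_real {..real_of_rat (q n)} t = indicator {..a} t"
    proof eventually_elim
      case (elim n)
      then show ?case using q(2)[of n] False by (auto simp: indicator_def)
    qed
    then show ?thesis by (rule tendsto_eventually)
  qed
  have "(\<lambda>n. abs_L2 (indicator {..real_of_rat (q n)})) \<longlonglongrightarrow> abs_L2 (indicator {..a})"
    by (rule abs_L2_dominated_convergence(3)[OF _ _ square_integrable_const[of 1]])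
      (use lim in \<open>auto simp: indicator_def measurable_restrict_space1\<close>)
  moreover have "abs_L2 (indicator {..real_of_rat (q n)}) = L2_step [(1, q n)]" for n
    by (simp add: L2_step_def)
  ultimately show ?thesis
    unfolding closure_sequential by (intro exI[of _ "\<lambda>n. L2_step [(1, q n)]"]) auto
qed

text \<open>
  Half-lines are stable under intersection and generate the Borel sets.  The sets whose indicator
  can be approximated are closed under complements within the unit interval and, by dominated
  convergence, under countable disjoint unions, so Dynkin's lemma applies.
\<close>

lemma indicator_in_closure:
  assumes "A \<in> sets borel"
  shows "abs_L2 (indicator A) \<in> closure (range L2_step)"
proof -
  have gen: "A \<in> sigma_sets UNIV (range (\<lambda>a. {..a::real}))"
    using assms by (simp add: borel_eq_atMost)
  have Int: "Int_stable (range (\<lambda>a. {..a::real}))"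
    by (auto simp: Int_stable_def)
  have borel: "B \<in> sets borel" if "B \<in> sigma_sets UNIV (range (\<lambda>a. {..a::real}))" for B
    using that by (simp add: borel_eq_atMost)
  have "range (\<lambda>a. {..a::real}) \<subseteq> Pow UNIV" by simp
  from Int this gen show ?thesis
  proof (induction rule: sigma_sets_induct_disjoint)
    case (basic A) then show ?case using indicator_atMost_in_closure by auto
  next
    case empty
    show ?case by (simp add: indicator_def abs_L2_zero zero_in_closure_range_L2_step)
  next
    case (compl A)
    have "abs_L2 (indicator (UNIV - A)) = abs_L2 (\<lambda>t. indicator {..1} t - indicator A t)"
    proof (subst abs_L2_eq_iff)
      show "AE t in unit_interval. indicat_real (UNIV - A) t = indicator {..1} t - indicator A t"
        by (rule AE_I2) (auto simp: indicator_def)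
    qed (use compl borel in \<open>auto intro!: square_integrable_indicator square_integrable_diff\<close>)
    also have "\<dots> = abs_L2 (indicator {..1}) + (-1) *\<^sub>R abs_L2 (indicator A)"
      using compl borel by (simp add: abs_L2_diff square_integrable_indicator)
    also have "\<dots> \<in> closure (range L2_step)"
      using compl by (intro closure_range_L2_step_add closure_range_L2_step_scale indicator_atMost_in_closure) auto
    finally show ?case .
  next
    case (union A)
    have A: "A i \<in> sets borel" for i using union borel by auto
    have sum: "(\<Sum>i<n. indicat_real (A i) t) = indicator (\<Union>i<n. A i) t" for n t
      using union(1) by (subst indicator_UN_disjoint) (auto simp: disjoint_family_on_def)
    have "(\<lambda>n. abs_L2 (\<lambda>t. \<Sum>i<n. indicator (A i) t)) \<longlonglongrightarrow> abs_L2 (indicator (\<Union>i. A i))"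
      unfolding sum
    proof (rule abs_L2_dominated_convergence(3)[OF _ _ square_integrable_const[of 1]])
      show "(\<lambda>n. indicat_real (\<Union>i<n. A i) t) \<longlonglongrightarrow> indicator (\<Union>i. A i) t" for t
        by (rule LIMSEQ_indicator_UN)
      show "\<bar>indicat_real (\<Union>i<n. A i) t\<bar> \<le> 1" for n t
        by (simp add: indicator_def)
    qed (use A in \<open>auto simp: measurable_restrict_space1\<close>)
    moreover have "abs_L2 (\<lambda>t. \<Sum>i<n. indicator (A i) t) \<in> closure (range L2_step)" for n
    proof (induction n)
      case 0
      show ?case by (simp add: abs_L2_zero zero_in_closure_range_L2_step)
    next
      case (Suc n)
      then show ?case
        using A union by (auto simp: abs_L2_add abs_L2_sum square_integrable_indicator intro!: closure_range_L2_step_add)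
    qed
    ultimately show ?case
      by (meson closed_closure closed_sequentially)
  qed
qed

lemma closure_range_L2_step: "closure (range L2_step) = UNIV"
proof -
  have "u \<in> closure (range L2_step)" for u
  proof -
    let ?f = "rep_L2 u"
    have f: "?f \<in> borel_measurable unit_interval" "square_integrable ?f"
      using square_integrable_rep_L2[of u] by (auto simp: square_integrable_def)
    obtain F where F: "\<And>i. simple_function unit_interval (F i)"
        "\<And>x. x \<in> space unit_interval \<Longrightarrow> (\<lambda>i. F i x) \<longlonglongrightarrow> ?f x"
        "\<And>i x. x \<in> space unit_interval \<Longrightarrow> dist (F i x) 0 \<le> 2 * dist (?f x) 0"
      using borel_measurable_implies_sequence_metric[OF f(1), of 0] by blast
    have "(\<lambda>n. abs_L2 (F n)) \<longlonglongrightarrow> abs_L2 ?f"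
      by (rule abs_L2_dominated_convergence(3)[where g = "\<lambda>t. 2 * \<bar>?f t\<bar>"])
        (use F f in \<open>auto intro!: square_integrable_scale square_integrable_abs borel_measurable_simple_function\<close>)
    moreover have "abs_L2 (F n) \<in> closure (range L2_step)" for n
    proof -
      define V where "V = F n ` {0..1}"
      have V: "finite V" using F(1)[of n] by (auto simp: V_def simple_function_def)
      have S: "F n -` {y} \<inter> {0..1} \<in> sets borel" for y
      proof (cases "y \<in> V")
        case True
        then have "F n -` {y} \<inter> {0..1} \<in> sets unit_interval"
          using F(1)[of n] by (auto simp: V_def simple_function_def)
        then show ?thesis by (auto simp: sets_restrict_space)
      next
        case False
        then have "F n -` {y} \<inter> {0..1} = {}" by (auto simp: V_def)
        then show ?thesis by (simp del: vimage_eq)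
      qed
      have sq: "square_integrable (\<lambda>t. y * indicator (F n -` {y} \<inter> {0..1}) t)" for y
        by (intro square_integrable_scale square_integrable_indicator S)
      have sF: "square_integrable (F n)"
        by (rule square_integrable_bound[where g = "\<lambda>t. 2 * \<bar>?f t\<bar>"])
         (use F f in \<open>auto intro!: square_integrable_scale square_integrable_abs borel_measurable_simple_function\<close>)
      have "abs_L2 (F n) = abs_L2 (\<lambda>t. \<Sum>y\<in>V. y * indicator (F n -` {y} \<inter> {0..1}) t)"
      proof (subst abs_L2_eq_iff)
        show "AE t in unit_interval. F n t = (\<Sum>y\<in>V. y * indicator (F n -` {y} \<inter> {0..1}) t)"
        proof (rule AE_I2)
          fix t assume t: "t \<in> space unit_interval"
          have "(\<Sum>y\<in>V. y * indicator (F n -` {y} \<inter> {0..1}) t) = (\<Sum>y\<in>V. if y = F n t then y else 0)"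
            using t by (intro sum.cong) (auto simp: indicator_def)
          also have "\<dots> = F n t" using t V by (auto simp: V_def)
          finally show "F n t = (\<Sum>y\<in>V. y * indicator (F n -` {y} \<inter> {0..1}) t)" ..
        qed
      qed (use abs_L2_sum[OF V sq] sF in auto)
      also have "\<dots> = (\<Sum>y\<in>V. y *\<^sub>R abs_L2 (indicator (F n -` {y} \<inter> {0..1})))"
        using abs_L2_sum[OF V sq] by (simp add: abs_L2_scale square_integrable_indicator S)
      also have "\<dots> \<in> closure (range L2_step)"
        using V
      proof (induction V)
        case empty
        show ?case by (simp add: zero_in_closure_range_L2_step)
      next
        case (insert y V)
        show ?case
          unfolding sum.insert[OF insert(1,2)]
          apply (rule closure_range_L2_step_add)
           apply (rule closure_range_L2_step_scale)
           apply (rule indicator_in_closure)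
           apply (rule S)
          apply (rule insert(3))
          done
      qed
      finally show ?thesis .
    qed
    ultimately have "abs_L2 ?f \<in> closure (range L2_step)"
      by (meson closed_closure closed_sequentially)
    then show ?thesis by simp
  qed
  then show ?thesis by auto
qed

text \<open>
  Separability makes the Borel sets of \<open>H \<times> H\<close> coincide with the product \<open>\<sigma>\<close>-algebra.  Hence sums,
  differences and inner products of \<open>H\<close>-valued random elements are measurable.
\<close>

instance L2 :: second_countable_topology
proof
  let ?B = "(\<lambda>(xs, r). ball (L2_step xs) (real_of_rat r)) ` UNIV"
  have "topological_basis ?B"
  proof (rule topological_basisI)
    fix O' :: "L2 set" and u assume "open O'" "u \<in> O'"
    then obtain e where e: "e > 0" "ball u e \<subseteq> O'" by (auto simp: open_contains_ball)
    obtain r where r: "0 < real_of_rat r" "real_of_rat r < e / 2" using of_rat_dense[of 0 "e/2"] e by auto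
    have "u \<in> closure (range L2_step)" using closure_range_L2_step by simp
    then obtain xs where xs: "dist (L2_step xs) u < real_of_rat r"
      using r unfolding closure_approachable by blast
    have "ball (L2_step xs) (real_of_rat r) \<subseteq> ball u e"
    proof
      fix y assume "y \<in> ball (L2_step xs) (real_of_rat r)"
      then have "dist (L2_step xs) y < real_of_rat r" by simp
      then have "dist u y < e" using xs r dist_triangle[of u y "L2_step xs"] by (simp add: dist_commute)
      then show "y \<in> ball u e" by simp
    qed
    then show "\<exists>B'\<in>?B. u \<in> B' \<and> B' \<subseteq> O'"
      using xs e by (intro bexI[of _ "ball (L2_step xs) (real_of_rat r)"]) auto
  qed auto
  then show "\<exists>B::L2 set set. countable B \<and> open = generate_topology B"
    by (intro exI[of _ ?B]) (auto intro!: topological_basis_imp_subbasis)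
qed

section \<open>Perturbation of eigenvalues and eigenvectors\<close>

text \<open>
  The ambient inner product space may be incomplete, where totally bounded image sets need not
  have limit points.  For that reason the existence of the limit \<open>g\<close> belongs to the assumption.
\<close>

locale compact_selfadjoint =
  fixes T :: "'a::real_inner \<Rightarrow> 'a"
  assumes bounded_linear: "bounded_linear T"
    and selfadjoint: "inner (T x) y = inner x (T y)"
    and compact: "(\<And>n::nat. norm (u n) \<le> 1) \<Longrightarrow>
      \<exists>r g. strict_mono (r :: nat \<Rightarrow> nat) \<and> (\<lambda>n. T (u (r n))) \<longlonglongrightarrow> g"

lemma eigensystemD:
  assumes "eigensystem T l v"
  shows "1 \<le> i \<Longrightarrow> T (v i) = l i *\<^sub>R v i"
    and "1 \<le> i \<Longrightarrow> 1 \<le> k \<Longrightarrow> inner (v i) (v k) = (if i = k then 1 else 0)"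
    and "1 \<le> i \<Longrightarrow> norm (v i) = 1"
    and "\<mu> \<noteq> 0 \<Longrightarrow> T u = \<mu> *\<^sub>R u \<Longrightarrow> u \<in> span {v i |i. 1 \<le> i \<and> l i = \<mu>}"
  using assms by (auto simp: eigensystem_def norm_eq_sqrt_inner)

lemma eigensystem_decreasing:
  assumes "eigensystem T l v" "1 \<le> i" "i \<le> k"
  shows "l k \<le> l i"
  using assms(3)
proof (induction rule: dec_induct)
  case (step n)
  then have "l (Suc n) \<le> l n" using assms by (simp add: eigensystem_def)
  then show ?case using step by simp
qed simp

lemma inner_eigencombination:
  assumes "eigensystem T l v" "I \<subseteq> {1..}" "finite I"
  shows "inner (\<Sum>i\<in>I. a i *\<^sub>R v i) (\<Sum>i\<in>I. b i *\<^sub>R v i) = (\<Sum>i\<in>I. a i * b i)"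
proof -
  have "inner (\<Sum>i\<in>I. a i *\<^sub>R v i) (\<Sum>i\<in>I. b i *\<^sub>R v i) = (\<Sum>i\<in>I. \<Sum>k\<in>I. a i * (b k * inner (v i) (v k)))"
    by (simp only: inner_sum_left inner_scaleR_left) (simp only: inner_sum_right inner_scaleR_right sum_distrib_left)
  also have "\<dots> = (\<Sum>i\<in>I. \<Sum>k\<in>I. if k = i then a i * b i else 0)"
    using assms(2) by (intro sum.cong refl) (auto simp: eigensystemD(2)[OF assms(1)] subset_iff)
  finally show ?thesis using assms(3) by simp
qed

lemma inner_eigencombination_orthogonal:
  assumes "\<And>i. i \<in> I \<Longrightarrow> inner (v i) u = 0"
  shows "inner (\<Sum>i\<in>I. a i *\<^sub>R v i) u = 0"
  using assms by (simp add: inner_sum_left)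

lemma eigencombination_image:
  assumes "linear T" "eigensystem T l v" "I \<subseteq> {1..}"
  shows "T (\<Sum>i\<in>I. a i *\<^sub>R v i) = (\<Sum>i\<in>I. (a i * l i) *\<^sub>R v i)"
  using assms(3) by (auto simp: linear_sum[OF assms(1)] linear_scale[OF assms(1)]
      eigensystemD(1)[OF assms(2)] subset_iff intro!: sum.cong)

context compact_selfadjoint
begin

lemma linear: "linear T"
  using bounded_linear by (rule bounded_linear.linear)

text \<open>
  An eigensystem is infinite.  If \<open>l j\<close> were negative, the images of \<open>v j, v (j+1), \<dots>\<close> would be
  orthogonal vectors of norm at least \<open>\<bar>l j\<bar>\<close>, which have no convergent subsequence.
\<close>

lemma eigenvalue_nonneg:
  assumes es: "eigensystem T l v" and j: "1 \<le> j"
  shows "0 \<le> l j"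
proof (rule ccontr)
  assume "\<not> 0 \<le> l j"
  then have neg: "l j < 0" by simp
  have "norm (v (j + n)) \<le> 1" for n
    using eigensystemD(3)[OF es, of "j + n"] j by simp
  then obtain r g where r: "strict_mono r" and g: "(\<lambda>n. T (v (j + r n))) \<longlonglongrightarrow> g"
    using compact[of "\<lambda>n. v (j + n)"] by auto
  have "Cauchy (\<lambda>n. T (v (j + r n)))" using g by (rule LIMSEQ_imp_Cauchy)
  then obtain M where M: "\<And>m n. m \<ge> M \<Longrightarrow> n \<ge> M \<Longrightarrow> norm (T (v (j + r m)) - T (v (j + r n))) < - l j"
    using neg unfolding Cauchy_iff by (metis neg_0_less_iff_less)
  define a where "a = j + r M"
  define b where "b = j + r (Suc M)"
  have ab: "1 \<le> a" "1 \<le> b" "a \<noteq> b" "j \<le> a" "j \<le> b"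
    using j strict_monoD[OF r, of M "Suc M"] by (auto simp: a_def b_def)
  have la: "l a \<le> l j" "l b \<le> l j" using eigensystem_decreasing[OF es j] ab by auto
  have "(norm (T (v a) - T (v b)))\<^sup>2 = (l a)\<^sup>2 + (l b)\<^sup>2"
    unfolding power2_norm_eq_inner using ab
    by (simp add: eigensystemD(1)[OF es] inner_diff_left inner_diff_right eigensystemD(2)[OF es] power2_eq_square)
  moreover have "(l j)\<^sup>2 \<le> (l a)\<^sup>2" using la(1) neg by (simp add: power2_le_iff_abs_le abs_le_square_iff[symmetric])
  ultimately have "(- l j)\<^sup>2 \<le> (norm (T (v a) - T (v b)))\<^sup>2"
    using zero_le_power2[of "l b"] power2_minus[of "l j"] by linarith
  then have "- l j \<le> norm (T (v a) - T (v b))" by (rule power2_le_imp_le) simp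
  then show False using M[of M "Suc M"] by (simp add: a_def b_def)
qed

text \<open>
  The upper half of the Courant--Fischer principle.  On the orthogonal complement \<open>V\<close> of the first
  \<open>j - 1\<close> eigenvectors let \<open>s\<close> be the supremum of the Rayleigh quotient and suppose \<open>l j < s\<close>.  For a
  maximising sequence \<open>x n\<close> the residual \<open>w n = s x n - T (x n)\<close> tends to zero, so by compactness a
  subsequence of \<open>x n\<close> converges to a unit eigenvector in \<open>V\<close> for the eigenvalue \<open>s\<close>.  As \<open>s\<close> is
  nonzero and larger than \<open>l j\<close>, an eigensystem places this vector in the span of eigenvectors with
  index below \<open>j\<close>, to which it is orthogonal.
\<close>

lemma rayleigh_le_eigenvalue:
  assumes es: "eigensystem T l v" and j: "1 \<le> j"
    and u: "\<And>i. 1 \<le> i \<Longrightarrow> i < j \<Longrightarrow> inner u (v i) = 0"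
  shows "inner (T u) u \<le> l j * (norm u)\<^sup>2"
proof (rule ccontr)
  assume contra: "\<not> ?thesis"
  define V where "V = {x. \<forall>i. 1 \<le> i \<and> i < j \<longrightarrow> inner x (v i) = 0}"
  have VT: "T x \<in> V" if "x \<in> V" for x
    using that by (auto simp: V_def selfadjoint eigensystemD(1)[OF es])
  have Vadd: "x - c *\<^sub>R y \<in> V" if "x \<in> V" "y \<in> V" for x y c
    using that by (auto simp: V_def inner_diff_left)
  have V0: "c *\<^sub>R x \<in> V" if "x \<in> V" for x c using that by (auto simp: V_def)
  obtain h where h: "h > 0" "\<And>x. norm (T x) \<le> h * norm x"
    using bounded_linear.pos_bounded[OF bounded_linear] by (metis mult.commute)
  define Q where "Q = {inner (T x) x |x. x \<in> V \<and> norm x = 1}"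
  define s where "s = Sup Q"
  have Qbound: "q \<le> h" if "q \<in> Q" for q
  proof -
    obtain x where x: "q = inner (T x) x" "norm x = 1" using \<open>q \<in> Q\<close> by (auto simp: Q_def)
    have "inner (T x) x \<le> norm (T x) * norm x" by (rule norm_cauchy_schwarz)
    then show ?thesis using h(2)[of x] x by simp
  qed
  then have bdd: "bdd_above Q" by (meson bdd_aboveI)
  have upper: "inner (T x) x \<le> s * (norm x)\<^sup>2" if "x \<in> V" for x
  proof (cases "x = 0")
    case True then show ?thesis by (simp add: linear_0[OF linear])
  next
    case False
    have "inner (T ((1 / norm x) *\<^sub>R x)) ((1 / norm x) *\<^sub>R x) \<in> Q"
      unfolding Q_def using V0[OF that] False by (intro CollectI exI[of _ "(1 / norm x) *\<^sub>R x"]) auto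
    then have "inner (T ((1 / norm x) *\<^sub>R x)) ((1 / norm x) *\<^sub>R x) \<le> s"
      unfolding s_def using bdd by (rule cSup_upper)
    then show ?thesis using False
      by (simp add: linear_scale[OF linear] power2_eq_square field_simps)
  qed
  have uV: "u \<in> V" using u by (auto simp: V_def)
  have "u \<noteq> 0" using contra by (auto simp: linear_0[OF linear])
  have "l j * (norm u)\<^sup>2 < s * (norm u)\<^sup>2" using upper[OF uV] contra by simp
  then have s: "l j < s" by (simp add: mult_less_cancel_right)
  then have s0: "0 < s" using eigenvalue_nonneg[OF es j] by simp
  have "v j \<in> V" using j by (auto simp: V_def eigensystemD(2)[OF es])
  then have Qne: "Q \<noteq> {}" using eigensystemD(3)[OF es j] by (auto simp: Q_def)
  have "\<exists>x. x \<in> V \<and> norm x = 1 \<and> s - 1 / real (Suc n) < inner (T x) x" for n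
  proof -
    have "s - 1 / real (Suc n) < Sup Q" by (simp add: s_def)
    then obtain q where "q \<in> Q" "s - 1 / real (Suc n) < q" using less_cSupE[OF _ Qne] by metis
    then show ?thesis by (auto simp: Q_def)
  qed
  then obtain x where x: "\<And>n. x n \<in> V" "\<And>n. norm (x n) = 1"
      "\<And>n. s - 1 / real (Suc n) < inner (T (x n)) (x n)" by metis
  define w where "w n = s *\<^sub>R x n - T (x n)" for n
  have w_bound: "(norm (w n))\<^sup>2 \<le> (s + h) * (1 / real (Suc n))" for n
  proof -
    (* Cauchy--Schwarz for the form B, which is nonnegative on V: expand B at x n - c w n; this
       choice of c minimises the resulting bound. *)
    define B where "B y z = s * inner y z - inner (T y) z" for y z
    define c where "c = 1 / (s + h)"
    have c: "c > 0" "c * (s + h) = 1" using s0 h by (auto simp: c_def)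
    have Bx: "B (x n) y = inner (w n) y" and xB: "B y (x n) = inner y (w n)" for y
      by (simp_all add: B_def w_def inner_diff_left inner_diff_right selfadjoint)
    have wV: "w n \<in> V" unfolding w_def
      using Vadd[OF V0[OF x(1)[of n], of s] VT[OF x(1)[of n]], of 1] by simp
    have "0 \<le> B (x n - c *\<^sub>R w n) (x n - c *\<^sub>R w n)"
      unfolding B_def using upper[OF Vadd[OF x(1)[of n] wV, of c]] by (simp add: power2_norm_eq_inner)
    also have "\<dots> = B (x n) (x n) - c * B (x n) (w n) - c * B (w n) (x n) + c\<^sup>2 * B (w n) (w n)"
      by (simp add: B_def linear_diff[OF linear] linear_scale[OF linear] inner_diff_left inner_diff_right
          power2_eq_square algebra_simps)
    also have "B (x n) (w n) = (norm (w n))\<^sup>2"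
      unfolding power2_norm_eq_inner Bx ..
    also have "B (w n) (x n) = (norm (w n))\<^sup>2"
      unfolding power2_norm_eq_inner xB ..
    also have "c\<^sup>2 * B (w n) (w n) \<le> c * (norm (w n))\<^sup>2"
    proof -
      have "- inner (T (w n)) (w n) \<le> norm (T (w n)) * norm (w n)"
        using Cauchy_Schwarz_ineq2[of "T (w n)" "w n"] by linarith
      also have "\<dots> \<le> h * norm (w n) * norm (w n)"
        by (rule mult_right_mono[OF h(2)]) simp
      finally have "B (w n) (w n) \<le> (s + h) * (norm (w n))\<^sup>2"
        by (simp add: B_def power2_norm_eq_inner[symmetric] power2_eq_square algebra_simps)
      then have "c\<^sup>2 * B (w n) (w n) \<le> c\<^sup>2 * ((s + h) * (norm (w n))\<^sup>2)"
        by (intro mult_left_mono) auto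
      also have "\<dots> = c * (norm (w n))\<^sup>2"
        using c by (simp add: power2_eq_square)
      finally show ?thesis .
    qed
    finally have "c * (norm (w n))\<^sup>2 \<le> B (x n) (x n)" by simp
    also have "\<dots> \<le> 1 / real (Suc n)"
      using x(3)[of n] x(2)[of n] by (simp add: B_def power2_norm_eq_inner[symmetric])
    finally have "(s + h) * (c * (norm (w n))\<^sup>2) \<le> (s + h) * (1 / real (Suc n))"
      using s0 h by (intro mult_left_mono) auto
    then show ?thesis using c by (simp add: mult.assoc[symmetric] mult.commute)
  qed
  have "(\<lambda>n. (norm (w n))\<^sup>2) \<longlonglongrightarrow> 0"
  proof (rule tendsto_sandwich[OF _ _ tendsto_const])
    show "(\<lambda>n. (s + h) * (1 / real (Suc n))) \<longlonglongrightarrow> 0"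
      using tendsto_mult[OF tendsto_const LIMSEQ_Suc[OF lim_1_over_n], of "s + h"] by simp
  qed (use w_bound in auto)
  from tendsto_real_sqrt[OF this] have w0: "w \<longlonglongrightarrow> 0"
    by (simp add: tendsto_norm_zero_iff)
  obtain r g where r: "strict_mono r" and g: "(\<lambda>n. T (x (r n))) \<longlonglongrightarrow> g"
    using compact[of x] x(2) by auto
  define y where "y = (1 / s) *\<^sub>R g"
  have "(\<lambda>n. (1 / s) *\<^sub>R (T (x (r n)) + w (r n))) \<longlonglongrightarrow> (1 / s) *\<^sub>R (g + 0)"
    using LIMSEQ_subseq_LIMSEQ[OF w0 r] g by (intro tendsto_intros) (auto simp: o_def)
  then have xy: "(\<lambda>n. x (r n)) \<longlonglongrightarrow> y"
    using s0 by (simp add: w_def y_def)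
  have "(\<lambda>n. norm (x (r n))) \<longlonglongrightarrow> norm y" using xy by (rule tendsto_norm)
  then have ny: "norm y = 1" using x(2) by (simp add: LIMSEQ_const_iff)
  have yV: "inner y (v i) = 0" if "1 \<le> i" "i < j" for i
  proof -
    have "(\<lambda>n. inner (x (r n)) (v i)) \<longlonglongrightarrow> inner y (v i)" by (intro tendsto_intros xy)
    moreover have "inner (x (r n)) (v i) = 0" for n using x(1)[of "r n"] that by (simp add: V_def)
    ultimately show ?thesis by (simp add: LIMSEQ_const_iff)
  qed
  have "(\<lambda>n. T (x (r n))) \<longlonglongrightarrow> T y" using bounded_linear.tendsto[OF bounded_linear xy] .
  then have "T y = g" using g LIMSEQ_unique by blast
  then have "T y = s *\<^sub>R y" using s0 by (simp add: y_def)
  then have "y \<in> span {v i |i. 1 \<le> i \<and> l i = s}" using eigensystemD(4)[OF es] s0 by auto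
  moreover have "\<forall>z\<in>{v i |i. 1 \<le> i \<and> l i = s}. orthogonal y z"
  proof safe
    fix i assume i: "(1::nat) \<le> i" "s = l i"
    have "i < j"
    proof (rule ccontr)
      assume "\<not> i < j"
      then have "l i \<le> l j" using eigensystem_decreasing[OF es j] by simp
      then show False using s i by simp
    qed
    then show "orthogonal y (v i)" using yV i by (simp add: orthogonal_def)
  qed
  ultimately have "orthogonal y y" using orthogonal_to_span by blast
  then show False using ny by (simp add: orthogonal_def)
qed

end

text \<open>
  A dimension count: the projection onto the span of \<open>j - 1\<close> vectors cannot be injective on a space
  of dimension \<open>j\<close>.
\<close>

lemma exists_eigencombination_orthogonal:
  assumes es: "eigensystem T l v" and es': "eigensystem T' l' v'" and j: "1 \<le> j"
  obtains a where "(\<Sum>i\<in>{1..j}. (a i)\<^sup>2) \<noteq> 0"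
    "\<And>k. 1 \<le> k \<Longrightarrow> k < j \<Longrightarrow> inner (\<Sum>i\<in>{1..j}. a i *\<^sub>R v i) (v' k) = 0"
proof -
  define P where "P u = (\<Sum>k\<in>{1..<j}. inner u (v' k) *\<^sub>R v' k)" for u
  let ?S = "v ` {1..j}"
  have injv: "inj_on v {1..j}"
  proof (rule inj_onI)
    fix i k assume "i \<in> {1..j}" "k \<in> {1..j}" "v i = v k"
    then show "i = k" using eigensystemD(2)[OF es, of i k] eigensystemD(2)[OF es, of i i] by (auto split: if_splits)
  qed
  have lin: "linear P" unfolding P_def
    by (rule linearI) (simp_all add: inner_add_left scaleR_add_left sum.distrib scaleR_sum_right)
  have ind: "independent ?S"
  proof (rule pairwise_orthogonal_independent)
    show "pairwise orthogonal ?S"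
      by (auto simp: pairwise_def orthogonal_def eigensystemD(2)[OF es])
    show "0 \<notin> ?S"
    proof
      assume "0 \<in> ?S"
      then obtain i where "1 \<le> i" "v i = 0" by auto
      then show False using eigensystemD(3)[OF es, of i] by simp
    qed
  qed
  have "\<not> inj_on P (span ?S)"
  proof
    assume inj: "inj_on P (span ?S)"
    have "independent (P ` ?S)"
      using linear_independent_injective_image[OF lin ind inj] .
    moreover have "P ` ?S \<subseteq> span (v' ` {1..<j})"
      unfolding P_def image_subset_iff by (intro ballI span_sum span_scale span_base imageI)
    ultimately have "card (P ` ?S) \<le> card (v' ` {1..<j})"
      using independent_span_bound[of "v' ` {1..<j}"] by simp
    moreover have "card (P ` ?S) = j"
      using inj_on_subset[OF inj span_superset] injv by (simp add: card_image)
    moreover have "card (v' ` {1..<j}) \<le> j - 1" using card_image_le[of "{1..<j}" v'] by simp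
    ultimately show False using j by simp
  qed
  then obtain x y where xy: "x \<in> span ?S" "y \<in> span ?S" "x \<noteq> y" "P x = P y"
    unfolding inj_on_def by blast
  define u where "u = x - y"
  have "u \<in> span ?S" using xy by (simp add: u_def span_diff)
  then obtain b where "u = (\<Sum>z\<in>?S. b z *\<^sub>R z)" using span_finite[of ?S] by auto
  then have u: "u = (\<Sum>i\<in>{1..j}. b (v i) *\<^sub>R v i)" using sum.reindex[OF injv] by simp
  have "inner u (v' k) = 0" if k: "1 \<le> k" "k < j" for k
  proof -
    have "inner (P u) (v' k) = (\<Sum>i\<in>{1..<j}. if i = k then inner u (v' k) else 0)"
      unfolding P_def inner_sum_left using k by (intro sum.cong) (auto simp: eigensystemD(2)[OF es'])
    also have "\<dots> = inner u (v' k)" using k by simp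
    finally show ?thesis using xy by (simp add: u_def linear_diff[OF lin])
  qed
  moreover have "(\<Sum>i\<in>{1..j}. (b (v i))\<^sup>2) \<noteq> 0"
  proof
    assume "(\<Sum>i\<in>{1..j}. (b (v i))\<^sup>2) = 0"
    then have "\<forall>i\<in>{1..j}. b (v i) = 0" by (subst (asm) sum_nonneg_eq_0_iff) auto
    then have "u = 0" using u by simp
    then show False using xy by (simp add: u_def)
  qed
  ultimately show thesis using that[of "\<lambda>i. b (v i)"] u by simp
qed

text \<open>
  Weyl's inequality.  On a vector of the span of \<open>v 1, \<dots>, v j\<close> orthogonal to
  \<open>v' 1, \<dots>, v' (j - 1)\<close> the Rayleigh quotient of \<open>T\<close> is at least \<open>l j\<close>, and that of \<open>T'\<close> is at most
  \<open>l' j\<close>.  The two quotients differ by at most \<open>h\<close>.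
\<close>

lemma eigenvalue_perturbation:
  assumes T: "linear T" "eigensystem T l v"
    and T': "compact_selfadjoint T'" "eigensystem T' l' v'"
    and h: "\<And>u. norm (T u - T' u) \<le> h * norm u" and j: "1 \<le> j"
  shows "l j - l' j \<le> h"
proof -
  obtain a where a: "(\<Sum>i\<in>{1..j}. (a i)\<^sup>2) \<noteq> 0"
    "\<And>k. 1 \<le> k \<Longrightarrow> k < j \<Longrightarrow> inner (\<Sum>i\<in>{1..j}. a i *\<^sub>R v i) (v' k) = 0"
    using exists_eigencombination_orthogonal[OF T(2) T'(2) j] by blast
  define u where "u = (\<Sum>i\<in>{1..j}. a i *\<^sub>R v i)"
  have I: "{1..j} \<subseteq> {1..}" "finite {1..j}" by auto
  have nu: "(norm u)\<^sup>2 = (\<Sum>i\<in>{1..j}. (a i)\<^sup>2)"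
    unfolding power2_norm_eq_inner u_def inner_eigencombination[OF T(2) I] by (simp add: power2_eq_square)
  have "l j * (norm u)\<^sup>2 \<le> (\<Sum>i\<in>{1..j}. a i * l i * a i)"
    unfolding nu sum_distrib_left
  proof (rule sum_mono)
    fix i assume "i \<in> {1..j}"
    then have "l j \<le> l i" using eigensystem_decreasing[OF T(2), of i j] by simp
    then have "l j * (a i)\<^sup>2 \<le> l i * (a i)\<^sup>2" by (rule mult_right_mono) simp
    then show "l j * (a i)\<^sup>2 \<le> a i * l i * a i" by (simp add: power2_eq_square mult_ac)
  qed
  also have "\<dots> = inner (T u) u"
    unfolding u_def eigencombination_image[OF T I(1)] inner_eigencombination[OF T(2) I] ..
  also have "\<dots> = inner (T' u) u + inner (T u - T' u) u" by (simp add: inner_diff_left)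
  also have "inner (T' u) u \<le> l' j * (norm u)\<^sup>2"
    using compact_selfadjoint.rayleigh_le_eigenvalue[OF T' j] a(2) by (simp add: u_def)
  also have "inner (T u - T' u) u \<le> h * (norm u)\<^sup>2"
  proof -
    have "inner (T u - T' u) u \<le> norm (T u - T' u) * norm u" by (rule norm_cauchy_schwarz)
    also have "\<dots> \<le> h * norm u * norm u" by (rule mult_right_mono[OF h]) simp
    finally show ?thesis by (simp add: power2_eq_square)
  qed
  finally have "l j * (norm u)\<^sup>2 \<le> (l' j + h) * (norm u)\<^sup>2" by (simp add: distrib_right)
  moreover have "(norm u)\<^sup>2 > 0" using a(1) nu by (metis zero_less_power2 power_zero_numeral)
  ultimately have "l j \<le> l' j + h" by simp
  then show ?thesis by simp
qed

text \<open>
  Let \<open>w\<close> be the part of \<open>u\<close> orthogonal to \<open>v j\<close>, split as \<open>w = p + r\<close> with \<open>p\<close> in the span of the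
  eigenvectors of index below \<open>j\<close>.  On \<open>p\<close> the form of \<open>T - l j\<close> is at least \<open>\<alpha>\<close>, on \<open>r\<close> it is at most
  \<open>-\<alpha>\<close>, and the mixed terms vanish.  Testing \<open>(T - l j) w\<close> against \<open>p - r\<close>, which has the same norm
  as \<open>w\<close>, therefore gives \<open>\<alpha> \<parallel>w\<parallel> \<le> \<parallel>(T - l j) u\<parallel> \<le> 2 h\<close>.  Finally
  \<open>\<parallel>sgn a u - v j\<parallel>\<^sup>2 \<le> 2 (1 - a\<^sup>2) = 2 \<parallel>w\<parallel>\<^sup>2\<close> with \<open>a = \<langle>u, v j\<rangle>\<close>; for \<open>a = 0\<close>, where the sign is zero,
  the left-hand side is \<open>1\<close>.
\<close>

lemma eigenvector_perturbation:
  fixes v :: "nat \<Rightarrow> 'a::real_inner"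
  assumes T: "compact_selfadjoint T" "eigensystem T l v" and j: "1 \<le> j"
    and gap: "\<alpha> > 0" "\<And>i. 1 \<le> i \<Longrightarrow> i < j \<Longrightarrow> \<alpha> \<le> l i - l j" "\<alpha> \<le> l j - l (Suc j)"
    and u: "norm u = 1" "T' u = l' *\<^sub>R u"
    and h: "norm (T u - T' u) \<le> h" "\<bar>l j - l'\<bar> \<le> h"
  shows "(norm (sgn (inner u (v j)) *\<^sub>R u - v j))\<^sup>2 \<le> 8 / \<alpha>\<^sup>2 * h\<^sup>2"
proof -
  interpret compact_selfadjoint T by fact
  define a where "a = inner u (v j)"
  define w where "w = u - a *\<^sub>R v j"
  define p where "p = (\<Sum>i\<in>{1..<j}. inner u (v i) *\<^sub>R v i)"
  define r where "r = w - p"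
  have I: "{1..<j} \<subseteq> {1..}" "finite {1..<j}" by auto
  have vj: "inner (v j) (v j) = 1" using eigensystemD(2)[OF T(2) j j] by simp
  have wj: "inner w (v j) = 0" by (simp add: w_def inner_diff_left a_def vj)
  have wi: "inner w (v i) = inner u (v i)" if "1 \<le> i" "i < j" for i
    using that by (simp add: w_def inner_diff_left eigensystemD(2)[OF T(2)])
  have pi: "inner p (v i) = (if i < j then inner u (v i) else 0)" if "1 \<le> i" for i
  proof -
    have "inner p (v i) = (\<Sum>k\<in>{1..<j}. if k = i then inner u (v i) else 0)"
      unfolding p_def inner_sum_left using that by (intro sum.cong) (auto simp: eigensystemD(2)[OF T(2)])
    then show ?thesis using that by simp
  qed
  have ri: "inner (v i) r = 0" if "1 \<le> i" "i \<le> j" for i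
    using that wi pi[of i] wj by (cases "i = j") (auto simp: r_def inner_diff_left inner_diff_right inner_commute)
  have Tp: "T p = (\<Sum>i\<in>{1..<j}. (inner u (v i) * l i) *\<^sub>R v i)"
    unfolding p_def by (rule eigencombination_image[OF linear T(2) I(1)])
  have pr: "inner p r = 0" unfolding p_def
    by (rule inner_eigencombination_orthogonal) (use ri in auto)
  have Tpr: "inner (T p) r = 0" unfolding Tp
    by (rule inner_eigencombination_orthogonal) (use ri in auto)
  have np: "(norm p)\<^sup>2 = (\<Sum>i\<in>{1..<j}. (inner u (v i))\<^sup>2)"
    unfolding power2_norm_eq_inner p_def inner_eigencombination[OF T(2) I] by (simp add: power2_eq_square)
  have p_part: "\<alpha> * (norm p)\<^sup>2 \<le> inner (T p) p - l j * (norm p)\<^sup>2"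
  proof -
    have "inner (T p) p = (\<Sum>i\<in>{1..<j}. l i * (inner u (v i))\<^sup>2)"
      unfolding Tp unfolding p_def inner_eigencombination[OF T(2) I] by (simp add: power2_eq_square mult_ac)
    moreover
    have "(\<Sum>i\<in>{1..<j}. (\<alpha> + l j) * (inner u (v i))\<^sup>2) \<le> (\<Sum>i\<in>{1..<j}. l i * (inner u (v i))\<^sup>2)"
    proof (rule sum_mono)
      fix i assume "i \<in> {1..<j}"
      then have "\<alpha> + l j \<le> l i" using gap(2)[of i] by simp
      then show "(\<alpha> + l j) * (inner u (v i))\<^sup>2 \<le> l i * (inner u (v i))\<^sup>2" by (rule mult_right_mono) simp
    qed
    then have "(\<alpha> + l j) * (norm p)\<^sup>2 \<le> (\<Sum>i\<in>{1..<j}. l i * (inner u (v i))\<^sup>2)"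
      unfolding np sum_distrib_left .
    ultimately show ?thesis by (simp only: distrib_right)
  qed
  have r_part: "\<alpha> * (norm r)\<^sup>2 \<le> l j * (norm r)\<^sup>2 - inner (T r) r"
  proof -
    have "inner (T r) r \<le> l (Suc j) * (norm r)\<^sup>2"
      by (rule rayleigh_le_eigenvalue[OF T(2)]) (use ri in \<open>auto simp: inner_commute\<close>)
    also have "\<dots> \<le> (l j - \<alpha>) * (norm r)\<^sup>2" using gap(3) by (intro mult_right_mono) auto
    finally show ?thesis by (simp add: left_diff_distrib)
  qed
  have w: "w = p + r" by (simp add: r_def)
  have nw: "(norm w)\<^sup>2 = (norm p)\<^sup>2 + (norm r)\<^sup>2" "(norm (p - r))\<^sup>2 = (norm p)\<^sup>2 + (norm r)\<^sup>2"
    using pr unfolding power2_norm_eq_inner w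
    by (auto simp: inner_add_left inner_add_right inner_diff_left inner_diff_right inner_commute)
  then have npr: "norm (p - r) = norm w" by (metis norm_ge_zero power2_eq_imp_eq)
  have "\<alpha> * (norm w)\<^sup>2 \<le> inner (T w - l j *\<^sub>R w) (p - r)"
  proof -
    have "inner (T w - l j *\<^sub>R w) (p - r) =
       (inner (T p) p - l j * (norm p)\<^sup>2) + (l j * (norm r)\<^sup>2 - inner (T r) r)"
      using pr Tpr selfadjoint[of r p] unfolding power2_norm_eq_inner w
      by (simp add: linear_add[OF linear] inner_add_left inner_add_right inner_diff_left inner_diff_right
          inner_commute algebra_simps)
    then show ?thesis using p_part r_part nw by (simp add: distrib_left)
  qed
  also have "T w - l j *\<^sub>R w = T u - l j *\<^sub>R u"
    using eigensystemD(1)[OF T(2) j]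
    by (simp add: w_def linear_diff[OF linear] linear_scale[OF linear] scaleR_diff_right mult.commute)
  also have "inner \<dots> (p - r) \<le> norm (T u - l j *\<^sub>R u) * norm w"
    using norm_cauchy_schwarz[of "T u - l j *\<^sub>R u" "p - r"] by (simp add: npr)
  also have "\<dots> \<le> 2 * h * norm w"
  proof (rule mult_right_mono)
    have "T u - l j *\<^sub>R u = (T u - T' u) + (l' - l j) *\<^sub>R u" using u by (simp add: scaleR_diff_left)
    then have "norm (T u - l j *\<^sub>R u) \<le> norm (T u - T' u) + norm ((l' - l j) *\<^sub>R u)"
      by (metis norm_triangle_ineq)
    then show "norm (T u - l j *\<^sub>R u) \<le> 2 * h" using h u by (simp add: abs_minus_commute)
  qed simp
  finally have "\<alpha> * norm w * norm w \<le> 2 * h * norm w" by (simp add: power2_eq_square mult.assoc)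
  moreover have "h \<ge> 0" using h(2) by linarith
  ultimately have "\<alpha> * norm w \<le> 2 * h"
    by (cases "norm w = 0") (auto simp: mult_le_cancel_right)
  then have "(\<alpha> * norm w)\<^sup>2 \<le> (2 * h)\<^sup>2" using gap(1) by (intro power_mono) auto
  then have w_bound: "(norm w)\<^sup>2 \<le> 4 / \<alpha>\<^sup>2 * h\<^sup>2"
    using gap(1) by (simp add: power_mult_distrib field_simps)
  have uu: "inner u u = 1" using u(1) by (simp add: norm_eq_1)
  have wa: "(norm w)\<^sup>2 = 1 - a\<^sup>2"
    unfolding power2_norm_eq_inner w_def
    by (simp add: inner_diff_left inner_diff_right vj uu a_def[symmetric] inner_commute power2_eq_square)
  have "\<bar>a\<bar> \<le> 1" using Cauchy_Schwarz_ineq2[of u "v j"] u(1) eigensystemD(3)[OF T(2) j] by (simp add: a_def)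
  have "(norm (sgn a *\<^sub>R u - v j))\<^sup>2 \<le> 2 * (1 - a\<^sup>2)"
  proof -
    have "(norm (sgn a *\<^sub>R u - v j))\<^sup>2 = (sgn a)\<^sup>2 - 2 * (sgn a * a) + 1"
      unfolding power2_norm_eq_inner
      by (simp add: inner_diff_left inner_diff_right vj uu a_def[symmetric] inner_commute power2_eq_square)
    also have "\<dots> \<le> 2 * (1 - \<bar>a\<bar>)" by (cases "a = 0") (auto simp: sgn_if)
    also have "\<dots> \<le> 2 * (1 - a\<^sup>2)"
      using \<open>\<bar>a\<bar> \<le> 1\<close> mult_left_le_one_le[of "\<bar>a\<bar>" "\<bar>a\<bar>"] by (simp add: power2_eq_square abs_mult[symmetric])
    finally show ?thesis .
  qed
  then show ?thesis using w_bound wa by (simp add: a_def)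
qed

section \<open>Integral operators with square-integrable kernels\<close>

lemma integrable_mult_of_squares:
  fixes f g :: "'a \<Rightarrow> real"
  assumes "f \<in> borel_measurable M" "g \<in> borel_measurable M"
    and "integrable M (\<lambda>x. (f x)\<^sup>2)" "integrable M (\<lambda>x. (g x)\<^sup>2)"
  shows "integrable M (\<lambda>x. f x * g x)"
proof (rule Bochner_Integration.integrable_bound)
  show "integrable M (\<lambda>x. (f x)\<^sup>2 + (g x)\<^sup>2)" using assms by simp
  show "AE x in M. norm (f x * g x) \<le> norm ((f x)\<^sup>2 + (g x)\<^sup>2)"
  proof (rule AE_I2)
    fix x
    have "2 * (\<bar>f x\<bar> * \<bar>g x\<bar>) \<le> (f x)\<^sup>2 + (g x)\<^sup>2"
      using sum_squares_bound[of "\<bar>f x\<bar>" "\<bar>g x\<bar>"] by (simp add: mult.assoc)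
    moreover have "0 \<le> \<bar>f x\<bar> * \<bar>g x\<bar>" by simp
    ultimately show "norm (f x * g x) \<le> norm ((f x)\<^sup>2 + (g x)\<^sup>2)"
      unfolding real_norm_def abs_mult by linarith
  qed
qed (use assms in simp)

interpretation unit_square: pair_sigma_finite unit_interval unit_interval
  by (simp add: pair_sigma_finite_def finite_measure.axioms(1) finite_measure_unit_interval)

text \<open>
  Sections are required to be square integrable at every point of the unit interval, not only almost
  everywhere, so that the image function \<open>t \<mapsto> \<langle>k t, u\<rangle>\<close> is an inner product for each \<open>t\<close>.
\<close>

definition L2_kernel :: "(real \<Rightarrow> real \<Rightarrow> real) \<Rightarrow> bool" where
  "L2_kernel k \<longleftrightarrow>
     (\<lambda>(t, s). k t s) \<in> borel_measurable (unit_interval \<Otimes>\<^sub>M unit_interval) \<and>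
     (\<forall>t\<in>{0..1}. square_integrable (k t)) \<and>
     integrable (unit_interval \<Otimes>\<^sub>M unit_interval) (\<lambda>(t, s). (k t s)\<^sup>2)"

text \<open>
  The Hilbert--Schmidt norm of the integral operator.
\<close>

definition kernel_norm :: "(real \<Rightarrow> real \<Rightarrow> real) \<Rightarrow> real" where
  "kernel_norm k = sqrt (integral\<^sup>L (unit_interval \<Otimes>\<^sub>M unit_interval) (\<lambda>(t, s). (k t s)\<^sup>2))"

lemma rep_L2_measurable [measurable]: "rep_L2 u \<in> borel_measurable unit_interval"
  using square_integrable_rep_L2[of u] unfolding square_integrable_def by blast

lemma integral_kernel_section:
  assumes "L2_kernel k" "t \<in> {0..1}"
  shows "(LINT s|unit_interval. k t s * rep_L2 u s) = inner (abs_L2 (k t)) u"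
  using inner_abs_L2[of "k t" "rep_L2 u"] assms by (simp add: L2_kernel_def)

lemma
  assumes "L2_kernel k"
  shows square_integrable_kernel_section_norm: "square_integrable (\<lambda>t. sqrt (LINT s|unit_interval. (k t s)\<^sup>2))" (is ?A)
    and power2_norm_kernel_section_norm:
      "(norm (abs_L2 (\<lambda>t. sqrt (LINT s|unit_interval. (k t s)\<^sup>2))))\<^sup>2 = (kernel_norm k)\<^sup>2" (is ?B)
proof -
  let ?K = "\<lambda>t. LINT s|unit_interval. (k t s)\<^sup>2"
  have [measurable]: "(\<lambda>(t, s). k t s) \<in> borel_measurable (unit_interval \<Otimes>\<^sub>M unit_interval)"
    and i: "integrable (unit_interval \<Otimes>\<^sub>M unit_interval) (\<lambda>(t, s). (k t s)\<^sup>2)"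
    using assms by (auto simp: L2_kernel_def)
  have "integrable unit_interval ?K" using unit_square.integrable_fst[OF i] .
  moreover have "(sqrt (?K t))\<^sup>2 = ?K t" for t by simp
  moreover have "(\<lambda>t. sqrt (?K t)) \<in> borel_measurable unit_interval" by measurable
  ultimately show A: ?A by (simp add: square_integrable_def)
  have "(LINT t|unit_interval. (sqrt (?K t))\<^sup>2) = (integral\<^sup>L (unit_interval \<Otimes>\<^sub>M unit_interval) (\<lambda>(t, s). (k t s)\<^sup>2))"
    using unit_square.integral_fst[OF i] by simp
  moreover have "\<dots> = (kernel_norm k)\<^sup>2"
    unfolding kernel_norm_def by (subst real_sqrt_pow2) (auto intro!: integral_nonneg_AE)
  ultimately show ?B using A by (simp add: power2_norm_abs_L2)
qed

lemma kernel_image_measurable: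
  assumes "L2_kernel k"
  shows "(\<lambda>t. LINT s|unit_interval. k t s * rep_L2 u s) \<in> borel_measurable unit_interval"
proof -
  have [measurable]: "(\<lambda>(t, s). k t s) \<in> borel_measurable (unit_interval \<Otimes>\<^sub>M unit_interval)"
    using assms by (auto simp: L2_kernel_def)
  show ?thesis by measurable
qed

lemma kernel_image_bound:
  assumes "L2_kernel k" "t \<in> {0..1}"
  shows "\<bar>LINT s|unit_interval. k t s * rep_L2 u s\<bar> \<le> norm u * sqrt (LINT s|unit_interval. (k t s)\<^sup>2)"
proof -
  have "square_integrable (k t)" using assms by (simp add: L2_kernel_def)
  from power2_norm_abs_L2[OF this] have "norm (abs_L2 (k t)) = sqrt (LINT s|unit_interval. (k t s)\<^sup>2)"
    by (metis norm_ge_zero real_sqrt_abs abs_of_nonneg)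
  then show ?thesis
    unfolding integral_kernel_section[OF assms]
    using Cauchy_Schwarz_ineq2[of "abs_L2 (k t)" u] by (simp add: mult.commute)
qed

lemma square_integrable_kernel_image:
  assumes "L2_kernel k"
  shows "square_integrable (\<lambda>t. LINT s|unit_interval. k t s * rep_L2 u s)"
proof (rule square_integrable_bound[OF kernel_image_measurable[OF assms]
      square_integrable_scale[OF square_integrable_kernel_section_norm[OF assms], of "norm u"]])
  fix t :: real assume "t \<in> {0..1}"
  then show "\<bar>LINT s|unit_interval. k t s * rep_L2 u s\<bar> \<le> \<bar>norm u * sqrt (LINT s|unit_interval. (k t s)\<^sup>2)\<bar>"
    using kernel_image_bound[OF assms, of t u] by linarith
qed

lemma norm_abs_L2_mono:
  assumes "square_integrable f" "square_integrable g" "\<And>t. t \<in> {0..1} \<Longrightarrow> \<bar>f t\<bar> \<le> \<bar>g t\<bar>"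
  shows "norm (abs_L2 f) \<le> norm (abs_L2 g)"
proof (rule power2_le_imp_le)
  show "(norm (abs_L2 f))\<^sup>2 \<le> (norm (abs_L2 g))\<^sup>2"
    unfolding power2_norm_abs_L2[OF assms(1)] power2_norm_abs_L2[OF assms(2)]
    using assms by (intro integral_mono) (auto simp: square_integrable_def abs_le_square_iff)
qed simp

lemma norm_integral_operator_le:
  assumes "L2_kernel k"
  shows "norm (integral_operator k u) \<le> kernel_norm k * norm u"
proof -
  note K = square_integrable_kernel_section_norm[OF assms]
  have "norm (integral_operator k u) \<le> norm (abs_L2 (\<lambda>t. norm u * sqrt (LINT s|unit_interval. (k t s)\<^sup>2)))"
    unfolding integral_operator_def
  proof (rule norm_abs_L2_mono[OF square_integrable_kernel_image[OF assms] square_integrable_scale[OF K]])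
    fix t :: real assume "t \<in> {0..1}"
    then show "\<bar>LINT s|unit_interval. k t s * rep_L2 u s\<bar> \<le> \<bar>norm u * sqrt (LINT s|unit_interval. (k t s)\<^sup>2)\<bar>"
      using kernel_image_bound[OF assms, of t u] by linarith
  qed
  also have "\<dots> = norm u * norm (abs_L2 (\<lambda>t. sqrt (LINT s|unit_interval. (k t s)\<^sup>2)))"
    by (simp add: abs_L2_scale[OF K])
  also have "norm (abs_L2 (\<lambda>t. sqrt (LINT s|unit_interval. (k t s)\<^sup>2))) = kernel_norm k"
  proof (rule power2_eq_imp_eq[OF power2_norm_kernel_section_norm[OF assms]])
    show "0 \<le> kernel_norm k" by (auto simp: kernel_norm_def intro!: integral_nonneg_AE)
  qed simp
  finally show ?thesis by (simp add: mult.commute)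
qed

lemma integral_operator_eqI:
  assumes "L2_kernel k" "square_integrable f"
    and "\<And>t. t \<in> {0..1} \<Longrightarrow> inner (abs_L2 (k t)) u = f t"
  shows "integral_operator k u = abs_L2 f"
  unfolding integral_operator_def
  by (subst abs_L2_eq_iff[OF square_integrable_kernel_image[OF assms(1)] assms(2)])
    (use assms(3) in \<open>auto intro!: AE_I2 simp: integral_kernel_section[OF assms(1)]\<close>)

lemma linear_integral_operator:
  assumes "L2_kernel k"
  shows "linear (integral_operator k)"
proof (rule linearI)
  note sq = square_integrable_kernel_image[OF assms]
  show "integral_operator k (u + w) = integral_operator k u + integral_operator k w" for u w
    unfolding integral_operator_def[of k u] integral_operator_def[of k w]
    by (subst abs_L2_add[OF sq sq, symmetric])
      (auto intro!: integral_operator_eqI[OF assms] square_integrable_add sq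
        simp: integral_kernel_section[OF assms] inner_add_right)
  show "integral_operator k (c *\<^sub>R u) = c *\<^sub>R integral_operator k u" for c u
    unfolding integral_operator_def[of k u]
    by (subst abs_L2_scale[OF sq, symmetric])
      (auto intro!: integral_operator_eqI[OF assms] square_integrable_scale sq
        simp: integral_kernel_section[OF assms])
qed

lemma L2_kernel_diff:
  assumes "L2_kernel k" "L2_kernel k'"
  shows "L2_kernel (\<lambda>t s. k t s - k' t s)"
    and "integral_operator (\<lambda>t s. k t s - k' t s) u = integral_operator k u - integral_operator k' u"
proof -
  let ?U = "unit_interval \<Otimes>\<^sub>M unit_interval"
  have [measurable]: "(\<lambda>(t, s). k t s) \<in> borel_measurable ?U" "(\<lambda>(t, s). k' t s) \<in> borel_measurable ?U"
    and i: "integrable ?U (\<lambda>(t, s). (k t s)\<^sup>2)" "integrable ?U (\<lambda>(t, s). (k' t s)\<^sup>2)"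
    using assms by (auto simp: L2_kernel_def)
  have "integrable ?U (\<lambda>x. case_prod k x * case_prod k' x)"
    using i by (intro integrable_mult_of_squares) (auto simp: case_prod_unfold)
  then have "integrable ?U (\<lambda>x. (case_prod k x)\<^sup>2 - 2 * (case_prod k x * case_prod k' x) + (case_prod k' x)\<^sup>2)"
    using i by (auto simp: case_prod_unfold)
  then have "integrable ?U (\<lambda>(t, s). (k t s - k' t s)\<^sup>2)"
    by (simp add: case_prod_unfold power2_diff algebra_simps)
  then show D: "L2_kernel (\<lambda>t s. k t s - k' t s)"
    using assms by (auto simp: L2_kernel_def intro!: square_integrable_diff)
  note sq = square_integrable_kernel_image[OF assms(1), of u] square_integrable_kernel_image[OF assms(2), of u]
  show "integral_operator (\<lambda>t s. k t s - k' t s) u = integral_operator k u - integral_operator k' u"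
    unfolding integral_operator_def[of k u] integral_operator_def[of k' u]
    using assms
    by (subst abs_L2_diff[OF sq, symmetric])
      (auto intro!: integral_operator_eqI[OF D] square_integrable_diff sq
        simp: integral_kernel_section[OF assms(1)] integral_kernel_section[OF assms(2)] abs_L2_diff
          inner_diff_left L2_kernel_def)
qed

lemma integral_operator_selfadjoint:
  assumes k: "L2_kernel k" and sym: "\<And>t s. t \<in> {0..1} \<Longrightarrow> s \<in> {0..1} \<Longrightarrow> k t s = k s t"
  shows "inner (integral_operator k u) w = inner u (integral_operator k w)"
proof -
  let ?U = "unit_interval \<Otimes>\<^sub>M unit_interval"
  have [measurable]: "(\<lambda>(t, s). k t s) \<in> borel_measurable ?U"
    and i: "integrable ?U (\<lambda>(t, s). (k t s)\<^sup>2)"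
    using k by (auto simp: L2_kernel_def)
  have sq: "integrable unit_interval (\<lambda>s. (rep_L2 x s)\<^sup>2)" for x
    using square_integrable_rep_L2[of x] unfolding square_integrable_def by blast
  have "integrable ?U (\<lambda>(t, s). (rep_L2 w t * rep_L2 u s)\<^sup>2)"
  proof (rule unit_square.Fubini_integrable)
    show "integrable unit_interval (\<lambda>t. LINT s|unit_interval. norm (case (t, s) of (t, s) \<Rightarrow> (rep_L2 w t * rep_L2 u s)\<^sup>2))"
      by (simp add: power_mult_distrib sq)
    show "AE t in unit_interval. integrable unit_interval (\<lambda>s. case (t, s) of (t, s) \<Rightarrow> (rep_L2 w t * rep_L2 u s)\<^sup>2)"
      by (simp add: power_mult_distrib sq)
  qed measurable
  then have "integrable ?U (\<lambda>x. case_prod k x * (rep_L2 w (fst x) * rep_L2 u (snd x)))"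
    using i by (intro integrable_mult_of_squares) (auto simp: case_prod_unfold)
  then have int: "integrable ?U (\<lambda>(t, s). k t s * rep_L2 u s * rep_L2 w t)"
    by (simp add: case_prod_unfold mult_ac)
  have expand: "inner (integral_operator k x) y =
      (LINT t|unit_interval. (LINT s|unit_interval. k t s * rep_L2 x s) * rep_L2 y t)" for x y
    unfolding integral_operator_def
    by (subst (1) abs_rep_L2[of y, symmetric], subst inner_abs_L2[OF square_integrable_kernel_image[OF k]]) auto
  have "inner (integral_operator k u) w =
      (LINT t|unit_interval. LINT s|unit_interval. k t s * rep_L2 u s * rep_L2 w t)"
    unfolding expand by simp
  also have "\<dots> = (LINT s|unit_interval. LINT t|unit_interval. k t s * rep_L2 u s * rep_L2 w t)"
    using unit_square.Fubini_integral[OF int] by simp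
  also have "\<dots> = (LINT s|unit_interval. LINT t|unit_interval. k s t * rep_L2 w t * rep_L2 u s)"
    using sym by (intro Bochner_Integration.integral_cong refl) (auto simp: mult_ac)
  also have "\<dots> = inner (integral_operator k w) u"
    unfolding expand by simp
  finally show ?thesis by (simp add: inner_commute)
qed

text \<open>
  A diagonal argument over the dense sequence \<open>L2_step\<close>; the uniform bound on \<open>u\<close> carries convergence
  of the inner products from the dense set to every \<open>x\<close>.
\<close>

lemma weakly_convergent_subsequence:
  fixes u :: "nat \<Rightarrow> L2"
  assumes u: "\<And>n. norm (u n) \<le> 1"
  obtains r where "strict_mono r" "\<And>x. convergent (\<lambda>n. inner (u (r n)) x)"
proof -
  define e where "e i = L2_step (from_nat i)" for i
  have bdd: "\<bar>inner (u n) x\<bar> \<le> norm x" for n x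
    using Cauchy_Schwarz_ineq2[of "u n" x] mult_right_mono[OF u[of n], of "norm x"] by simp
  interpret subseqs "\<lambda>i s. convergent (\<lambda>n. inner (u (s n)) (e i))"
  proof
    fix i and s :: "nat \<Rightarrow> nat" assume "strict_mono s"
    have "bounded (range (\<lambda>n. inner (u (s n)) (e i)))"
      using bdd by (auto simp: bounded_iff)
    from bounded_imp_convergent_subsequence[OF this]
    show "\<exists>r'. strict_mono r' \<and> convergent (\<lambda>n. inner (u ((s \<circ> r') n)) (e i))"
      by (auto simp: convergent_def o_def)
  qed
  have conv: "convergent (\<lambda>n. inner (u (diagseq n)) (e i))" for i
  proof -
    have "convergent (\<lambda>n. inner (u ((diagseq \<circ> (+) (Suc i)) n)) (e i))"
    proof (rule diagseq_holds)
      fix r s :: "nat \<Rightarrow> nat" and n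
      assume "strict_mono r" "convergent (\<lambda>m. inner (u (s m)) (e n))"
      then show "convergent (\<lambda>m. inner (u ((s \<circ> r) m)) (e n))"
        using convergent_subseq_convergent[of "\<lambda>m. inner (u (s m)) (e n)" r] by (simp add: o_def)
    qed
    then show ?thesis
      using convergent_ignore_initial_segment[of "\<lambda>n. inner (u (diagseq n)) (e i)" "Suc i"]
      by (simp add: o_def add.commute)
  qed
  have "convergent (\<lambda>n. inner (u (diagseq n)) x)" for x
  proof (rule real_Cauchy_convergent, unfold Cauchy_iff, intro allI impI)
    fix \<eta> :: real assume "\<eta> > 0"
    have "x \<in> closure (range L2_step)" using closure_range_L2_step by simp
    then obtain xs where "dist (L2_step xs) x < \<eta> / 3"
      using \<open>\<eta> > 0\<close> unfolding closure_approachable by (metis divide_pos_pos rangeE zero_less_numeral)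
    then have xs: "norm (x - e (to_nat xs)) < \<eta> / 3"
      by (simp add: e_def dist_norm norm_minus_commute)
    have "Cauchy (\<lambda>n. inner (u (diagseq n)) (e (to_nat xs)))"
      using conv convergent_Cauchy by blast
    then obtain N where N: "\<And>m n. m \<ge> N \<Longrightarrow> n \<ge> N \<Longrightarrow>
        norm (inner (u (diagseq m)) (e (to_nat xs)) - inner (u (diagseq n)) (e (to_nat xs))) < \<eta> / 3"
      unfolding Cauchy_iff using \<open>\<eta> > 0\<close> by (metis divide_pos_pos zero_less_numeral)
    have "norm (inner (u (diagseq m)) x - inner (u (diagseq n)) x) < \<eta>" if "m \<ge> N" "n \<ge> N" for m n
    proof -
      have split: "inner (u i) x = inner (u i) (e (to_nat xs)) + inner (u i) (x - e (to_nat xs))" for i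
        by (simp add: inner_diff_right)
      then show ?thesis
        unfolding split using N[OF that] bdd[of "diagseq m" "x - e (to_nat xs)"] bdd[of "diagseq n" "x - e (to_nat xs)"] xs
        unfolding real_norm_def by linarith
    qed
    then show "\<exists>N. \<forall>m\<ge>N. \<forall>n\<ge>N. norm (inner (u (diagseq m)) x - inner (u (diagseq n)) x) < \<eta>" by blast
  qed
  then show thesis using that subseq_diagseq by blast
qed

text \<open>
  Along a weakly convergent subsequence the images \<open>t \<mapsto> \<langle>k t, u n\<rangle>\<close> converge at every \<open>t\<close>, and they are
  dominated by the square-integrable function \<open>t \<mapsto> \<parallel>k t\<parallel>\<close>.
\<close>

lemma compact_selfadjoint_integral_operator:
  assumes k: "L2_kernel k" and sym: "\<And>t s. t \<in> {0..1} \<Longrightarrow> s \<in> {0..1} \<Longrightarrow> k t s = k s t"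
  shows "compact_selfadjoint (integral_operator k)"
proof (rule compact_selfadjoint.intro)
  note lin = linear_integral_operator[OF k]
  show "bounded_linear (integral_operator k)"
    by (rule bounded_linear_intro[where K = "kernel_norm k"])
      (use norm_integral_operator_le[OF k] in \<open>auto simp: linear_add[OF lin] linear_scale[OF lin] mult.commute\<close>)
  show "inner (integral_operator k x) y = inner x (integral_operator k y)" for x y
    by (rule integral_operator_selfadjoint[OF k sym])
  fix u :: "nat \<Rightarrow> L2" assume u: "\<And>n. norm (u n) \<le> 1"
  obtain r where r: "strict_mono r" "\<And>x. convergent (\<lambda>n. inner (u (r n)) x)"
    by (rule weakly_convergent_subsequence[where u = u, OF u]) (rule that)
  define F where "F n t = (LINT s|unit_interval. k t s * rep_L2 (u (r n)) s)" for n t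
  define G where "G t = lim (\<lambda>n. F n t)" for t
  have Fm [measurable]: "F n \<in> borel_measurable unit_interval" for n
    unfolding F_def by (rule kernel_image_measurable[OF k])
  have lim: "(\<lambda>n. F n t) \<longlonglongrightarrow> G t" if "t \<in> {0..1}" for t
  proof -
    have "convergent (\<lambda>n. F n t)"
      unfolding F_def integral_kernel_section[OF k that] using r(2) by (simp add: inner_commute)
    then show ?thesis by (simp add: G_def convergent_LIMSEQ_iff)
  qed
  have "(\<lambda>n. abs_L2 (F n)) \<longlonglongrightarrow> abs_L2 G"
  proof (rule abs_L2_dominated_convergence(3)[OF Fm _ square_integrable_kernel_section_norm[OF k]])
    show "G \<in> borel_measurable unit_interval"
      by (rule borel_measurable_LIMSEQ_real[OF _ Fm]) (use lim in simp)
    show "\<bar>F n t\<bar> \<le> sqrt (LINT s|unit_interval. (k t s)\<^sup>2)" if "t \<in> {0..1}" for n t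
    proof -
      have "\<bar>F n t\<bar> \<le> norm (u (r n)) * sqrt (LINT s|unit_interval. (k t s)\<^sup>2)"
        unfolding F_def by (rule kernel_image_bound[OF k that])
      also have "\<dots> \<le> 1 * sqrt (LINT s|unit_interval. (k t s)\<^sup>2)"
        by (rule mult_right_mono[OF u]) (auto intro!: integral_nonneg_AE)
      finally show ?thesis by simp
    qed
  qed (use lim in auto)
  then show "\<exists>r g. strict_mono (r :: nat \<Rightarrow> nat) \<and> (\<lambda>n. integral_operator k (u (r n))) \<longlonglongrightarrow> g"
    using r(1) by (auto simp: integral_operator_def F_def[abs_def])
qed

section \<open>Laws of coupled sequences\<close>

lemma measurable_family [measurable (raw)]:
  assumes "\<And>k. g k \<in> measurable M S"
  shows "(\<lambda>\<omega> k. g k \<omega>) \<in> measurable M (PiM UNIV (\<lambda>_. S))"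
  by (rule measurable_PiM_single') (use assms measurable_space[OF assms] in auto)

text \<open>
  Two independent families, each with independent members, form one independent family.  Indexing
  the original innovations and one copy jointly by a sum type lets every coupled element be
  written as a function of a reindexed i.i.d. family.
\<close>

lemma (in prob_space) indep_vars_case_sum:
  fixes S :: "'s measure" and A :: "'c \<Rightarrow> 'a \<Rightarrow> 's" and B :: "'d \<Rightarrow> 'a \<Rightarrow> 's"
  assumes A: "indep_vars (\<lambda>_. S) A UNIV" and B: "indep_vars (\<lambda>_. S) B UNIV"
    and AB: "\<And>E F. E \<in> sets (PiM UNIV (\<lambda>_. S)) \<Longrightarrow> F \<in> sets (PiM UNIV (\<lambda>_. S)) \<Longrightarrow>
      prob {\<omega> \<in> space M. (\<lambda>k. A k \<omega>) \<in> E \<and> (\<lambda>k. B k \<omega>) \<in> F} =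
      prob {\<omega> \<in> space M. (\<lambda>k. A k \<omega>) \<in> E} * prob {\<omega> \<in> space M. (\<lambda>k. B k \<omega>) \<in> F}"
  shows "indep_vars (\<lambda>_. S) (case_sum A B) UNIV"
proof -
  have cylinder: "prob {\<omega> \<in> space M. \<forall>i\<in>J. X i \<omega> \<in> C i} = (\<Prod>i\<in>J. prob (X i -` C i \<inter> space M))"
    if X: "indep_vars (\<lambda>_. S) X UNIV" and "finite J" "\<And>i. i \<in> J \<Longrightarrow> C i \<in> sets S"
    for X :: "'i \<Rightarrow> 'a \<Rightarrow> 's" and J C
  proof (cases "J = {}")
    case True then show ?thesis by (simp add: prob_space)
  next
    case False
    have "{\<omega> \<in> space M. \<forall>i\<in>J. X i \<omega> \<in> C i} = (\<Inter>i\<in>J. X i -` C i \<inter> space M)" using False by auto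
    then show ?thesis using indep_varsD[OF X False \<open>finite J\<close>] that by simp
  qed
  have cylinder_space: "{x \<in> space (PiM UNIV (\<lambda>_. S)). \<forall>i\<in>J. x i \<in> C i} \<in> sets (PiM UNIV (\<lambda>_. S))"
    if "finite J" "\<And>i. i \<in> J \<Longrightarrow> C i \<in> sets S" for J :: "'i set" and C
    by (rule sets.sets_Collect_finite_All) (use that in auto)
  have rv: "random_variable S (case_sum A B j)" for j
    using A B by (cases j) (auto simp: indep_vars_def2)
  show ?thesis
    unfolding indep_vars_def2
  proof (intro conjI ballI indep_setsI)
    fix j :: "'c + 'd"
    show "random_variable S (case_sum A B j)" by (rule rv)
  next
    fix j :: "'c + 'd"
    show "{case_sum A B j -` C \<inter> space M |C. C \<in> sets S} \<subseteq> events"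
      using measurable_sets[OF rv] by blast
  next
    fix E J assume J: "J \<noteq> {}" "finite J"
      and E: "\<forall>j\<in>J. E j \<in> {case_sum A B j -` C \<inter> space M |C. C \<in> sets S}"
    from E obtain C where C: "\<And>j. j \<in> J \<Longrightarrow> C j \<in> sets S" "\<And>j. j \<in> J \<Longrightarrow> E j = case_sum A B j -` C j \<inter> space M"
      by (simp only: mem_Collect_eq) metis
    define JA where "JA = Inl -` J"
    define JB where "JB = Inr -` J"
    have EA: "C (Inl i) \<in> sets S" "E (Inl i) = A i -` C (Inl i) \<inter> space M" if "i \<in> JA" for i
      using C[of "Inl i"] that by (auto simp: JA_def)
    have EB: "C (Inr i) \<in> sets S" "E (Inr i) = B i -` C (Inr i) \<inter> space M" if "i \<in> JB" for i
      using C[of "Inr i"] that by (auto simp: JB_def)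
    have fin: "finite JA" "finite JB" using J by (auto simp: JA_def JB_def intro!: finite_vimageI)
    have Jeq: "J = Inl ` JA \<union> Inr ` JB"
    proof (intro set_eqI)
      fix j show "j \<in> J \<longleftrightarrow> j \<in> Inl ` JA \<union> Inr ` JB" by (cases j) (auto simp: JA_def JB_def)
    qed
    let ?EA = "{x \<in> space (PiM UNIV (\<lambda>_. S)). \<forall>i\<in>JA. x i \<in> C (Inl i)}"
    let ?EB = "{x \<in> space (PiM UNIV (\<lambda>_. S)). \<forall>i\<in>JB. x i \<in> C (Inr i)}"
    have sp: "(\<lambda>k. A k \<omega>) \<in> space (PiM UNIV (\<lambda>_. S))" "(\<lambda>k. B k \<omega>) \<in> space (PiM UNIV (\<lambda>_. S))" if "\<omega> \<in> space M" for \<omega>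
      using A B that by (auto simp: space_PiM indep_vars_def2 dest: measurable_space)
    have "(\<Inter>j\<in>J. E j) = {\<omega> \<in> space M. (\<lambda>k. A k \<omega>) \<in> ?EA \<and> (\<lambda>k. B k \<omega>) \<in> ?EB}"
    proof (intro set_eqI iffI)
      fix \<omega> assume w: "\<omega> \<in> (\<Inter>j\<in>J. E j)"
      then have "\<omega> \<in> space M" using J C(2) by auto
      moreover have "A i \<omega> \<in> C (Inl i)" if "i \<in> JA" for i
        using w C(2)[of "Inl i"] that by (auto simp: JA_def)
      moreover have "B i \<omega> \<in> C (Inr i)" if "i \<in> JB" for i
        using w C(2)[of "Inr i"] that by (auto simp: JB_def)
      ultimately show "\<omega> \<in> {\<omega> \<in> space M. (\<lambda>k. A k \<omega>) \<in> ?EA \<and> (\<lambda>k. B k \<omega>) \<in> ?EB}"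
        using sp by auto
    next
      fix \<omega> assume "\<omega> \<in> {\<omega> \<in> space M. (\<lambda>k. A k \<omega>) \<in> ?EA \<and> (\<lambda>k. B k \<omega>) \<in> ?EB}"
      then show "\<omega> \<in> (\<Inter>j\<in>J. E j)" using C(2) unfolding Jeq by auto
    qed
    also have "prob \<dots> = prob {\<omega> \<in> space M. (\<lambda>k. A k \<omega>) \<in> ?EA} * prob {\<omega> \<in> space M. (\<lambda>k. B k \<omega>) \<in> ?EB}"
      by (intro AB cylinder_space fin C) (auto simp: JA_def JB_def)
    also have "{\<omega> \<in> space M. (\<lambda>k. A k \<omega>) \<in> ?EA} = {\<omega> \<in> space M. \<forall>i\<in>JA. A i \<omega> \<in> C (Inl i)}"
      using sp by auto
    also have "{\<omega> \<in> space M. (\<lambda>k. B k \<omega>) \<in> ?EB} = {\<omega> \<in> space M. \<forall>i\<in>JB. B i \<omega> \<in> C (Inr i)}"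
      using sp by auto
    also have "prob {\<omega> \<in> space M. \<forall>i\<in>JA. A i \<omega> \<in> C (Inl i)} = (\<Prod>j\<in>Inl ` JA. prob (E j))"
      using cylinder[OF A fin(1), of "\<lambda>i. C (Inl i)"] by (simp add: prod.reindex EA)
    also have "prob {\<omega> \<in> space M. \<forall>i\<in>JB. B i \<omega> \<in> C (Inr i)} = (\<Prod>j\<in>Inr ` JB. prob (E j))"
      using cylinder[OF B fin(2), of "\<lambda>i. C (Inr i)"] by (simp add: prod.reindex EB)
    also have "(\<Prod>j\<in>Inl ` JA. prob (E j)) * (\<Prod>j\<in>Inr ` JB. prob (E j)) = (\<Prod>j\<in>J. prob (E j))"
      unfolding Jeq by (subst prod.union_disjoint) (use fin in auto)
    finally show "prob (\<Inter>j\<in>J. E j) = (\<Prod>j\<in>J. prob (E j))" .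
  qed
qed

lemma (in prob_space) distr_iid_reindex:
  fixes g :: "'i \<Rightarrow> 'a \<Rightarrow> 'b" and \<phi> :: "'j \<Rightarrow> 'i"
  assumes g: "indep_vars (\<lambda>_. S) g UNIV" and law: "\<And>i. distr M S (g i) = P" and inj: "inj \<phi>"
  shows "distr M (PiM UNIV (\<lambda>_. S)) (\<lambda>\<omega> k. g (\<phi> k) \<omega>) = PiM UNIV (\<lambda>_. P)"
proof -
  have rv [measurable]: "random_variable S (g i)" for i using g by (auto simp: indep_vars_def2)
  have P: "prob_space P" using prob_space_distr[OF rv] law by simp
  have sets_P: "sets P = sets S" using law by (metis sets_distr)
  have "distr M (PiM UNIV (\<lambda>_. S)) (\<lambda>\<omega>. \<lambda>i\<in>UNIV. g i \<omega>) = PiM UNIV (\<lambda>i. distr M S (g i))"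
    using indep_vars_iff_distr_eq_PiM'[where I = UNIV and M' = "\<lambda>_. S" and X = g] g by simp
  then have g_law: "distr M (PiM UNIV (\<lambda>_. S)) (\<lambda>\<omega> i. g i \<omega>) = PiM UNIV (\<lambda>_. P)"
    by (simp add: law restrict_UNIV)
  have "PiM UNIV (\<lambda>_. P) = distr (PiM UNIV (\<lambda>_. P)) (PiM UNIV (\<lambda>_. P)) (\<lambda>x. \<lambda>k\<in>UNIV. x (\<phi> k))"
    using distr_PiM_reindex[of UNIV "\<lambda>_. P" \<phi> UNIV] P inj by simp
  also have "\<dots> = distr (distr M (PiM UNIV (\<lambda>_. S)) (\<lambda>\<omega> i. g i \<omega>)) (PiM UNIV (\<lambda>_. S)) (\<lambda>x k. x (\<phi> k))"
    unfolding g_law by (intro distr_cong refl sets_PiM_cong) (auto simp: sets_P)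
  also have "\<dots> = distr M (PiM UNIV (\<lambda>_. S)) (\<lambda>\<omega> k. g (\<phi> k) \<omega>)"
    by (subst distr_distr) (auto simp: o_def intro!: measurable_family)
  finally show ?thesis ..
qed

lemma (in prob_space) indep_var_reindex:
  fixes g :: "'i \<Rightarrow> 'a \<Rightarrow> 'b" and \<phi> \<psi> :: "'j \<Rightarrow> 'i"
  assumes g: "indep_vars (\<lambda>_. S) g UNIV" and disj: "range \<phi> \<inter> range \<psi> = {}"
    and f: "f \<in> measurable (PiM UNIV (\<lambda>_. S)) N"
  shows "indep_var N (\<lambda>\<omega>. f (\<lambda>k. g (\<phi> k) \<omega>)) N (\<lambda>\<omega>. f (\<lambda>k. g (\<psi> k) \<omega>))"
proof -
  have ind: "indep_var (PiM (range \<phi>) (\<lambda>_. S)) (\<lambda>\<omega>. restrict (\<lambda>i. g i \<omega>) (range \<phi>))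
      (PiM (range \<psi>) (\<lambda>_. S)) (\<lambda>\<omega>. restrict (\<lambda>i. g i \<omega>) (range \<psi>))"
    by (rule indep_var_restrict[OF g disj]) auto
  have meas: "(\<lambda>x. f (\<lambda>k. x (\<theta> k))) \<in> measurable (PiM (range \<theta>) (\<lambda>_. S)) N" for \<theta> :: "'j \<Rightarrow> 'i"
    by (rule measurable_compose[OF _ f]) (auto intro!: measurable_PiM_single')
  from indep_var_compose[OF ind meas meas] show ?thesis by (simp add: o_def)
qed

text \<open>
  The coupling estimates use the norm only, hence the general separable value space; inner
  products enter with the kernels chosen later.
\<close>

locale approximable = prob_space M
  for M :: "'w measure" and S :: "'s measure"
    and f :: "(nat \<Rightarrow> 's) \<Rightarrow> 'a::{second_countable_topology, real_normed_vector}"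
    and \<epsilon> :: "int \<Rightarrow> 'w \<Rightarrow> 's" and \<epsilon>' :: "int \<Rightarrow> int \<Rightarrow> 'w \<Rightarrow> 's"
    and X :: "int \<Rightarrow> 'w \<Rightarrow> 'a" +
  assumes approximable: "Lp_m_approximable M 4 S f \<epsilon> \<epsilon>' X"
begin

lemma iid: "indep_vars (\<lambda>_. S) \<epsilon> UNIV" "distr M S (\<epsilon> i) = distr M S (\<epsilon> 0)"
  using approximable unfolding Lp_m_approximable_def iid_sequence_def by blast+

lemma measurable_f [measurable]: "f \<in> borel_measurable (PiM UNIV (\<lambda>_. S))"
  using approximable unfolding Lp_m_approximable_def by blast

lemma measurable_innovations [measurable]: "random_variable S (\<epsilon> i)"
  using iid(1) by (auto simp: indep_vars_def2)

lemma copies: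
  shows "distr M (PiM UNIV (\<lambda>_. S)) (\<lambda>\<omega> k. \<epsilon>' n k \<omega>) = distr M (PiM UNIV (\<lambda>_. S)) (\<lambda>\<omega> k. \<epsilon> k \<omega>)"
    and "indep_vars (\<lambda>_::int option. PiM (UNIV :: int set) (\<lambda>_. S))
       (\<lambda>i \<omega> k. case i of None \<Rightarrow> \<epsilon> k \<omega> | Some n \<Rightarrow> \<epsilon>' n k \<omega>) UNIV"
  using approximable unfolding Lp_m_approximable_def independent_copies_def by blast+

lemma measurable_copy_sequence: "(\<lambda>\<omega> k. \<epsilon>' n k \<omega>) \<in> measurable M (PiM UNIV (\<lambda>_. S))"
proof -
  have "(\<lambda>\<omega> k. case Some n of None \<Rightarrow> \<epsilon> k \<omega> | Some n \<Rightarrow> \<epsilon>' n k \<omega>) \<in> measurable M (PiM UNIV (\<lambda>_. S))"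
    using copies(2) unfolding indep_vars_def2 by blast
  then show ?thesis by simp
qed

lemma measurable_copies [measurable]: "random_variable S (\<epsilon>' n i)"
  using measurable_compose[OF measurable_copy_sequence measurable_component_singleton[of i UNIV]] by simp

lemma copies_iid:
  "indep_vars (\<lambda>_. S) (\<epsilon>' n) UNIV" "distr M S (\<epsilon>' n i) = distr M S (\<epsilon> 0)"
proof -
  have "distr M S (\<epsilon>' n i) = distr (distr M (PiM UNIV (\<lambda>_. S)) (\<lambda>\<omega> k. \<epsilon>' n k \<omega>)) S (\<lambda>x. x i)" for i
    by (subst distr_distr) (auto simp: o_def intro!: measurable_family)
  also have "\<dots> i = distr (distr M (PiM UNIV (\<lambda>_. S)) (\<lambda>\<omega> k. \<epsilon> k \<omega>)) S (\<lambda>x. x i)" for i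
    unfolding copies(1) ..
  also have "\<dots> i = distr M S (\<epsilon> i)" for i
    by (subst distr_distr) (auto simp: o_def intro!: measurable_family)
  finally have law: "distr M S (\<epsilon>' n i) = distr M S (\<epsilon> i)" for i .
  then show "distr M S (\<epsilon>' n i) = distr M S (\<epsilon> 0)" using iid(2) by metis
  have "distr M (PiM UNIV (\<lambda>_. S)) (\<lambda>\<omega>. \<lambda>k\<in>UNIV. \<epsilon>' n k \<omega>) = PiM UNIV (\<lambda>i. distr M S (\<epsilon>' n i))"
    using copies(1)[of n] indep_vars_iff_distr_eq_PiM'[where I = UNIV and M' = "\<lambda>_. S" and X = \<epsilon>] iid(1)
    by (simp add: law restrict_UNIV)
  then show "indep_vars (\<lambda>_. S) (\<epsilon>' n) UNIV"
    using indep_vars_iff_distr_eq_PiM'[where I = UNIV and M' = "\<lambda>_. S" and X = "\<epsilon>' n"] by simp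
qed

lemma joint_innovations_indep: "indep_vars (\<lambda>_. S) (case_sum \<epsilon> (\<epsilon>' n)) UNIV"
proof (rule indep_vars_case_sum[OF iid(1) copies_iid(1)])
  let ?\<Pi> = "PiM UNIV (\<lambda>_. S) :: (int \<Rightarrow> 's) measure"
  fix E F assume EF: "E \<in> sets ?\<Pi>" "F \<in> sets ?\<Pi>"
  define G where "G i = (case i of None \<Rightarrow> E | Some (_::int) \<Rightarrow> F)" for i
  let ?Z = "\<lambda>i \<omega> k. case i of None \<Rightarrow> \<epsilon> k \<omega> | Some n \<Rightarrow> \<epsilon>' n k \<omega>"
  have "prob (\<Inter>i\<in>{None, Some n}. ?Z i -` G i \<inter> space M) = (\<Prod>i\<in>{None, Some n}. prob (?Z i -` G i \<inter> space M))"
    by (rule indep_varsD[OF copies(2)]) (use EF in \<open>auto simp: G_def split: option.split\<close>)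
  moreover have "(\<Inter>i\<in>{None, Some n}. ?Z i -` G i \<inter> space M) =
      {\<omega> \<in> space M. (\<lambda>k. \<epsilon> k \<omega>) \<in> E \<and> (\<lambda>k. \<epsilon>' n k \<omega>) \<in> F}"
    by (auto simp: G_def)
  moreover have "?Z None -` G None \<inter> space M = {\<omega> \<in> space M. (\<lambda>k. \<epsilon> k \<omega>) \<in> E}"
    "?Z (Some n) -` G (Some n) \<inter> space M = {\<omega> \<in> space M. (\<lambda>k. \<epsilon>' n k \<omega>) \<in> F}"
    by (auto simp: G_def)
  ultimately show "prob {\<omega> \<in> space M. (\<lambda>k. \<epsilon> k \<omega>) \<in> E \<and> (\<lambda>k. \<epsilon>' n k \<omega>) \<in> F} =
      prob {\<omega> \<in> space M. (\<lambda>k. \<epsilon> k \<omega>) \<in> E} * prob {\<omega> \<in> space M. (\<lambda>k. \<epsilon>' n k \<omega>) \<in> F}"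
    by simp
qed

lemma joint_innovations_law: "distr M S (case_sum \<epsilon> (\<epsilon>' n) j) = distr M S (\<epsilon> 0)"
  using iid(2) copies_iid(2) by (cases j) auto

text \<open>
  The causal version of the sequence; \<open>X n\<close> agrees with it only almost surely.
\<close>

definition past :: "int \<Rightarrow> 'w \<Rightarrow> 'a" where
  "past n \<omega> = f (\<lambda>k. \<epsilon> (n - int k) \<omega>)"

definition law :: "'a measure" where
  "law = distr (PiM UNIV (\<lambda>_::nat. distr M S (\<epsilon> 0))) borel f"

lemma measurable_past [measurable]: "past n \<in> borel_measurable M"
  unfolding past_def[abs_def] by measurable

lemma measurable_coupled [measurable]: "coupled f \<epsilon> \<epsilon>' k n \<in> borel_measurable M"
  unfolding coupled_def[abs_def] by measurable

lemma AE_past: "AE \<omega> in M. X n \<omega> = past n \<omega>"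
  using approximable unfolding Lp_m_approximable_def past_def by blast

lemma distr_reindex_law:
  assumes "inj \<phi>"
  shows "distr M borel (\<lambda>\<omega>. f (\<lambda>k. case_sum \<epsilon> (\<epsilon>' n) (\<phi> k) \<omega>)) = law"
proof -
  have [measurable]: "random_variable S (case_sum \<epsilon> (\<epsilon>' n) j)" for j by (cases j) auto
  have sets_eq: "sets (PiM UNIV (\<lambda>_::nat. S)) = sets (PiM UNIV (\<lambda>_. distr M S (\<epsilon> 0)))"
    by (intro sets_PiM_cong) auto
  show ?thesis
    unfolding law_def distr_iid_reindex[OF joint_innovations_indep[of n] joint_innovations_law assms, symmetric]
    by (subst distr_distr) (auto simp: o_def intro!: measurable_family)
qed

lemma past_eq_case_sum: "past n \<omega> = f (\<lambda>k. case_sum \<epsilon> (\<epsilon>' m) (Inl (n - int k)) \<omega>)"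
  by (simp add: past_def)

lemma coupled_eq_case_sum:
  "coupled f \<epsilon> \<epsilon>' k n \<omega> =
    f (\<lambda>i. case_sum \<epsilon> (\<epsilon>' n) (if i < k then Inl (n - int i) else Inr (n - int i)) \<omega>)"
  unfolding coupled_def by (rule arg_cong[of _ _ f]) auto

lemma distr_past: "distr M borel (past n) = law"
  unfolding past_eq_case_sum[abs_def, where m = 0] by (rule distr_reindex_law) (auto simp: inj_def)

lemma distr_coupled: "distr M borel (coupled f \<epsilon> \<epsilon>' k n) = law"
  unfolding coupled_eq_case_sum[abs_def] by (rule distr_reindex_law) (auto simp: inj_def split: if_splits)

text \<open>
  At time \<open>n + k\<close> the coupled element of order \<open>k\<close> reads the innovations \<open>n + 1, \<dots>, n + k\<close> and the
  copy, whereas \<open>past n\<close> reads the innovations up to \<open>n\<close>.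
\<close>

lemma past_coupled_indep:
  "distr M (borel \<Otimes>\<^sub>M borel) (\<lambda>\<omega>. (past n \<omega>, coupled f \<epsilon> \<epsilon>' k (n + int k) \<omega>)) = law \<Otimes>\<^sub>M law"
proof -
  have "indep_var borel (past n) borel (coupled f \<epsilon> \<epsilon>' k (n + int k))"
    unfolding past_eq_case_sum[abs_def, where m = "n + int k"] coupled_eq_case_sum[abs_def]
    by (rule indep_var_reindex[OF joint_innovations_indep _ measurable_f]) auto
  then show ?thesis by (simp add: indep_var_distribution_eq distr_past distr_coupled)
qed

text \<open>
  Stationarity of the coupling.  It carries the summability assumption, which speaks of the order
  \<open>k\<close> at time \<open>k\<close> only, to all times.
\<close>

lemma distr_past_coupled:
  "distr M (borel \<Otimes>\<^sub>M borel) (\<lambda>\<omega>. (past n \<omega>, coupled f \<epsilon> \<epsilon>' k n \<omega>)) =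
   distr M (borel \<Otimes>\<^sub>M borel) (\<lambda>\<omega>. (past m \<omega>, coupled f \<epsilon> \<epsilon>' k m \<omega>))"
proof -
  define H where "H x = (f (\<lambda>i. x (Inl i)), f (\<lambda>i. if i < k then x (Inl i) else x (Inr i)))" for x :: "nat + nat \<Rightarrow> 's"
  have [measurable]: "H \<in> measurable (PiM UNIV (\<lambda>_. S)) (borel \<Otimes>\<^sub>M borel)"
    unfolding H_def[abs_def] by measurable
  have "distr M (borel \<Otimes>\<^sub>M borel) (\<lambda>\<omega>. (past n \<omega>, coupled f \<epsilon> \<epsilon>' k n \<omega>)) =
      distr (PiM UNIV (\<lambda>_. distr M S (\<epsilon> 0))) (borel \<Otimes>\<^sub>M borel) H" for n
  proof -
    let ?\<phi> = "map_sum (\<lambda>i::nat. n - int i) (\<lambda>i::nat. n - int i)"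
    have inj: "inj ?\<phi>" by (intro sum.inj_map) (auto simp: inj_def)
    have [measurable]: "random_variable S (case_sum \<epsilon> (\<epsilon>' n) j)" for j by (cases j) auto
    have "(past n \<omega>, coupled f \<epsilon> \<epsilon>' k n \<omega>) = H (\<lambda>j. case_sum \<epsilon> (\<epsilon>' n) (?\<phi> j) \<omega>)" for \<omega>
      unfolding H_def past_def coupled_def by (auto intro!: arg_cong[of _ _ f])
    then show ?thesis
      unfolding distr_iid_reindex[OF joint_innovations_indep[of n] joint_innovations_law inj, symmetric]
      by (subst distr_distr) (auto simp: o_def intro!: measurable_family)
  qed
  then show ?thesis by simp
qed

end

section \<open>Mean square error of averages\<close>

lemma sum_lag_le:
  fixes r :: "nat \<Rightarrow> real"
  assumes r: "summable r" "\<And>k. 0 \<le> r k" and n: "n \<in> {1..N}"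
  shows "(\<Sum>m\<in>{1..N}. r (if m \<le> n then n - m else m - n)) \<le> 2 * suminf r"
proof -
  have "(\<Sum>m\<in>{1..N}. r (if m \<le> n then n - m else m - n)) =
      (\<Sum>m\<in>{1..n}. r (n - m)) + (\<Sum>m\<in>{n<..N}. r (m - n))"
  proof -
    have "{1..N} = {1..n} \<union> {n<..N}" using n by auto
    then show ?thesis by (simp add: sum.union_disjoint ivl_disj_int)
  qed
  also have "(\<Sum>m\<in>{1..n}. r (n - m)) = sum r ((\<lambda>m. n - m) ` {1..n})"
    by (subst sum.reindex) (auto simp: inj_on_def)
  also have "\<dots> \<le> suminf r" by (rule sum_le_suminf) (use r in auto)
  also have "(\<Sum>m\<in>{n<..N}. r (m - n)) = sum r ((\<lambda>m. m - n) ` {n<..N})"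
    by (subst sum.reindex) (auto simp: inj_on_def)
  also have "\<dots> \<le> suminf r" by (rule sum_le_suminf) (use r in auto)
  finally show ?thesis by simp
qed

lemma (in prob_space) power2_expectation_le:
  fixes Y :: "'a \<Rightarrow> real"
  assumes "Y \<in> borel_measurable M" "integrable M (\<lambda>x. (Y x)\<^sup>2)"
  shows "(expectation Y)\<^sup>2 \<le> expectation (\<lambda>x. (Y x)\<^sup>2)"
  using variance_eq[OF square_integrable_imp_integrable[OF assms] assms(2)] variance_positive[of Y] by simp

text \<open>
  For processes indexed by a \<open>\<sigma>\<close>-finite space \<open>T\<close>, seen as random elements of \<open>L\<^sup>2(T)\<close>, expanding the
  square gives \<open>E \<parallel>(\<Sum> Z\<^sub>n) / N - E Z\<^sub>1\<parallel>\<^sup>2 = 1/N\<^sup>2 (\<Sum>\<^sub>n \<Sum>\<^sub>m E \<langle>Z\<^sub>n, Z\<^sub>m\<rangle> - c)\<close>, where \<open>c\<close> is the expected inner product of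
  independent copies of \<open>Z\<^sub>n\<close> and \<open>Z\<^sub>1\<close>.  Summability over the lags leaves a sum of order \<open>N\<close>.
  The mean enters through the iterated integral \<open>c\<close> alone.  The pointwise identity
  \<open>E Z\<^sub>n \<tau> = E Z\<^sub>1 \<tau>\<close> is thereby avoided; it would be awkward to extract when only the laws of the classes
  modulo null sets agree.
\<close>

lemma (in prob_space) mean_square_error:
  fixes Z :: "nat \<Rightarrow> 'a \<Rightarrow> 't \<Rightarrow> real" and T :: "'t measure"
  assumes T: "sigma_finite_measure T"
    and meas: "\<And>n. (\<lambda>(\<omega>, \<tau>). Z n \<omega> \<tau>) \<in> borel_measurable (M \<Otimes>\<^sub>M T)"
    and sq: "\<And>n \<omega>. \<omega> \<in> space M \<Longrightarrow> integrable T (\<lambda>\<tau>. (Z n \<omega> \<tau>)\<^sup>2)"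
    and int: "\<And>n. integrable M (\<lambda>\<omega>. LINT \<tau>|T. (Z n \<omega> \<tau>)\<^sup>2)"
    and mean: "\<And>n. 1 \<le> n \<Longrightarrow> (LINT \<omega>|M. LINT \<omega>'|M. LINT \<tau>|T. Z n \<omega> \<tau> * Z 1 \<omega>' \<tau>) = c"
    and cov: "\<And>n k. 1 \<le> n \<Longrightarrow> \<bar>(LINT \<omega>|M. LINT \<tau>|T. Z n \<omega> \<tau> * Z (n + k) \<omega> \<tau>) - c\<bar> \<le> r k"
    and r: "summable r" "\<And>k. 0 \<le> r k" and N: "1 \<le> N"
  shows "integrable M (\<lambda>\<omega>. LINT \<tau>|T. ((\<Sum>n\<in>{1..N}. Z n \<omega> \<tau>) / real N - (LINT \<omega>'|M. Z 1 \<omega>' \<tau>))\<^sup>2)" (is ?A)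
    and "(LINT \<omega>|M. LINT \<tau>|T. ((\<Sum>n\<in>{1..N}. Z n \<omega> \<tau>) / real N - (LINT \<omega>'|M. Z 1 \<omega>' \<tau>))\<^sup>2)
      \<le> 2 * suminf r / real N" (is ?B)
    and "\<And>\<omega>. \<omega> \<in> space M \<Longrightarrow>
      integrable T (\<lambda>\<tau>. ((\<Sum>n\<in>{1..N}. Z n \<omega> \<tau>) / real N - (LINT \<omega>'|M. Z 1 \<omega>' \<tau>))\<^sup>2)"
    and "integrable T (\<lambda>\<tau>. (LINT \<omega>'|M. Z 1 \<omega>' \<tau>)\<^sup>2)"
proof -
  interpret T: sigma_finite_measure T by (rule T)
  interpret MT: pair_sigma_finite M T ..
  let ?MT = "M \<Otimes>\<^sub>M T"
  define \<mu> where "\<mu> \<tau> = (LINT \<omega>|M. Z 1 \<omega> \<tau>)" for \<tau>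
  note [measurable] = meas
  have Zsec [measurable]: "Z n \<omega> \<in> borel_measurable T" if "\<omega> \<in> space M" for n \<omega>
    using that by measurable
  have \<mu>m [measurable]: "\<mu> \<in> borel_measurable T" unfolding \<mu>_def[abs_def] by measurable
  have Zsq: "integrable ?MT (\<lambda>x. (case_prod (Z n) x)\<^sup>2)" for n
  proof (rule MT.Fubini_integrable)
    show "integrable M (\<lambda>\<omega>. LINT \<tau>|T. norm ((case_prod (Z n) (\<omega>, \<tau>))\<^sup>2))" using int by simp
    show "AE \<omega> in M. integrable T (\<lambda>\<tau>. (case_prod (Z n) (\<omega>, \<tau>))\<^sup>2)" using sq by simp
  qed measurable
  have Zsq': "integrable ?MT (case_prod (\<lambda>\<omega> \<tau>. (Z n \<omega> \<tau>)\<^sup>2))" for n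
    using Zsq[of n] by (simp add: case_prod_unfold)
  have \<mu>_sq: "integrable T (\<lambda>\<tau>. (\<mu> \<tau>)\<^sup>2)"
  proof (rule Bochner_Integration.integrable_bound[OF MT.integrable_snd[OF Zsq'[of 1]]])
    show "AE \<tau> in T. norm ((\<mu> \<tau>)\<^sup>2) \<le> norm (LINT \<omega>|M. (Z 1 \<omega> \<tau>)\<^sup>2)"
      using MT.AE_integrable_snd[OF Zsq'[of 1]] AE_space
    proof eventually_elim
      case (elim \<tau>)
      then have "(\<lambda>\<omega>. Z 1 \<omega> \<tau>) \<in> borel_measurable M" by measurable
      from power2_expectation_le[OF this] elim show ?case by (simp add: \<mu>_def)
    qed
  qed measurable
  then show "integrable T (\<lambda>\<tau>. (LINT \<omega>'|M. Z 1 \<omega>' \<tau>)\<^sup>2)" by (simp add: \<mu>_def)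
  have \<mu>_sq': "integrable ?MT (\<lambda>x. (\<mu> (snd x))\<^sup>2)"
    by (rule MT.Fubini_integrable) (use \<mu>_sq in auto)
  have ZZ: "integrable ?MT (\<lambda>x. case_prod (Z n) x * case_prod (Z m) x)" for n m
    by (rule integrable_mult_of_squares[OF _ _ Zsq Zsq]) measurable
  have Z\<mu>: "integrable ?MT (\<lambda>x. case_prod (Z n) x * \<mu> (snd x))" for n
    by (rule integrable_mult_of_squares[OF _ _ Zsq \<mu>_sq']) measurable
  have q: "integral\<^sup>L ?MT (\<lambda>x. case_prod (Z n) x * case_prod (Z m) x) = (LINT \<omega>|M. LINT \<tau>|T. Z n \<omega> \<tau> * Z m \<omega> \<tau>)" for n m
    using MT.integral_fst'[OF ZZ[of n m]] by simp
  have p: "integral\<^sup>L ?MT (\<lambda>x. case_prod (Z n) x * \<mu> (snd x)) = c" if "1 \<le> n" for n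
  proof -
    have "integral\<^sup>L ?MT (\<lambda>x. case_prod (Z n) x * \<mu> (snd x)) = (LINT \<omega>|M. LINT \<tau>|T. Z n \<omega> \<tau> * \<mu> \<tau>)"
      using MT.integral_fst'[OF Z\<mu>[of n]] by simp
    also have "\<dots> = (LINT \<omega>|M. LINT \<omega>'|M. LINT \<tau>|T. Z n \<omega> \<tau> * Z 1 \<omega>' \<tau>)"
    proof (rule Bochner_Integration.integral_cong[OF refl])
      fix \<omega> assume \<omega>: "\<omega> \<in> space M"
      have "integrable ?MT (\<lambda>x. (Z n \<omega> (snd x))\<^sup>2)"
        by (rule MT.Fubini_integrable) (use sq[OF \<omega>] Zsec[OF \<omega>] in auto)
      then have "integrable ?MT (\<lambda>x. Z n \<omega> (snd x) * case_prod (Z 1) x)"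
        using Zsec[OF \<omega>] by (intro integrable_mult_of_squares[OF _ _ _ Zsq]) auto
      then have "integrable ?MT (case_prod (\<lambda>\<omega>' \<tau>. Z n \<omega> \<tau> * Z 1 \<omega>' \<tau>))"
        by (simp add: case_prod_unfold)
      from MT.Fubini_integral[OF this]
      show "(LINT \<tau>|T. Z n \<omega> \<tau> * \<mu> \<tau>) = (LINT \<omega>'|M. LINT \<tau>|T. Z n \<omega> \<tau> * Z 1 \<omega>' \<tau>)"
        by (simp add: \<mu>_def)
    qed
    finally show ?thesis using mean[OF that] by simp
  qed
  have p0: "integral\<^sup>L ?MT (\<lambda>x. (\<mu> (snd x))\<^sup>2) = c"
  proof -
    have "integral\<^sup>L ?MT (\<lambda>x. (\<mu> (snd x))\<^sup>2) = (LINT \<tau>|T. \<mu> \<tau> * \<mu> \<tau>)"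
      using MT.integral_fst'[OF \<mu>_sq'] by (simp add: prob_space power2_eq_square)
    also have "\<dots> = (LINT \<tau>|T. LINT \<omega>|M. Z 1 \<omega> \<tau> * \<mu> \<tau>)"
      by (simp add: \<mu>_def)
    also have "\<dots> = integral\<^sup>L ?MT (\<lambda>x. case_prod (Z 1) x * \<mu> (snd x))"
      using Z\<mu>[of 1] by (subst MT.integral_snd) (simp_all add: case_prod_unfold)
    finally show ?thesis using p[of 1] by simp
  qed
  define W where "W x = (\<Sum>n\<in>{1..N}. case_prod (Z n) x) / real N - \<mu> (snd x)" for x
  have W_sq: "(W x)\<^sup>2 = (\<Sum>n\<in>{1..N}. \<Sum>m\<in>{1..N}. case_prod (Z n) x * case_prod (Z m) x) / (real N)\<^sup>2
      - 2 / real N * (\<Sum>n\<in>{1..N}. case_prod (Z n) x * \<mu> (snd x)) + (\<mu> (snd x))\<^sup>2" for x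
    unfolding W_def sum_product[symmetric] sum_distrib_right[symmetric]
    by (simp only: power2_diff power_divide) (simp add: power2_eq_square)
  have W_int: "integrable ?MT (\<lambda>x. (W x)\<^sup>2)"
    unfolding W_sq using ZZ Z\<mu> \<mu>_sq' by auto
  have q_le: "\<bar>(LINT \<omega>|M. LINT \<tau>|T. Z n \<omega> \<tau> * Z m \<omega> \<tau>) - c\<bar> \<le> r (if m \<le> n then n - m else m - n)"
    if "1 \<le> n" "1 \<le> m" for n m
    using cov[of n "m - n"] cov[of m "n - m"] that by (auto simp: mult.commute)
  have "integral\<^sup>L ?MT (\<lambda>x. (W x)\<^sup>2) =
      (\<Sum>n\<in>{1..N}. \<Sum>m\<in>{1..N}. LINT \<omega>|M. LINT \<tau>|T. Z n \<omega> \<tau> * Z m \<omega> \<tau>) / (real N)\<^sup>2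
      - 2 / real N * (\<Sum>n\<in>{1..N}. c) + c"
    unfolding W_sq using ZZ Z\<mu> \<mu>_sq' by (simp add: q p p0)
  also have "\<dots> = (\<Sum>n\<in>{1..N}. \<Sum>m\<in>{1..N}. (LINT \<omega>|M. LINT \<tau>|T. Z n \<omega> \<tau> * Z m \<omega> \<tau>) - c) / (real N)\<^sup>2"
    using N by (simp add: sum_subtractf field_simps power2_eq_square)
  also have "\<dots> \<le> (\<Sum>n\<in>{1..N}. \<Sum>m\<in>{1..N}. r (if m \<le> n then n - m else m - n)) / (real N)\<^sup>2"
    by (intro divide_right_mono sum_mono order_trans[OF abs_ge_self q_le]) auto
  also have "\<dots> \<le> (\<Sum>n\<in>{1..N}. 2 * suminf r) / (real N)\<^sup>2"
    by (intro divide_right_mono sum_mono sum_lag_le r) auto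
  also have "\<dots> = 2 * suminf r / real N" using N by (simp add: power2_eq_square)
  finally have W_le: "integral\<^sup>L ?MT (\<lambda>x. (W x)\<^sup>2) \<le> 2 * suminf r / real N" .
  show ?A using MT.integrable_fst'[OF W_int] by (simp add: W_def \<mu>_def)
  show ?B using MT.integral_fst'[OF W_int] W_le by (simp add: W_def \<mu>_def)
  fix \<omega> assume \<omega>: "\<omega> \<in> space M"
  have ZZ': "integrable T (\<lambda>\<tau>. Z n \<omega> \<tau> * Z m \<omega> \<tau>)" for n m
    by (rule integrable_mult_of_squares[OF _ _ sq[OF \<omega>] sq[OF \<omega>]]) (use Zsec[OF \<omega>] in auto)
  have Z\<mu>': "integrable T (\<lambda>\<tau>. Z n \<omega> \<tau> * \<mu> \<tau>)" for n
    by (rule integrable_mult_of_squares[OF _ _ sq[OF \<omega>] \<mu>_sq]) (use Zsec[OF \<omega>] in auto)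
  have "integrable T (\<lambda>\<tau>. (W (\<omega>, \<tau>))\<^sup>2)"
    unfolding W_sq using ZZ' Z\<mu>' \<mu>_sq by simp
  then show "integrable T (\<lambda>\<tau>. ((\<Sum>n\<in>{1..N}. Z n \<omega> \<tau>) / real N - (LINT \<omega>'|M. Z 1 \<omega>' \<tau>))\<^sup>2)"
    by (simp add: W_def \<mu>_def)
qed

section \<open>Autocovariances of approximable sequences\<close>

lemma young_four:
  fixes a b c d :: real
  shows "a * b * c * d \<le> (a ^ 4 + b ^ 4 + c ^ 4 + d ^ 4) / 4"
proof -
  have "2 * ((a * b) * (c * d)) \<le> (a * b)\<^sup>2 + (c * d)\<^sup>2" by (simp add: sum_squares_bound[of "a * b" "c * d", simplified mult.assoc] mult.assoc)
  moreover have "2 * (a\<^sup>2 * b\<^sup>2) \<le> (a\<^sup>2)\<^sup>2 + (b\<^sup>2)\<^sup>2" using sum_squares_bound[of "a\<^sup>2" "b\<^sup>2"] by (simp add: mult.assoc)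
  moreover have "2 * (c\<^sup>2 * d\<^sup>2) \<le> (c\<^sup>2)\<^sup>2 + (d\<^sup>2)\<^sup>2" using sum_squares_bound[of "c\<^sup>2" "d\<^sup>2"] by (simp add: mult.assoc)
  ultimately show ?thesis by (simp add: power_mult_distrib power_mult[symmetric] mult.assoc)
qed

lemma power4_sum_le:
  fixes a b :: real
  shows "(a + b) ^ 4 \<le> 8 * (a ^ 4 + b ^ 4)"
proof -
  have *: "(x + y)\<^sup>2 \<le> 2 * (x\<^sup>2 + y\<^sup>2)" for x y :: real
    using sum_squares_bound[of x y] by (simp add: power2_sum)
  have "(a + b) ^ 4 = ((a + b)\<^sup>2)\<^sup>2" by (simp add: power_mult[symmetric])
  also have "\<dots> \<le> (2 * (a\<^sup>2 + b\<^sup>2))\<^sup>2" by (rule power_mono[OF *]) simp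
  also have "\<dots> = 4 * (a\<^sup>2 + b\<^sup>2)\<^sup>2" by (simp only: power_mult_distrib) simp
  also have "\<dots> \<le> 4 * (2 * ((a\<^sup>2)\<^sup>2 + (b\<^sup>2)\<^sup>2))" by (intro mult_left_mono *) simp
  finally show ?thesis by (simp add: power_mult[symmetric])
qed

text \<open>
  The scalar functions of two observations whose autocovariances are needed.  The weights are such
  that four factors with finite fourth moment control increments in the second argument.
\<close>

definition admissible :: "('a::real_normed_vector \<Rightarrow> 'a \<Rightarrow> real) \<Rightarrow> bool" where
  "admissible \<kappa> \<longleftrightarrow>
     case_prod \<kappa> \<in> borel_measurable (borel \<Otimes>\<^sub>M borel) \<and>
     (\<forall>x y. \<bar>\<kappa> x y\<bar> \<le> (1 + norm x)\<^sup>2 * (1 + norm y)\<^sup>2) \<and>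
     (\<forall>x y z. \<bar>\<kappa> x y - \<kappa> x z\<bar> \<le> (1 + norm x)\<^sup>2 * (1 + norm y + norm z) * norm (y - z))"

context approximable
begin

definition decay :: "nat \<Rightarrow> real" where
  "decay k = nu M 4 (\<lambda>\<omega>. X (int k) \<omega> - coupled f \<epsilon> \<epsilon>' k (int k) \<omega>)"

definition moment :: real where
  "moment = (LINT x|law. norm x ^ 4)"

lemma prob_space_law: "prob_space law"
  unfolding distr_past[of 0, symmetric] by (rule prob_space_distr) measurable

lemma sets_law [measurable_cong]: "sets law = sets borel"
  by (simp add: law_def)

lemma integrable_law_norm4: "integrable law (\<lambda>x. norm x ^ 4)"
proof -
  have "Lp_random_element M 4 (X 0)" using approximable unfolding Lp_m_approximable_def by blast
  then have m: "X 0 \<in> borel_measurable M" and i: "integrable M (\<lambda>\<omega>. norm (X 0 \<omega>) powr 4)"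
    unfolding Lp_random_element_def by blast+
  have "integrable M (\<lambda>\<omega>. norm (past 0 \<omega>) powr 4)"
    using i AE_past[of 0] m by (subst (asm) integrable_cong_AE[where g = "\<lambda>\<omega>. norm (past 0 \<omega>) powr 4"]) auto
  then have "integrable M (\<lambda>\<omega>. norm (past 0 \<omega>) ^ 4)" by simp
  then show ?thesis
    unfolding distr_past[of 0, symmetric] by (subst integrable_distr_eq) auto
qed

lemma integrable_past_norm4: "integrable M (\<lambda>\<omega>. norm (past n \<omega>) ^ 4)"
  and integrable_coupled_norm4: "integrable M (\<lambda>\<omega>. norm (coupled f \<epsilon> \<epsilon>' k n \<omega>) ^ 4)"
  and expectation_past_norm4: "expectation (\<lambda>\<omega>. norm (past n \<omega>) ^ 4) = moment"
  and expectation_coupled_norm4: "expectation (\<lambda>\<omega>. norm (coupled f \<epsilon> \<epsilon>' k n \<omega>) ^ 4) = moment"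
proof -
  show "integrable M (\<lambda>\<omega>. norm (past n \<omega>) ^ 4)"
    using integrable_law_norm4 unfolding distr_past[of n, symmetric] by (subst (asm) integrable_distr_eq) auto
  show "integrable M (\<lambda>\<omega>. norm (coupled f \<epsilon> \<epsilon>' k n \<omega>) ^ 4)"
    using integrable_law_norm4 unfolding distr_coupled[of k n, symmetric] by (subst (asm) integrable_distr_eq) auto
  show "expectation (\<lambda>\<omega>. norm (past n \<omega>) ^ 4) = moment"
    unfolding moment_def distr_past[of n, symmetric] by (subst integral_distr) auto
  show "expectation (\<lambda>\<omega>. norm (coupled f \<epsilon> \<epsilon>' k n \<omega>) ^ 4) = moment"
    unfolding moment_def distr_coupled[of k n, symmetric] by (subst integral_distr) auto
qed

lemma moment_nonneg: "0 \<le> moment"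
  by (simp add: moment_def)

lemma integrable_difference_norm4: "integrable M (\<lambda>\<omega>. norm (past n \<omega> - coupled f \<epsilon> \<epsilon>' k n \<omega>) ^ 4)"
proof (rule Bochner_Integration.integrable_bound)
  show "integrable M (\<lambda>\<omega>. 8 * (norm (past n \<omega>) ^ 4 + norm (coupled f \<epsilon> \<epsilon>' k n \<omega>) ^ 4))"
    using integrable_past_norm4 integrable_coupled_norm4 by auto
  show "AE \<omega> in M. norm (norm (past n \<omega> - coupled f \<epsilon> \<epsilon>' k n \<omega>) ^ 4) \<le>
      norm (8 * (norm (past n \<omega>) ^ 4 + norm (coupled f \<epsilon> \<epsilon>' k n \<omega>) ^ 4))"
  proof (rule AE_I2)
    fix \<omega>
    have "norm (past n \<omega> - coupled f \<epsilon> \<epsilon>' k n \<omega>) ^ 4 \<le> (norm (past n \<omega>) + norm (coupled f \<epsilon> \<epsilon>' k n \<omega>)) ^ 4"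
      by (intro power_mono norm_triangle_ineq4) simp
    also have "\<dots> \<le> 8 * (norm (past n \<omega>) ^ 4 + norm (coupled f \<epsilon> \<epsilon>' k n \<omega>) ^ 4)" by (rule power4_sum_le)
    finally show "norm (norm (past n \<omega> - coupled f \<epsilon> \<epsilon>' k n \<omega>) ^ 4) \<le>
      norm (8 * (norm (past n \<omega>) ^ 4 + norm (coupled f \<epsilon> \<epsilon>' k n \<omega>) ^ 4))" by simp
  qed
qed measurable

lemma decay_nonneg: "0 \<le> decay k" by (simp add: decay_def nu_def)

lemma expectation_difference_norm4:
  "expectation (\<lambda>\<omega>. norm (past n \<omega> - coupled f \<epsilon> \<epsilon>' k n \<omega>) ^ 4) = decay k ^ 4"
proof -
  have X: "X (int k) \<in> borel_measurable M"
    using approximable unfolding Lp_m_approximable_def Lp_random_element_def by blast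
  have shift: "expectation (\<lambda>\<omega>. norm (past n \<omega> - coupled f \<epsilon> \<epsilon>' k n \<omega>) ^ 4) =
      integral\<^sup>L (distr M (borel \<Otimes>\<^sub>M borel) (\<lambda>\<omega>. (past n \<omega>, coupled f \<epsilon> \<epsilon>' k n \<omega>))) (\<lambda>(x, y). norm (x - y) ^ 4)" for n
    by (subst integral_distr) auto
  have "expectation (\<lambda>\<omega>. norm (past n \<omega> - coupled f \<epsilon> \<epsilon>' k n \<omega>) ^ 4) =
      expectation (\<lambda>\<omega>. norm (past (int k) \<omega> - coupled f \<epsilon> \<epsilon>' k (int k) \<omega>) ^ 4)"
    unfolding shift distr_past_coupled[of n k "int k"] ..
  also have "\<dots> = (LINT \<omega>|M. norm (X (int k) \<omega> - coupled f \<epsilon> \<epsilon>' k (int k) \<omega>) powr 4)"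
    using X AE_past[of "int k"] by (intro integral_cong_AE) auto
  also have "\<dots> = decay k ^ 4"
  proof -
    have "0 \<le> (LINT \<omega>|M. norm (X (int k) \<omega> - coupled f \<epsilon> \<epsilon>' k (int k) \<omega>) powr 4)" by simp
    then show ?thesis unfolding decay_def nu_def
      by (subst powr_numeral[symmetric]) (auto simp: powr_powr)
  qed
  finally show ?thesis .
qed

lemma summable_decay: "summable (\<lambda>k. decay (Suc k))"
  using approximable unfolding Lp_m_approximable_def decay_def Let_def by simp

text \<open>
  The factor comes from \<open>(16 (1 + m) + 64 (1 + 2 m) + 1) / 4 \<le> 40 (1 + m)\<close>, with \<open>m\<close> the fourth
  moment, in the estimate below.
\<close>

definition cov_const :: real where "cov_const = 40 * (1 + moment)"

definition independent_mean :: "('a \<Rightarrow> 'a \<Rightarrow> real) \<Rightarrow> real" where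
  "independent_mean \<kappa> = integral\<^sup>L (law \<Otimes>\<^sub>M law) (case_prod \<kappa>)"

lemma weight_product_le: "(1 + norm x)\<^sup>2 * (1 + norm y)\<^sup>2 \<le> 4 * (2 + norm x ^ 4 + norm y ^ 4)"
proof -
  have "(1 + norm x)\<^sup>2 * (1 + norm y)\<^sup>2 \<le> ((1 + norm x) ^ 4 + (1 + norm y) ^ 4) / 2"
  proof -
    have "a\<^sup>2 * b\<^sup>2 \<le> (a ^ 4 + b ^ 4) / 2" for a b :: real
      using young_four[of a a b b] by (simp add: power2_eq_square mult.assoc)
    then show ?thesis .
  qed
  also have "\<dots> \<le> (8 * (1 ^ 4 + norm x ^ 4) + 8 * (1 ^ 4 + norm y ^ 4)) / 2"
    by (intro divide_right_mono add_mono power4_sum_le) simp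
  finally show ?thesis by simp
qed

lemma admissible_le:
  assumes "admissible \<kappa>"
  shows "\<bar>\<kappa> x y\<bar> \<le> 4 * (2 + norm x ^ 4 + norm y ^ 4)"
  using assms weight_product_le[of x y] unfolding admissible_def by (meson order_trans)

lemma integrable_admissible:
  assumes k: "admissible \<kappa>" and A: "A \<in> borel_measurable M" "integrable M (\<lambda>\<omega>. norm (A \<omega>) ^ 4)"
    and B: "B \<in> borel_measurable M" "integrable M (\<lambda>\<omega>. norm (B \<omega>) ^ 4)"
  shows "integrable M (\<lambda>\<omega>. \<kappa> (A \<omega>) (B \<omega>))"
proof (rule Bochner_Integration.integrable_bound)
  show "integrable M (\<lambda>\<omega>. 4 * (2 + norm (A \<omega>) ^ 4 + norm (B \<omega>) ^ 4))" using A B by auto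
  have "case_prod \<kappa> \<in> borel_measurable (borel \<Otimes>\<^sub>M borel)" using k by (simp add: admissible_def)
  from measurable_compose[OF measurable_Pair[OF A(1) B(1)] this]
  show "(\<lambda>\<omega>. \<kappa> (A \<omega>) (B \<omega>)) \<in> borel_measurable M" by simp
  show "AE \<omega> in M. norm (\<kappa> (A \<omega>) (B \<omega>)) \<le> norm (4 * (2 + norm (A \<omega>) ^ 4 + norm (B \<omega>) ^ 4))"
    using admissible_le[OF k] by (auto simp: abs_of_nonneg)
qed

text \<open>
  Replace the later observation by its coupled version of order \<open>k\<close>, which is independent of the
  earlier one.  The increment of \<open>\<kappa>\<close> is at most \<open>(1 + \<parallel>x\<parallel>)\<^sup>2 (1 + \<parallel>y\<parallel> + \<parallel>z\<parallel>) \<parallel>y - z\<parallel>\<close>, and the inequality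
  between arithmetic and geometric means of fourth powers, with the last factor divided by \<open>\<theta>\<close>,
  bounds its expectation by a multiple of \<open>\<theta>\<close>, because \<open>E \<parallel>y - z\<parallel>\<^sup>4 \<le> \<theta>\<^sup>4\<close>.
\<close>

lemma autocovariance_bound:
  assumes k: "admissible \<kappa>"
  shows "\<bar>expectation (\<lambda>\<omega>. \<kappa> (past n \<omega>) (past (n + int k) \<omega>)) - independent_mean \<kappa>\<bar>
    \<le> cov_const * (decay k + (1 / 2) ^ k)"
proof -
  let ?Y = "past n" and ?Z = "past (n + int k)" and ?Z' = "coupled f \<epsilon> \<epsilon>' k (n + int k)"
  (* The summable term (1/2)^k keeps theta positive when the coupling is exact. *)
  define \<theta> where "\<theta> = decay k + (1 / 2) ^ k"
  have \<theta>: "0 < \<theta>" "decay k \<le> \<theta>" using decay_nonneg[of k] by (auto simp: \<theta>_def intro: add_nonneg_pos)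
  have km [measurable]: "case_prod \<kappa> \<in> borel_measurable (borel \<Otimes>\<^sub>M borel)" using k by (simp add: admissible_def)
  have mean: "independent_mean \<kappa> = expectation (\<lambda>\<omega>. \<kappa> (?Y \<omega>) (?Z' \<omega>))"
    unfolding independent_mean_def past_coupled_indep[of n k, symmetric] by (subst integral_distr) auto
  define G where "G \<omega> = \<theta> * ((16 * (1 + norm (?Y \<omega>) ^ 4) + 64 * (1 + norm (?Z \<omega>) ^ 4 + norm (?Z' \<omega>) ^ 4) + norm (?Z \<omega> - ?Z' \<omega>) ^ 4 / \<theta> ^ 4) / 4)" for \<omega>
  have pointwise: "\<bar>\<kappa> (?Y \<omega>) (?Z \<omega>) - \<kappa> (?Y \<omega>) (?Z' \<omega>)\<bar> \<le> G \<omega>" for \<omega>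
  proof -
    let ?a = "1 + norm (?Y \<omega>)" and ?b = "1 + norm (?Z \<omega>) + norm (?Z' \<omega>)" and ?d = "norm (?Z \<omega> - ?Z' \<omega>)"
    have "\<bar>\<kappa> (?Y \<omega>) (?Z \<omega>) - \<kappa> (?Y \<omega>) (?Z' \<omega>)\<bar> \<le> ?a\<^sup>2 * ?b * ?d"
      using k unfolding admissible_def by blast
    also have "\<dots> = \<theta> * (?a * ?a * ?b * (?d / \<theta>))" using \<theta> by (simp add: power2_eq_square)
    also have "\<dots> \<le> \<theta> * ((?a ^ 4 + ?a ^ 4 + ?b ^ 4 + (?d / \<theta>) ^ 4) / 4)"
      using \<theta> by (intro mult_left_mono young_four) auto
    also have "\<dots> \<le> \<theta> * ((8 * (1 ^ 4 + norm (?Y \<omega>) ^ 4) + 8 * (1 ^ 4 + norm (?Y \<omega>) ^ 4) +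
        64 * (1 + norm (?Z \<omega>) ^ 4 + norm (?Z' \<omega>) ^ 4) + (?d / \<theta>) ^ 4) / 4)"
    proof -
      have "?b ^ 4 \<le> 8 * ((1 + norm (?Z \<omega>)) ^ 4 + norm (?Z' \<omega>) ^ 4)" by (rule power4_sum_le)
      also have "\<dots> \<le> 8 * (8 * (1 ^ 4 + norm (?Z \<omega>) ^ 4) + norm (?Z' \<omega>) ^ 4)"
        by (intro mult_left_mono add_mono power4_sum_le) auto
      also have "\<dots> \<le> 64 * (1 + norm (?Z \<omega>) ^ 4 + norm (?Z' \<omega>) ^ 4)" by simp
      finally have "?b ^ 4 \<le> 64 * (1 + norm (?Z \<omega>) ^ 4 + norm (?Z' \<omega>) ^ 4)" .
      then show ?thesis
        using \<theta> by (intro mult_left_mono divide_right_mono add_mono power4_sum_le) auto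
    qed
    also have "\<dots> = G \<omega>" by (simp add: G_def power_divide)
    finally show ?thesis .
  qed
  note ints = integrable_past_norm4 integrable_coupled_norm4 integrable_difference_norm4
  have Gi: "integrable M G" unfolding G_def[abs_def] using ints by simp
  have int1: "integrable M (\<lambda>\<omega>. \<kappa> (?Y \<omega>) (?Z \<omega>))" and int2: "integrable M (\<lambda>\<omega>. \<kappa> (?Y \<omega>) (?Z' \<omega>))"
    by (rule integrable_admissible[OF k]; use ints in simp)+
  have "\<bar>expectation (\<lambda>\<omega>. \<kappa> (?Y \<omega>) (?Z \<omega>)) - independent_mean \<kappa>\<bar> =
      \<bar>expectation (\<lambda>\<omega>. \<kappa> (?Y \<omega>) (?Z \<omega>) - \<kappa> (?Y \<omega>) (?Z' \<omega>))\<bar>"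
    unfolding mean using int1 int2 by simp
  also have "\<dots> \<le> expectation (\<lambda>\<omega>. \<bar>\<kappa> (?Y \<omega>) (?Z \<omega>) - \<kappa> (?Y \<omega>) (?Z' \<omega>)\<bar>)" by (rule integral_abs_bound)
  also have "\<dots> \<le> expectation G"
    by (rule integral_mono[OF _ Gi pointwise]) (use int1 int2 in simp)
  also have "\<dots> = \<theta> * ((16 * (1 + moment) + 64 * (1 + moment + moment) + decay k ^ 4 / \<theta> ^ 4) / 4)"
    unfolding G_def[abs_def] using ints
    by (simp add: expectation_past_norm4 expectation_coupled_norm4 expectation_difference_norm4 prob_space)
  also have "\<dots> \<le> \<theta> * ((16 * (1 + moment) + 64 * (1 + moment + moment) + 1) / 4)"
    using \<theta> decay_nonneg[of k] by (intro mult_left_mono divide_right_mono add_mono) (auto simp: power_mono)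
  also have "\<dots> \<le> \<theta> * (40 * (1 + moment))"
    using \<theta> moment_nonneg by (intro mult_left_mono) auto
  finally show ?thesis by (simp add: \<theta>_def cov_const_def mult.commute)
qed

end

section \<open>Tensor kernels\<close>

lemma unit_square_product:
  assumes g: "integrable unit_interval g" and h: "integrable unit_interval h"
  shows "integrable (unit_interval \<Otimes>\<^sub>M unit_interval) (\<lambda>(t, s). g t * h s :: real)"
    and "integral\<^sup>L (unit_interval \<Otimes>\<^sub>M unit_interval) (\<lambda>(t, s). g t * h s) =
      (LINT t|unit_interval. g t) * (LINT s|unit_interval. h s)"
proof -
  have [measurable]: "g \<in> borel_measurable unit_interval" "h \<in> borel_measurable unit_interval" using g h by auto
  show i: "integrable (unit_interval \<Otimes>\<^sub>M unit_interval) (\<lambda>(t, s). g t * h s)"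
    by (rule unit_square.Fubini_integrable) (use g h in \<open>auto simp: abs_mult\<close>)
  show "integral\<^sup>L (unit_interval \<Otimes>\<^sub>M unit_interval) (\<lambda>(t, s). g t * h s) =
      (LINT t|unit_interval. g t) * (LINT s|unit_interval. h s)"
    using unit_square.integral_fst[OF i] by simp
qed

lemma L2_kernel_product:
  assumes f: "square_integrable f" and g: "square_integrable g"
  shows "L2_kernel (\<lambda>t s. f t * g s)"
    and "integral\<^sup>L (unit_interval \<Otimes>\<^sub>M unit_interval) (\<lambda>(t, s). (f t * g s)\<^sup>2) =
      (LINT t|unit_interval. (f t)\<^sup>2) * (LINT s|unit_interval. (g s)\<^sup>2)"
proof -
  have [measurable]: "f \<in> borel_measurable unit_interval" "g \<in> borel_measurable unit_interval"
    using f g by (auto simp: square_integrable_def)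
  have sq: "integrable unit_interval (\<lambda>t. (f t)\<^sup>2)" "integrable unit_interval (\<lambda>t. (g t)\<^sup>2)"
    using f g by (auto simp: square_integrable_def)
  show "L2_kernel (\<lambda>t s. f t * g s)"
    unfolding L2_kernel_def using unit_square_product(1)[OF sq] square_integrable_scale[OF g]
    by (auto simp: power_mult_distrib)
  show "integral\<^sup>L (unit_interval \<Otimes>\<^sub>M unit_interval) (\<lambda>(t, s). (f t * g s)\<^sup>2) =
      (LINT t|unit_interval. (f t)\<^sup>2) * (LINT s|unit_interval. (g s)\<^sup>2)"
    using unit_square_product(2)[OF sq] by (simp add: power_mult_distrib)
qed

lemma L2_kernel_scale: "L2_kernel k \<Longrightarrow> L2_kernel (\<lambda>t s. c * k t s)"
  by (auto simp: L2_kernel_def power_mult_distrib case_prod_unfold square_integrable_scale)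

lemma L2_kernel_add: "L2_kernel k \<Longrightarrow> L2_kernel k' \<Longrightarrow> L2_kernel (\<lambda>t s. k t s + k' t s)"
  using L2_kernel_diff(1)[OF _ L2_kernel_scale[of k' "-1"], of k] by simp

lemma L2_kernel_sum: "(\<And>i. i \<in> I \<Longrightarrow> L2_kernel (K i)) \<Longrightarrow> L2_kernel (\<lambda>t s. \<Sum>i\<in>I. K i t s)"
proof (induction I rule: infinite_finite_induct)
  case (insert i I) then show ?case by (simp add: L2_kernel_add)
qed (use L2_kernel_product[OF square_integrable_zero square_integrable_zero] in auto)

section \<open>Averages of functionals of the observations\<close>

lemma weight_ge: "a \<le> (1 + a)\<^sup>2" "a\<^sup>2 \<le> (1 + a)\<^sup>2" if "0 \<le> a" for a :: real
  using that by (auto simp: power2_sum)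

text \<open>
  The next three functions are the inner products in \<open>L\<^sup>2([0,1])\<close> of two paths \<open>x\<close> and \<open>y\<close>, in
  \<open>L\<^sup>2([0,1]\<^sup>2)\<close> of the tensors \<open>x \<otimes> x\<close> and \<open>y \<otimes> y\<close>, and in the real line of \<open>\<parallel>x\<parallel>\<^sup>2\<close> and \<open>\<parallel>y\<parallel>\<^sup>2\<close>.
\<close>

lemma admissible_inner: "admissible (inner :: L2 \<Rightarrow> L2 \<Rightarrow> real)"
  unfolding admissible_def
proof (intro conjI allI)
  show "case_prod inner \<in> borel_measurable (borel \<Otimes>\<^sub>M (borel :: L2 measure))"
    by (simp add: case_prod_unfold)
  fix x y z :: L2
  have "\<bar>inner x y\<bar> \<le> norm x * norm y" by (rule Cauchy_Schwarz_ineq2)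
  also have "\<dots> \<le> (1 + norm x)\<^sup>2 * (1 + norm y)\<^sup>2" by (intro mult_mono weight_ge) auto
  finally show "\<bar>inner x y\<bar> \<le> (1 + norm x)\<^sup>2 * (1 + norm y)\<^sup>2" .
  have "\<bar>inner x y - inner x z\<bar> \<le> norm x * 1 * norm (y - z)"
    using Cauchy_Schwarz_ineq2[of x "y - z"] by (simp add: inner_diff_right)
  also have "\<dots> \<le> (1 + norm x)\<^sup>2 * (1 + norm y + norm z) * norm (y - z)"
    by (intro mult_mono weight_ge) auto
  finally show "\<bar>inner x y - inner x z\<bar> \<le> (1 + norm x)\<^sup>2 * (1 + norm y + norm z) * norm (y - z)" .
qed

lemma admissible_power2_inner: "admissible (\<lambda>x y :: L2. (inner x y)\<^sup>2)"
  unfolding admissible_def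
proof (intro conjI allI)
  show "case_prod (\<lambda>x y. (inner x y)\<^sup>2) \<in> borel_measurable (borel \<Otimes>\<^sub>M (borel :: L2 measure))"
    by (simp add: case_prod_unfold)
  fix x y z :: L2
  have "\<bar>(inner x y)\<^sup>2\<bar> \<le> (norm x * norm y)\<^sup>2"
    using Cauchy_Schwarz_ineq2[of x y] by (simp add: abs_le_square_iff[symmetric])
  also have "\<dots> \<le> (1 + norm x)\<^sup>2 * (1 + norm y)\<^sup>2"
    unfolding power_mult_distrib by (intro mult_mono weight_ge) auto
  finally show "\<bar>(inner x y)\<^sup>2\<bar> \<le> (1 + norm x)\<^sup>2 * (1 + norm y)\<^sup>2" .
  have "\<bar>(inner x y)\<^sup>2 - (inner x z)\<^sup>2\<bar> = \<bar>inner x (y + z)\<bar> * \<bar>inner x (y - z)\<bar>"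
    by (simp add: abs_mult[symmetric] inner_add_right inner_diff_right power2_eq_square algebra_simps)
  also have "\<dots> \<le> (norm x * (norm y + norm z)) * (norm x * norm (y - z))"
    by (intro mult_mono order_trans[OF Cauchy_Schwarz_ineq2] mult_left_mono norm_triangle_ineq) auto
  also have "\<dots> = (norm x)\<^sup>2 * (norm y + norm z) * norm (y - z)" by (simp add: power2_eq_square)
  also have "\<dots> \<le> (1 + norm x)\<^sup>2 * (1 + norm y + norm z) * norm (y - z)"
    by (intro mult_mono weight_ge) auto
  finally show "\<bar>(inner x y)\<^sup>2 - (inner x z)\<^sup>2\<bar> \<le> (1 + norm x)\<^sup>2 * (1 + norm y + norm z) * norm (y - z)" .
qed

lemma admissible_power2_norms: "admissible (\<lambda>x y :: L2. (norm x)\<^sup>2 * (norm y)\<^sup>2)"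
  unfolding admissible_def
proof (intro conjI allI)
  show "case_prod (\<lambda>x y. (norm x)\<^sup>2 * (norm y)\<^sup>2) \<in> borel_measurable (borel \<Otimes>\<^sub>M (borel :: L2 measure))"
    by (simp add: case_prod_unfold)
  fix x y z :: L2
  show "\<bar>(norm x)\<^sup>2 * (norm y)\<^sup>2\<bar> \<le> (1 + norm x)\<^sup>2 * (1 + norm y)\<^sup>2"
    by (simp, intro mult_mono weight_ge) auto
  have "\<bar>(norm x)\<^sup>2 * (norm y)\<^sup>2 - (norm x)\<^sup>2 * (norm z)\<^sup>2\<bar> = (norm x)\<^sup>2 * \<bar>(norm y + norm z) * (norm y - norm z)\<bar>"
    by (simp add: abs_mult right_diff_distrib[symmetric] power2_eq_square square_diff_square_factored)
  also have "\<dots> = (norm x)\<^sup>2 * ((norm y + norm z) * \<bar>norm y - norm z\<bar>)" by (simp add: abs_mult)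
  also have "\<dots> \<le> (norm x)\<^sup>2 * ((norm y + norm z) * norm (y - z))"
    by (intro mult_left_mono norm_triangle_ineq3) auto
  also have "\<dots> \<le> (1 + norm x)\<^sup>2 * (1 + norm y + norm z) * norm (y - z)"
    unfolding mult.assoc[symmetric] by (intro mult_mono weight_ge) auto
  finally show "\<bar>(norm x)\<^sup>2 * (norm y)\<^sup>2 - (norm x)\<^sup>2 * (norm z)\<^sup>2\<bar>
      \<le> (1 + norm x)\<^sup>2 * (1 + norm y + norm z) * norm (y - z)" .
qed

context approximable
begin

definition error_const :: real where
  "error_const = 2 * (\<Sum>k. cov_const * (decay k + (1 / 2) ^ k))"

lemma cov_const_nonneg: "0 \<le> cov_const"
  using moment_nonneg by (simp add: cov_const_def)

lemma measurable_observation [measurable]: "X n \<in> borel_measurable M"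
  using approximable unfolding Lp_m_approximable_def Lp_random_element_def by blast

lemma integrable_observation_norm4: "integrable M (\<lambda>\<omega>. norm (X n \<omega>) ^ 4)"
  using integrable_past_norm4[of n] AE_past[of n]
  by (subst integrable_cong_AE[where g = "\<lambda>\<omega>. norm (past n \<omega>) ^ 4"]) auto

text \<open>
  The iterated integral depends on the laws of \<open>X n\<close> and \<open>X m\<close> only, and these are equal.
\<close>

lemma independent_mean_iterated:
  assumes k: "admissible \<kappa>"
  shows "(LINT \<omega>|M. LINT \<omega>'|M. \<kappa> (X n \<omega>) (X m \<omega>')) = independent_mean \<kappa>"
proof -
  interpret law: prob_space law by (rule prob_space_law)
  interpret LL: pair_sigma_finite law law ..
  have km [measurable]: "case_prod \<kappa> \<in> borel_measurable (borel \<Otimes>\<^sub>M borel)" using k by (simp add: admissible_def)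
  have sec: "\<kappa> x \<in> borel_measurable borel" for x by measurable
  have inner: "(LINT \<omega>'|M. \<kappa> x (X m \<omega>')) = (LINT y|law. \<kappa> x y)" for x
  proof -
    have "(LINT \<omega>'|M. \<kappa> x (X m \<omega>')) = (LINT \<omega>'|M. \<kappa> x (past m \<omega>'))"
      using AE_past[of m] by (intro integral_cong_AE) auto
    also have "\<dots> = (LINT y|law. \<kappa> x y)"
      unfolding distr_past[of m, symmetric] by (subst integral_distr) (use sec in auto)
    finally show ?thesis .
  qed
  have [measurable]: "(\<lambda>x. LINT y|law. \<kappa> x y) \<in> borel_measurable borel" by measurable
  have "integrable (distr M (borel \<Otimes>\<^sub>M borel) (\<lambda>\<omega>. (past 0 \<omega>, coupled f \<epsilon> \<epsilon>' 0 (0 + int 0) \<omega>))) (case_prod \<kappa>)"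
    by (subst integrable_distr_eq)
      (auto intro!: integrable_admissible[OF k] integrable_past_norm4 integrable_coupled_norm4)
  then have int: "integrable (law \<Otimes>\<^sub>M law) (case_prod \<kappa>)" unfolding past_coupled_indep .
  have "(LINT \<omega>|M. LINT y|law. \<kappa> (X n \<omega>) y) = (LINT \<omega>|M. LINT y|law. \<kappa> (past n \<omega>) y)"
    using AE_past[of n] by (intro integral_cong_AE) auto
  also have "\<dots> = (LINT x|distr M borel (past n). LINT y|law. \<kappa> x y)"
    by (subst integral_distr) auto
  also have "\<dots> = independent_mean \<kappa>"
    unfolding distr_past independent_mean_def using LL.integral_fst[OF int] by simp
  finally show ?thesis by (simp add: inner)
qed

text \<open>
  The functional \<open>Z\<close> of the observations enters only through its inner products \<open>\<kappa>\<close>, so one bound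
  serves averages with values in different \<open>L\<^sup>2\<close> spaces.
\<close>

lemma mean_square_error_observations:
  fixes Z :: "nat \<Rightarrow> 'w \<Rightarrow> 't \<Rightarrow> real"
  assumes k: "admissible \<kappa>" and T: "sigma_finite_measure T"
    and meas: "\<And>n. (\<lambda>(\<omega>, \<tau>). Z n \<omega> \<tau>) \<in> borel_measurable (M \<Otimes>\<^sub>M T)"
    and sq: "\<And>n \<omega>. \<omega> \<in> space M \<Longrightarrow> integrable T (\<lambda>\<tau>. (Z n \<omega> \<tau>)\<^sup>2)"
    and Z: "\<And>n m \<omega> \<omega>'. \<omega> \<in> space M \<Longrightarrow> \<omega>' \<in> space M \<Longrightarrow>
      (LINT \<tau>|T. Z n \<omega> \<tau> * Z m \<omega>' \<tau>) = \<kappa> (X (int n) \<omega>) (X (int m) \<omega>')"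
    and N: "1 \<le> N"
  shows "integrable M (\<lambda>\<omega>. LINT \<tau>|T. ((\<Sum>n\<in>{1..N}. Z n \<omega> \<tau>) / real N - (LINT \<omega>'|M. Z 1 \<omega>' \<tau>))\<^sup>2)"
    and "(LINT \<omega>|M. LINT \<tau>|T. ((\<Sum>n\<in>{1..N}. Z n \<omega> \<tau>) / real N - (LINT \<omega>'|M. Z 1 \<omega>' \<tau>))\<^sup>2)
      \<le> error_const / real N"
    and "\<And>\<omega>. \<omega> \<in> space M \<Longrightarrow>
      integrable T (\<lambda>\<tau>. ((\<Sum>n\<in>{1..N}. Z n \<omega> \<tau>) / real N - (LINT \<omega>'|M. Z 1 \<omega>' \<tau>))\<^sup>2)"
    and "integrable T (\<lambda>\<tau>. (LINT \<omega>'|M. Z 1 \<omega>' \<tau>)\<^sup>2)"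
proof -
  have int: "integrable M (\<lambda>\<omega>. LINT \<tau>|T. (Z n \<omega> \<tau>)\<^sup>2)" for n
  proof -
    have "integrable M (\<lambda>\<omega>. \<kappa> (X (int n) \<omega>) (X (int n) \<omega>))"
      by (intro integrable_admissible[OF k] integrable_observation_norm4) auto
    moreover have "(LINT \<tau>|T. (Z n \<omega> \<tau>)\<^sup>2) = \<kappa> (X (int n) \<omega>) (X (int n) \<omega>)" if "\<omega> \<in> space M" for \<omega>
      using Z[OF that that, of n n] by (simp add: power2_eq_square)
    ultimately show ?thesis by (simp cong: Bochner_Integration.integrable_cong)
  qed
  have mean: "(LINT \<omega>|M. LINT \<omega>'|M. LINT \<tau>|T. Z n \<omega> \<tau> * Z 1 \<omega>' \<tau>) = independent_mean \<kappa>" for n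
  proof -
    have "(LINT \<omega>|M. LINT \<omega>'|M. LINT \<tau>|T. Z n \<omega> \<tau> * Z 1 \<omega>' \<tau>) =
        (LINT \<omega>|M. LINT \<omega>'|M. \<kappa> (X (int n) \<omega>) (X (int 1) \<omega>'))"
      by (intro Bochner_Integration.integral_cong refl Z)
    then show ?thesis by (simp only: independent_mean_iterated[OF k])
  qed
  have cov: "\<bar>(LINT \<omega>|M. LINT \<tau>|T. Z n \<omega> \<tau> * Z (n + k) \<omega> \<tau>) - independent_mean \<kappa>\<bar>
      \<le> cov_const * (decay k + (1 / 2) ^ k)" for n k
  proof -
    have km [measurable]: "case_prod \<kappa> \<in> borel_measurable (borel \<Otimes>\<^sub>M borel)"
      using assms(1) by (simp add: admissible_def)
    have "(LINT \<omega>|M. LINT \<tau>|T. Z n \<omega> \<tau> * Z (n + k) \<omega> \<tau>) =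
        (LINT \<omega>|M. \<kappa> (X (int n) \<omega>) (X (int (n + k)) \<omega>))"
      by (intro Bochner_Integration.integral_cong refl Z)
    also have "\<dots> = (LINT \<omega>|M. \<kappa> (past (int n) \<omega>) (past (int n + int k) \<omega>))"
    proof (rule integral_cong_AE)
      show "AE \<omega> in M. \<kappa> (X (int n) \<omega>) (X (int (n + k)) \<omega>) = \<kappa> (past (int n) \<omega>) (past (int n + int k) \<omega>)"
        using AE_past[of "int n"] AE_past[of "int (n + k)"] by eventually_elim simp
    qed measurable
    finally show ?thesis using autocovariance_bound[OF assms(1), of "int n" k] by simp
  qed
  have "summable (\<lambda>k. decay k)" using summable_decay by (subst (asm) summable_Suc_iff)
  then have r: "summable (\<lambda>k. cov_const * (decay k + (1 / 2) ^ k))"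
    by (intro summable_mult summable_add summable_geometric) auto
  have r0: "0 \<le> cov_const * (decay k + (1 / 2) ^ k)" for k
    using cov_const_nonneg decay_nonneg[of k] by simp
  note mse = mean_square_error[OF T meas sq int mean cov r r0 N]
  show "integrable M (\<lambda>\<omega>. LINT \<tau>|T. ((\<Sum>n\<in>{1..N}. Z n \<omega> \<tau>) / real N - (LINT \<omega>'|M. Z 1 \<omega>' \<tau>))\<^sup>2)"
    by (rule mse(1))
  show "(LINT \<omega>|M. LINT \<tau>|T. ((\<Sum>n\<in>{1..N}. Z n \<omega> \<tau>) / real N - (LINT \<omega>'|M. Z 1 \<omega>' \<tau>))\<^sup>2)
      \<le> error_const / real N"
    unfolding error_const_def by (rule mse(2))
  show "integrable T (\<lambda>\<tau>. ((\<Sum>n\<in>{1..N}. Z n \<omega> \<tau>) / real N - (LINT \<omega>'|M. Z 1 \<omega>' \<tau>))\<^sup>2)" if "\<omega> \<in> space M" for \<omega>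
    by (rule mse(3)[OF _ that])
  show "integrable T (\<lambda>\<tau>. (LINT \<omega>'|M. Z 1 \<omega>' \<tau>)\<^sup>2)" by (rule mse(4))
qed

end

section \<open>Mean square error of the empirical covariance\<close>

text \<open>
  Applied with \<open>x\<close> the squared error of the sample mean and \<open>e\<close> the fluctuation of the averaged squared
  norms.  For \<open>e \<le> b\<close> the product is linear in \<open>x\<close>; for \<open>e > b\<close> the a priori bound on \<open>x\<close> turns it into
  a multiple of \<open>e\<^sup>2\<close>.
\<close>

lemma cross_term_bound:
  fixes x e b :: real
  assumes "0 \<le> x" "0 \<le> b" "x \<le> 2 * (b + e)"
  shows "2 * x * (b + e) \<le> 4 * b * x + 4 * e\<^sup>2"
proof (cases "e \<le> b")
  case True
  then have "x * e \<le> x * b" using assms by (intro mult_left_mono) auto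
  moreover have "2 * x * (b + e) = 2 * (x * b) + 2 * (x * e)" "4 * b * x = 4 * (x * b)"
    by (simp_all add: algebra_simps)
  moreover have "0 \<le> x * b" using assms by simp
  ultimately show ?thesis using zero_le_power2[of e] by linarith
next
  case False
  have "x * (e - b) \<le> 2 * (b + e) * (e - b)" using False assms by (intro mult_right_mono) auto
  also have "\<dots> = 2 * (e\<^sup>2 - b\<^sup>2)" by (simp add: power2_eq_square algebra_simps)
  also have "\<dots> \<le> 2 * e\<^sup>2" by simp
  finally show ?thesis by (simp add: algebra_simps)
qed

locale functional_sample = approximable M S f \<epsilon> \<epsilon>' "\<lambda>n \<omega>. abs_L2 (X n \<omega>)"
  for M :: "'w measure" and S :: "'s measure" and f :: "(nat \<Rightarrow> 's) \<Rightarrow> L2"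
    and \<epsilon> :: "int \<Rightarrow> 'w \<Rightarrow> 's" and \<epsilon>' :: "int \<Rightarrow> int \<Rightarrow> 'w \<Rightarrow> 's"
    and X :: "int \<Rightarrow> 'w \<Rightarrow> real \<Rightarrow> real" +
  assumes square_integrable_path: "\<omega> \<in> space M \<Longrightarrow> square_integrable (X n \<omega>)"
    and jointly_measurable [measurable]: "(\<lambda>(\<omega>, t). X n \<omega> t) \<in> borel_measurable (M \<Otimes>\<^sub>M unit_interval)"
    and bounded_second_moment: "(SUP t\<in>{0..1}. \<integral>\<^sup>+\<omega>. ennreal (\<bar>X 1 \<omega> t\<bar>\<^sup>2) \<partial>M) < \<infinity>"
begin

definition mean_function :: "real \<Rightarrow> real" where
  "mean_function t = (LINT \<omega>|M. X 1 \<omega> t)"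

definition second_moment_kernel :: "real \<Rightarrow> real \<Rightarrow> real" where
  "second_moment_kernel t s = (LINT \<omega>|M. X 1 \<omega> t * X 1 \<omega> s)"

lemma power2_norm_path: "\<omega> \<in> space M \<Longrightarrow> (norm (abs_L2 (X n \<omega>)))\<^sup>2 = (LINT t|unit_interval. (X n \<omega> t)\<^sup>2)"
  by (intro power2_norm_abs_L2 square_integrable_path)

lemma measurable_at [measurable]: "t \<in> {0..1} \<Longrightarrow> (\<lambda>\<omega>. X n \<omega> t) \<in> borel_measurable M"
  by measurable

lemma second_moment_bound:
  obtains B where "\<And>t. t \<in> {0..1} \<Longrightarrow> integrable M (\<lambda>\<omega>. (X 1 \<omega> t)\<^sup>2)"
    "\<And>t. t \<in> {0..1} \<Longrightarrow> (LINT \<omega>|M. (X 1 \<omega> t)\<^sup>2) \<le> B"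
proof -
  define b where "b = (SUP t\<in>{0..1}. \<integral>\<^sup>+\<omega>. ennreal (\<bar>X 1 \<omega> t\<bar>\<^sup>2) \<partial>M)"
  have b: "b < \<infinity>" using bounded_second_moment by (simp add: b_def)
  have le: "(\<integral>\<^sup>+\<omega>. ennreal ((X 1 \<omega> t)\<^sup>2) \<partial>M) \<le> b" if "t \<in> {0..1}" for t
    unfolding b_def using that by (intro SUP_upper2[of t]) auto
  have int: "integrable M (\<lambda>\<omega>. (X 1 \<omega> t)\<^sup>2)" if "t \<in> {0..1}" for t
    using le[OF that] b measurable_at[OF that, of 1]
    by (intro integrableI_bounded) (auto simp: less_top[symmetric] top_unique)
  have "(LINT \<omega>|M. (X 1 \<omega> t)\<^sup>2) \<le> enn2real b" if "t \<in> {0..1}" for t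
  proof -
    have "ennreal (LINT \<omega>|M. (X 1 \<omega> t)\<^sup>2) \<le> b"
      using nn_integral_eq_integral[OF int[OF that]] le[OF that] by simp
    then have "enn2real (ennreal (LINT \<omega>|M. (X 1 \<omega> t)\<^sup>2)) \<le> enn2real b"
      using b by (intro enn2real_mono) auto
    then show ?thesis by simp
  qed
  then show thesis using int that by blast
qed

lemma cov_kernel_eq:
  assumes t: "t \<in> {0..1}" and s: "s \<in> {0..1}"
  shows "cov_kernel M (X 1) t s = second_moment_kernel t s - mean_function t * mean_function s"
proof -
  obtain B where B: "\<And>t. t \<in> {0..1} \<Longrightarrow> integrable M (\<lambda>\<omega>. (X 1 \<omega> t)\<^sup>2)"
    using second_moment_bound by blast
  have i1: "integrable M (\<lambda>\<omega>. X 1 \<omega> t)" if "t \<in> {0..1}" for t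
    using square_integrable_imp_integrable[OF measurable_at[OF that] B[OF that]] .
  have i2: "integrable M (\<lambda>\<omega>. X 1 \<omega> t * X 1 \<omega> s)"
    by (rule integrable_mult_of_squares[OF measurable_at[OF t] measurable_at[OF s] B[OF t] B[OF s]])
  have "cov_kernel M (X 1) t s = (LINT \<omega>|M. X 1 \<omega> t * X 1 \<omega> s - mean_function s * X 1 \<omega> t
      - mean_function t * X 1 \<omega> s + mean_function t * mean_function s)"
    unfolding cov_kernel_def mean_function_def
    by (intro Bochner_Integration.integral_cong refl) (simp add: algebra_simps)
  also have "\<dots> = second_moment_kernel t s - mean_function t * mean_function s"
    using i1[OF t] i1[OF s] i2
    by (simp add: second_moment_kernel_def mean_function_def[symmetric] prob_space)
  finally show ?thesis .
qed

text \<open>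
  Centring at the sample mean only subtracts its tensor square, so that the uncentred products of
  observations can be averaged.
\<close>

lemma emp_cov_kernel_eq:
  assumes "1 \<le> N"
  shows "emp_cov_kernel X N \<omega> t s =
    (\<Sum>n\<in>{1..N}. X (int n) \<omega> t * X (int n) \<omega> s) / real N - sample_mean X N \<omega> t * sample_mean X N \<omega> s"
proof -
  let ?m = "sample_mean X N \<omega>"
  have m: "(\<Sum>n\<in>{1..N}. X (int n) \<omega> t) = real N * ?m t" for t
    using assms by (simp add: sample_mean_def)
  have "(\<Sum>n=1..N. (X (int n) \<omega> t - ?m t) * (X (int n) \<omega> s - ?m s)) =
      (\<Sum>n\<in>{1..N}. X (int n) \<omega> t * X (int n) \<omega> s - ?m t * X (int n) \<omega> s - X (int n) \<omega> t * ?m s + ?m t * ?m s)"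
    by (intro sum.cong refl) (simp add: algebra_simps)
  also have "\<dots> = (\<Sum>n\<in>{1..N}. X (int n) \<omega> t * X (int n) \<omega> s) - ?m t * (\<Sum>n\<in>{1..N}. X (int n) \<omega> s)
      - (\<Sum>n\<in>{1..N}. X (int n) \<omega> t) * ?m s + real N * (?m t * ?m s)"
    by (simp add: sum.distrib sum_subtractf sum_distrib_left sum_distrib_right)
  also have "\<dots> = (\<Sum>n\<in>{1..N}. X (int n) \<omega> t * X (int n) \<omega> s) - real N * (?m t * ?m s)"
    unfolding m by (simp add: algebra_simps)
  finally show ?thesis using assms by (simp add: emp_cov_kernel_def diff_divide_distrib)
qed

lemma square_integrable_sample_mean:
  "\<omega> \<in> space M \<Longrightarrow> square_integrable (sample_mean X N \<omega>)"
proof -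
  assume "\<omega> \<in> space M"
  then have "square_integrable (\<lambda>t. (1 / real N) * (\<Sum>n\<in>{1..N}. X (int n) \<omega> t))"
    by (intro square_integrable_scale conjunct1[OF abs_L2_sum] square_integrable_path) auto
  then show ?thesis by (simp add: sample_mean_def[abs_def])
qed

lemma L2_kernel_emp_cov:
  assumes "1 \<le> N" "\<omega> \<in> space M"
  shows "L2_kernel (emp_cov_kernel X N \<omega>)"
proof -
  have "L2_kernel (\<lambda>t s. (1 / real N) * (\<Sum>n\<in>{1..N}. X (int n) \<omega> t * X (int n) \<omega> s)
      - sample_mean X N \<omega> t * sample_mean X N \<omega> s)"
    using assms by (intro L2_kernel_diff(1) L2_kernel_scale L2_kernel_sum L2_kernel_product(1)
      square_integrable_path square_integrable_sample_mean)
  moreover have "emp_cov_kernel X N \<omega> = (\<lambda>t s. (1 / real N) * (\<Sum>n\<in>{1..N}. X (int n) \<omega> t * X (int n) \<omega> s)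
      - sample_mean X N \<omega> t * sample_mean X N \<omega> s)"
    by (intro ext) (simp add: emp_cov_kernel_eq[OF assms(1)])
  ultimately show ?thesis by simp
qed

text \<open>
  A uniform bound on the second moments makes the covariance kernel bounded, in particular square
  integrable in every section.
\<close>

lemma L2_kernel_cov: "L2_kernel (cov_kernel M (X 1))"
proof -
  let ?U = "unit_interval \<Otimes>\<^sub>M unit_interval"
  obtain B where B: "\<And>t. t \<in> {0..1} \<Longrightarrow> integrable M (\<lambda>\<omega>. (X 1 \<omega> t)\<^sup>2)"
    "\<And>t. t \<in> {0..1} \<Longrightarrow> (LINT \<omega>|M. (X 1 \<omega> t)\<^sup>2) \<le> B"
    using second_moment_bound by blast
  have m [measurable]: "(\<lambda>(t, s). cov_kernel M (X 1) t s) \<in> borel_measurable ?U"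
    unfolding cov_kernel_def by measurable
  have bound: "\<bar>cov_kernel M (X 1) t s\<bar> \<le> 2 * B" if t: "t \<in> {0..1}" and s: "s \<in> {0..1}" for t s
  proof -
    have ti: "integrable M (\<lambda>\<omega>. X 1 \<omega> t * X 1 \<omega> s)"
      by (rule integrable_mult_of_squares[OF measurable_at[OF t] measurable_at[OF s] B(1)[OF t] B(1)[OF s]])
    have am: "\<bar>x * y\<bar> \<le> (x\<^sup>2 + y\<^sup>2) / 2" for x y :: real
      using sum_squares_bound[of "\<bar>x\<bar>" "\<bar>y\<bar>"] by (simp add: abs_mult)
    have "\<bar>second_moment_kernel t s\<bar> \<le> (LINT \<omega>|M. \<bar>X 1 \<omega> t * X 1 \<omega> s\<bar>)"
      unfolding second_moment_kernel_def by (rule integral_abs_bound)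
    also have "\<dots> \<le> (LINT \<omega>|M. ((X 1 \<omega> t)\<^sup>2 + (X 1 \<omega> s)\<^sup>2) / 2)"
      by (rule integral_mono) (use ti B(1)[OF t] B(1)[OF s] am in auto)
    also have "\<dots> \<le> B" using B(1)[OF t] B(1)[OF s] B(2)[OF t] B(2)[OF s] by simp
    finally have 1: "\<bar>second_moment_kernel t s\<bar> \<le> B" .
    have "(mean_function t)\<^sup>2 \<le> B" if "t \<in> {0..1}" for t
      using power2_expectation_le[OF measurable_at[OF that] B(1)[OF that]] B(2)[OF that]
      by (simp add: mean_function_def)
    from this[OF t] this[OF s] am[of "mean_function t" "mean_function s"]
    have "\<bar>mean_function t * mean_function s\<bar> \<le> B" by argo
    with 1 show ?thesis unfolding cov_kernel_eq[OF t s] by linarith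
  qed
  have "square_integrable (cov_kernel M (X 1) t)" if "t \<in> {0..1}" for t
  proof (rule square_integrable_bound[OF _ square_integrable_const[of "2 * B"]])
    show "cov_kernel M (X 1) t \<in> borel_measurable unit_interval"
      using measurable_compose[OF measurable_Pair1'[of t unit_interval unit_interval] m] that by simp
    show "\<bar>cov_kernel M (X 1) t s\<bar> \<le> \<bar>2 * B\<bar>" if "s \<in> {0..1}" for s
      by (rule order_trans[OF bound[OF \<open>t \<in> {0..1}\<close> that] abs_ge_self])
  qed
  moreover have "integrable ?U (\<lambda>(t, s). (cov_kernel M (X 1) t s)\<^sup>2)"
  proof (rule Bochner_Integration.integrable_bound)
    show "integrable ?U (\<lambda>(t, s). (2 * B)\<^sup>2 * 1)"
      by (rule unit_square_product(1)) auto
    show "AE x in ?U. norm (case x of (t, s) \<Rightarrow> (cov_kernel M (X 1) t s)\<^sup>2) \<le> norm (case x of (t, s) \<Rightarrow> (2 * B)\<^sup>2 * 1)"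
    proof (rule AE_I2)
      fix x assume "x \<in> space ?U"
      then have "\<bar>cov_kernel M (X 1) (fst x) (snd x)\<bar> \<le> \<bar>2 * B\<bar>"
        using bound[of "fst x" "snd x"] by (auto simp: space_pair_measure)
      then show "norm (case x of (t, s) \<Rightarrow> (cov_kernel M (X 1) t s)\<^sup>2) \<le> norm (case x of (t, s) \<Rightarrow> (2 * B)\<^sup>2 * 1)"
        unfolding abs_le_square_iff by (simp add: case_prod_unfold)
    qed
  qed measurable
  ultimately show ?thesis using m by (simp add: L2_kernel_def)
qed

definition mean_error :: "nat \<Rightarrow> 'w \<Rightarrow> real" where
  "mean_error N \<omega> = (LINT t|unit_interval. (sample_mean X N \<omega> t - mean_function t)\<^sup>2)"

definition moment_kernel_error :: "nat \<Rightarrow> 'w \<Rightarrow> real" where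
  "moment_kernel_error N \<omega> = integral\<^sup>L (unit_interval \<Otimes>\<^sub>M unit_interval)
     (\<lambda>(t, s). ((\<Sum>n\<in>{1..N}. X (int n) \<omega> t * X (int n) \<omega> s) / real N - second_moment_kernel t s)\<^sup>2)"

definition mean_square_norm :: "nat \<Rightarrow> 'w \<Rightarrow> real" where
  "mean_square_norm N \<omega> = (\<Sum>n\<in>{1..N}. (norm (abs_L2 (X (int n) \<omega>)))\<^sup>2) / real N"

definition second_moment :: real where
  "second_moment = (LINT \<omega>|M. (norm (abs_L2 (X 1 \<omega>)))\<^sup>2)"

lemma mean_error:
  assumes N: "1 \<le> N"
  shows "integrable M (mean_error N)" "expectation (mean_error N) \<le> error_const / real N"
    and "square_integrable mean_function"
proof -
  note mse = mean_square_error_observations[where T = unit_interval and Z = "\<lambda>n. X (int n)", OF admissible_inner _ _ _ _ N]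
  have T: "sigma_finite_measure unit_interval" by (rule unit_interval.sigma_finite_measure)
  have eq: "(\<lambda>\<omega>. LINT t|unit_interval. ((\<Sum>n\<in>{1..N}. X (int n) \<omega> t) / real N - (LINT \<omega>'|M. X (int 1) \<omega>' t))\<^sup>2) = mean_error N"
    by (simp add: mean_error_def[abs_def] sample_mean_def mean_function_def)
  have sq: "integrable unit_interval (\<lambda>t. (X (int n) \<omega> t)\<^sup>2)" if "\<omega> \<in> space M" for n \<omega>
    using square_integrable_path[OF that] by (simp add: square_integrable_def)
  have rep: "(LINT t|unit_interval. X (int n) \<omega> t * X (int m) \<omega>' t) = inner (abs_L2 (X (int n) \<omega>)) (abs_L2 (X (int m) \<omega>'))"
    if "\<omega> \<in> space M" "\<omega>' \<in> space M" for n m \<omega> \<omega>'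
    using that by (simp add: inner_abs_L2 square_integrable_path)
  show "integrable M (mean_error N)" unfolding eq[symmetric]
    by (rule mse(1)[OF T jointly_measurable sq rep])
  show "expectation (mean_error N) \<le> error_const / real N" unfolding eq[symmetric]
    by (rule mse(2)[OF T jointly_measurable sq rep])
  have "integrable unit_interval (\<lambda>t. (LINT \<omega>'|M. X (int 1) \<omega>' t)\<^sup>2)"
    by (rule mse(4)[OF T jointly_measurable sq rep])
  moreover have "mean_function \<in> borel_measurable unit_interval"
    unfolding mean_function_def[abs_def] by measurable
  ultimately show "square_integrable mean_function"
    by (simp add: square_integrable_def mean_function_def)
qed

lemma moment_kernel_error:
  assumes N: "1 \<le> N"
  shows "integrable M (moment_kernel_error N)" "expectation (moment_kernel_error N) \<le> error_const / real N"
    and "\<omega> \<in> space M \<Longrightarrow> integrable (unit_interval \<Otimes>\<^sub>M unit_interval)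
     (\<lambda>(t, s). ((\<Sum>n\<in>{1..N}. X (int n) \<omega> t * X (int n) \<omega> s) / real N - second_moment_kernel t s)\<^sup>2)"
proof -
  let ?U = "unit_interval \<Otimes>\<^sub>M unit_interval"
  define Z where "Z n \<omega> x = X (int n) \<omega> (fst x) * X (int n) \<omega> (snd x)" for n \<omega> x
  have T: "sigma_finite_measure ?U" by (rule unit_square.P.sigma_finite_measure_axioms)
  have meas: "(\<lambda>(\<omega>, x). Z n \<omega> x) \<in> borel_measurable (M \<Otimes>\<^sub>M ?U)" for n
    unfolding Z_def by measurable
  have sqU: "integrable unit_interval (\<lambda>t. (X (int n) \<omega> t)\<^sup>2)" if "\<omega> \<in> space M" for n \<omega>
    using square_integrable_path[OF that] by (simp add: square_integrable_def)
  have sq: "integrable ?U (\<lambda>x. (Z n \<omega> x)\<^sup>2)" if "\<omega> \<in> space M" for n \<omega>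
    using unit_square_product(1)[OF sqU[OF that] sqU[OF that]]
    by (simp add: Z_def power_mult_distrib case_prod_unfold)
  have rep: "integral\<^sup>L ?U (\<lambda>x. Z n \<omega> x * Z m \<omega>' x) = (inner (abs_L2 (X (int n) \<omega>)) (abs_L2 (X (int m) \<omega>')))\<^sup>2"
    if "\<omega> \<in> space M" "\<omega>' \<in> space M" for n m \<omega> \<omega>'
  proof -
    let ?h = "\<lambda>t. X (int n) \<omega> t * X (int m) \<omega>' t"
    have h: "integrable unit_interval ?h"
      by (rule square_integrable_mult) (use that in \<open>auto intro: square_integrable_path\<close>)
    show ?thesis
      using unit_square_product(2)[OF h h] that
      by (simp add: Z_def case_prod_unfold inner_abs_L2 square_integrable_path power2_eq_square mult_ac)
  qed
  note mse = mean_square_error_observations[OF admissible_power2_inner T meas sq rep N]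
  have eq: "((\<Sum>n\<in>{1..N}. Z n \<omega> x) / real N - (LINT \<omega>'|M. Z 1 \<omega>' x))\<^sup>2 =
     (case x of (t, s) \<Rightarrow> ((\<Sum>n\<in>{1..N}. X (int n) \<omega> t * X (int n) \<omega> s) / real N - second_moment_kernel t s)\<^sup>2)" for \<omega> x
    by (simp add: Z_def second_moment_kernel_def case_prod_unfold)
  show "integrable M (moment_kernel_error N)"
    using mse(1) unfolding eq by (simp add: moment_kernel_error_def[abs_def])
  show "expectation (moment_kernel_error N) \<le> error_const / real N"
    using mse(2) unfolding eq by (simp add: moment_kernel_error_def[abs_def])
  show "integrable ?U
     (\<lambda>(t, s). ((\<Sum>n\<in>{1..N}. X (int n) \<omega> t * X (int n) \<omega> s) / real N - second_moment_kernel t s)\<^sup>2)"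
    if "\<omega> \<in> space M"
    using mse(3)[OF _ _ _ that] unfolding eq by simp
qed

text \<open>
  Real-valued averages are the case of a one-point index space.
\<close>

lemma mean_square_norm_deviation:
  assumes N: "1 \<le> N"
  shows "integrable M (\<lambda>\<omega>. (mean_square_norm N \<omega> - second_moment)\<^sup>2)"
    "expectation (\<lambda>\<omega>. (mean_square_norm N \<omega> - second_moment)\<^sup>2) \<le> error_const / real N"
proof -
  let ?T = "count_space (UNIV :: unit set)"
  define Z where "Z n \<omega> u = (norm (abs_L2 (X (int n) \<omega>)))\<^sup>2" for n \<omega> and u :: unit
  have T: "sigma_finite_measure ?T" by (rule sigma_finite_measure_count_space_finite) simp
  have eval: "integral\<^sup>L ?T g = g ()" for g :: "unit \<Rightarrow> real"
    by (subst lebesgue_integral_count_space_finite) (auto simp: UNIV_unit)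
  have meas: "(\<lambda>(\<omega>, x). Z n \<omega> x) \<in> borel_measurable (M \<Otimes>\<^sub>M ?T)" for n
    unfolding Z_def by measurable
  have sq: "integrable ?T (\<lambda>x. (Z n \<omega> x)\<^sup>2)" if "\<omega> \<in> space M" for n \<omega>
    by (rule integrable_count_space) simp
  have rep: "integral\<^sup>L ?T (\<lambda>x. Z n \<omega> x * Z m \<omega>' x) =
      (norm (abs_L2 (X (int n) \<omega>)))\<^sup>2 * (norm (abs_L2 (X (int m) \<omega>')))\<^sup>2"
    if "\<omega> \<in> space M" "\<omega>' \<in> space M" for n m \<omega> \<omega>'
    by (simp add: eval Z_def)
  note mse = mean_square_error_observations[OF admissible_power2_norms T meas sq rep N]
  have eq: "integral\<^sup>L ?T (\<lambda>x. ((\<Sum>n\<in>{1..N}. Z n \<omega> x) / real N - (LINT \<omega>'|M. Z 1 \<omega>' x))\<^sup>2) = (mean_square_norm N \<omega> - second_moment)\<^sup>2" for \<omega>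
    by (simp add: eval Z_def mean_square_norm_def second_moment_def)
  show "integrable M (\<lambda>\<omega>. (mean_square_norm N \<omega> - second_moment)\<^sup>2)" using mse(1) unfolding eq .
  show "expectation (\<lambda>\<omega>. (mean_square_norm N \<omega> - second_moment)\<^sup>2) \<le> error_const / real N" using mse(2) unfolding eq .
qed

lemma sample_mean_norm_le:
  assumes N: "1 \<le> N" and \<omega>: "\<omega> \<in> space M"
  shows "(LINT t|unit_interval. (sample_mean X N \<omega> t)\<^sup>2) \<le> mean_square_norm N \<omega>"
proof -
  have sq: "integrable unit_interval (\<lambda>t. (X (int n) \<omega> t)\<^sup>2)" for n
    using square_integrable_path[OF \<omega>] by (simp add: square_integrable_def)
  have "(sample_mean X N \<omega> t)\<^sup>2 \<le> (\<Sum>n\<in>{1..N}. (X (int n) \<omega> t)\<^sup>2) / real N" for t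
  proof -
    have "(\<Sum>n\<in>{1..N}. X (int n) \<omega> t)\<^sup>2 \<le> real N * (\<Sum>n\<in>{1..N}. (X (int n) \<omega> t)\<^sup>2)"
      using sum_squared_le_sum_of_squares[of "\<lambda>n. X (int n) \<omega> t" "{1..N}"] by (simp add: mult.commute)
    then have "(\<Sum>n\<in>{1..N}. X (int n) \<omega> t)\<^sup>2 / (real N)\<^sup>2 \<le> real N * (\<Sum>n\<in>{1..N}. (X (int n) \<omega> t)\<^sup>2) / (real N)\<^sup>2"
      by (rule divide_right_mono) simp
    then show ?thesis using N by (simp add: sample_mean_def power_divide power2_eq_square)
  qed
  then have "(LINT t|unit_interval. (sample_mean X N \<omega> t)\<^sup>2) \<le>
      (LINT t|unit_interval. (\<Sum>n\<in>{1..N}. (X (int n) \<omega> t)\<^sup>2) / real N)"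
    using sq square_integrable_sample_mean[OF \<omega>] by (intro integral_mono) (auto simp: square_integrable_def)
  also have "\<dots> = mean_square_norm N \<omega>"
    using sq by (simp add: mean_square_norm_def power2_norm_path[OF \<omega>])
  finally show ?thesis .
qed

definition square_norm_of_mean :: real where
  "square_norm_of_mean = (LINT t|unit_interval. (mean_function t)\<^sup>2)"

text \<open>
  A measurable majorant of the squared Hilbert--Schmidt error of the empirical covariance.
\<close>

definition error_bound :: "nat \<Rightarrow> 'w \<Rightarrow> real" where
  "error_bound N \<omega> = 2 * moment_kernel_error N \<omega> + 8 * (second_moment + square_norm_of_mean) * mean_error N \<omega>
     + 8 * (mean_square_norm N \<omega> - second_moment)\<^sup>2"

text \<open>
  With \<open>m\<close> the sample mean, \<open>\<mu>\<close> the mean and \<open>\<Delta> = m - \<mu>\<close>, the difference of the kernels is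
  \<open>\<Delta> \<otimes> m + \<mu> \<otimes> \<Delta> - A\<close>, where \<open>A\<close> is the error of the averaged tensors.  The first two terms have squared
  norm of the order of \<open>\<parallel>\<Delta>\<parallel>\<^sup>2 (\<parallel>m\<parallel>\<^sup>2 + \<parallel>\<mu>\<parallel>\<^sup>2)\<close>, a fourth-order quantity.  As \<open>\<parallel>m\<parallel>\<^sup>2\<close> is at most the average of
  the squared norms, \<open>cross_term_bound\<close> reduces it to quantities whose expectations are second-order
  errors of averages.
\<close>

lemma kernel_norm_error_le:
  assumes N: "1 \<le> N" and \<omega>: "\<omega> \<in> space M"
  shows "(kernel_norm (\<lambda>t s. cov_kernel M (X 1) t s - emp_cov_kernel X N \<omega> t s))\<^sup>2 \<le> error_bound N \<omega>"
proof -
  let ?U = "unit_interval \<Otimes>\<^sub>M unit_interval"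
  define m where "m = sample_mean X N \<omega>"
  define \<mu> where "\<mu> = mean_function"
  define \<Delta> where "\<Delta> t = m t - \<mu> t" for t
  define A where "A t s = (\<Sum>n\<in>{1..N}. X (int n) \<omega> t * X (int n) \<omega> s) / real N - second_moment_kernel t s" for t s
  have sm: "square_integrable m" "square_integrable \<mu>" "square_integrable \<Delta>"
    using square_integrable_sample_mean[OF \<omega>, of N] mean_error(3)[OF N]
    by (auto simp: m_def \<mu>_def \<Delta>_def[abs_def] intro: square_integrable_diff)
  define x where "x = (LINT t|unit_interval. (\<Delta> t)\<^sup>2)"
  define p where "p = (LINT t|unit_interval. (m t)\<^sup>2)"
  have x: "x = mean_error N \<omega>" by (simp add: x_def mean_error_def \<Delta>_def m_def \<mu>_def)
  have nonneg: "0 \<le> x" "0 \<le> square_norm_of_mean" "0 \<le> second_moment" by (auto simp: x_def square_norm_of_mean_def second_moment_def)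
  have p: "p \<le> mean_square_norm N \<omega>" using sample_mean_norm_le[OF N \<omega>] by (simp add: p_def m_def)
  have x_le: "x \<le> 2 * (p + square_norm_of_mean)"
  proof -
    have "x \<le> (LINT t|unit_interval. 2 * ((m t)\<^sup>2 + (\<mu> t)\<^sup>2))"
      unfolding x_def
    proof (rule integral_mono)
      show "(\<Delta> t)\<^sup>2 \<le> 2 * ((m t)\<^sup>2 + (\<mu> t)\<^sup>2)" for t
        using zero_le_power2[of "m t + \<mu> t"] by (simp add: \<Delta>_def power2_sum power2_diff)
    qed (use sm in \<open>auto simp: square_integrable_def\<close>)
    also have "\<dots> = 2 * (p + square_norm_of_mean)"
      using sm by (simp add: p_def square_norm_of_mean_def \<mu>_def square_integrable_def)
    finally show ?thesis .
  qed
  have i: "integrable ?U (\<lambda>(t, s). (A t s)\<^sup>2)" "integrable ?U (\<lambda>(t, s). (\<Delta> t * m s)\<^sup>2)"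
      "integrable ?U (\<lambda>(t, s). (\<mu> t * \<Delta> s)\<^sup>2)"
    using moment_kernel_error(3)[OF N \<omega>] L2_kernel_product(1)[OF sm(3,1)] L2_kernel_product(1)[OF sm(2,3)]
    by (simp_all add: A_def L2_kernel_def)
  have kd: "L2_kernel (\<lambda>t s. cov_kernel M (X 1) t s - emp_cov_kernel X N \<omega> t s)"
    by (rule L2_kernel_diff(1)[OF L2_kernel_cov L2_kernel_emp_cov[OF N \<omega>]])
  have "(kernel_norm (\<lambda>t s. cov_kernel M (X 1) t s - emp_cov_kernel X N \<omega> t s))\<^sup>2 =
      integral\<^sup>L ?U (\<lambda>(t, s). (cov_kernel M (X 1) t s - emp_cov_kernel X N \<omega> t s)\<^sup>2)"
    unfolding kernel_norm_def by (subst real_sqrt_pow2) (auto intro!: integral_nonneg_AE)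
  also have "\<dots> \<le> integral\<^sup>L ?U (\<lambda>z. 2 * (case z of (t, s) \<Rightarrow> (A t s)\<^sup>2)
      + 4 * ((case z of (t, s) \<Rightarrow> (\<Delta> t * m s)\<^sup>2) + (case z of (t, s) \<Rightarrow> (\<mu> t * \<Delta> s)\<^sup>2)))"
  proof (rule integral_mono)
    show "integrable ?U (\<lambda>(t, s). (cov_kernel M (X 1) t s - emp_cov_kernel X N \<omega> t s)\<^sup>2)"
      using kd by (simp add: L2_kernel_def)
    show "integrable ?U (\<lambda>z. 2 * (case z of (t, s) \<Rightarrow> (A t s)\<^sup>2)
      + 4 * ((case z of (t, s) \<Rightarrow> (\<Delta> t * m s)\<^sup>2) + (case z of (t, s) \<Rightarrow> (\<mu> t * \<Delta> s)\<^sup>2)))"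
      using i by simp
    fix z assume "z \<in> space ?U"
    then obtain t s where z: "z = (t, s)" "t \<in> {0..1}" "s \<in> {0..1}" by (auto simp: space_pair_measure)
    have *: "(a - b)\<^sup>2 \<le> 2 * a\<^sup>2 + 2 * b\<^sup>2" "(a + b)\<^sup>2 \<le> 2 * a\<^sup>2 + 2 * b\<^sup>2" for a b :: real
      using zero_le_power2[of "a + b"] zero_le_power2[of "a - b"] by (auto simp: power2_sum power2_diff)
    have "cov_kernel M (X 1) t s - emp_cov_kernel X N \<omega> t s = (\<Delta> t * m s + \<mu> t * \<Delta> s) - A t s"
      unfolding cov_kernel_eq[OF z(2,3)] emp_cov_kernel_eq[OF N]
      by (simp add: A_def \<Delta>_def m_def \<mu>_def algebra_simps)
    then have "(cov_kernel M (X 1) t s - emp_cov_kernel X N \<omega> t s)\<^sup>2 \<le>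
        2 * (\<Delta> t * m s + \<mu> t * \<Delta> s)\<^sup>2 + 2 * (A t s)\<^sup>2"
      using *(1)[of "\<Delta> t * m s + \<mu> t * \<Delta> s" "A t s"] by simp
    also have "(\<Delta> t * m s + \<mu> t * \<Delta> s)\<^sup>2 \<le> 2 * (\<Delta> t * m s)\<^sup>2 + 2 * (\<mu> t * \<Delta> s)\<^sup>2" by (rule *)
    finally show "(case z of (t, s) \<Rightarrow> (cov_kernel M (X 1) t s - emp_cov_kernel X N \<omega> t s)\<^sup>2) \<le>
        2 * (case z of (t, s) \<Rightarrow> (A t s)\<^sup>2)
        + 4 * ((case z of (t, s) \<Rightarrow> (\<Delta> t * m s)\<^sup>2) + (case z of (t, s) \<Rightarrow> (\<mu> t * \<Delta> s)\<^sup>2))"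
      by (simp add: z)
  qed
  also have "\<dots> = 2 * moment_kernel_error N \<omega> + 4 * (x * p + square_norm_of_mean * x)"
    using i L2_kernel_product(2)[OF sm(3,1)] L2_kernel_product(2)[OF sm(2,3)]
    by (simp add: x_def p_def square_norm_of_mean_def \<mu>_def[symmetric] moment_kernel_error_def A_def)
  also have "x * p + square_norm_of_mean * x \<le> x * (mean_square_norm N \<omega> + square_norm_of_mean)"
    using mult_left_mono[OF p nonneg(1)] by (simp add: distrib_left mult.commute)
  also have "2 * moment_kernel_error N \<omega> + 4 * (x * (mean_square_norm N \<omega> + square_norm_of_mean)) \<le> error_bound N \<omega>"
  proof -
    have "2 * x * (mean_square_norm N \<omega> + square_norm_of_mean) \<le>
        4 * (second_moment + square_norm_of_mean) * x + 4 * (mean_square_norm N \<omega> - second_moment)\<^sup>2"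
      using cross_term_bound[of x "second_moment + square_norm_of_mean" "mean_square_norm N \<omega> - second_moment"] nonneg x_le p
      by (simp add: algebra_simps)
    then show ?thesis unfolding error_bound_def x[symmetric] by (simp add: algebra_simps)
  qed
  finally show ?thesis by simp
qed

lemma error_bound:
  obtains K where "0 \<le> K" "\<And>N. 1 \<le> N \<Longrightarrow> integrable M (error_bound N)"
    "\<And>N. 1 \<le> N \<Longrightarrow> expectation (error_bound N) \<le> K / real N"
proof
  define b where "b = second_moment + square_norm_of_mean"
  have b: "0 \<le> b" by (simp add: b_def second_moment_def square_norm_of_mean_def)
  have "0 \<le> expectation (mean_error 1)" by (simp add: mean_error_def[abs_def])
  then have e: "0 \<le> error_const" using mean_error(2)[of 1] by simp
  show "0 \<le> 2 * error_const + 8 * b * error_const + 8 * error_const" using b e by simp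
  fix N :: nat assume N: "1 \<le> N"
  note ints = moment_kernel_error(1)[OF N] mean_error(1)[OF N] mean_square_norm_deviation(1)[OF N]
  show "integrable M (error_bound N)"
    unfolding error_bound_def[abs_def] using ints by auto
  have "expectation (error_bound N) = 2 * expectation (moment_kernel_error N) + 8 * b * expectation (mean_error N)
      + 8 * expectation (\<lambda>\<omega>. (mean_square_norm N \<omega> - second_moment)\<^sup>2)"
    unfolding error_bound_def[abs_def] b_def using ints by simp
  also have "\<dots> \<le> 2 * (error_const / real N) + 8 * b * (error_const / real N) + 8 * (error_const / real N)"
    using b by (intro add_mono mult_left_mono moment_kernel_error(2) mean_error(2) mean_square_norm_deviation(2) N) auto
  finally show "expectation (error_bound N) \<le> (2 * error_const + 8 * b * error_const + 8 * error_const) / real N"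
    by (simp add: add_divide_distrib)
qed

text \<open>
  Eigenvalues and eigenvectors of the empirical operator need not depend measurably on \<open>\<omega>\<close>.  Their
  errors enter through a pointwise bound by the measurable \<open>error_bound\<close>, and the nonnegative integral
  is monotone for arbitrary functions.
\<close>

lemma limsup_scaled_expectation_finite:
  assumes c: "0 \<le> c" and G: "\<And>N \<omega>. 1 \<le> N \<Longrightarrow> \<omega> \<in> space M \<Longrightarrow> G N \<omega> \<le> c * error_bound N \<omega>"
  shows "limsup (\<lambda>N. ennreal (real N) * (\<integral>\<^sup>+\<omega>. ennreal (G N \<omega>) \<partial>M)) < \<infinity>"
proof -
  obtain K where K: "0 \<le> K" "\<And>N. 1 \<le> N \<Longrightarrow> integrable M (error_bound N)"
    "\<And>N. 1 \<le> N \<Longrightarrow> expectation (error_bound N) \<le> K / real N" using error_bound by blast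
  have "ennreal (real N) * (\<integral>\<^sup>+\<omega>. ennreal (G N \<omega>) \<partial>M) \<le> ennreal (c * K)" if N: "1 \<le> N" for N
  proof -
    have eb: "0 \<le> error_bound N \<omega>" if "\<omega> \<in> space M" for \<omega>
      using kernel_norm_error_le[OF N that] by (rule order_trans[OF zero_le_power2])
    have "(\<integral>\<^sup>+\<omega>. ennreal (G N \<omega>) \<partial>M) \<le> (\<integral>\<^sup>+\<omega>. ennreal (c * error_bound N \<omega>) \<partial>M)"
      by (intro nn_integral_mono ennreal_leI G N)
    also have "\<dots> = ennreal (c * expectation (error_bound N))"
      using K(2)[OF N] c eb by (subst nn_integral_eq_integral) auto
    also have "\<dots> \<le> ennreal (c * (K / real N))"
      by (intro ennreal_leI mult_left_mono K(3) N c)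
    finally have "ennreal (real N) * (\<integral>\<^sup>+\<omega>. ennreal (G N \<omega>) \<partial>M) \<le> ennreal (real N) * ennreal (c * (K / real N))"
      by (rule mult_left_mono) simp
    also have "\<dots> = ennreal (c * K)" using N c K(1) by (simp add: ennreal_mult[symmetric])
    finally show ?thesis .
  qed
  then have "limsup (\<lambda>N. ennreal (real N) * (\<integral>\<^sup>+\<omega>. ennreal (G N \<omega>) \<partial>M)) \<le> ennreal (c * K)"
    by (intro Limsup_bounded) (auto simp: eventually_sequentially)
  then show ?thesis by (rule order.strict_trans1) simp
qed

end

section \<open>Rates for eigenvalues and eigenfunctions\<close>

theorem theorem3p2:
  fixes M :: "'w measure" and S :: "'s measure"
    and f :: "(nat \<Rightarrow> 's) \<Rightarrow> L2"
    and \<epsilon> :: "int \<Rightarrow> 'w \<Rightarrow> 's" and \<epsilon>' :: "int \<Rightarrow> int \<Rightarrow> 'w \<Rightarrow> 's"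
    and X :: "int \<Rightarrow> 'w \<Rightarrow> real \<Rightarrow> real"
    and lam :: "nat \<Rightarrow> real" and v :: "nat \<Rightarrow> L2"
    and lam_hat :: "nat \<Rightarrow> 'w \<Rightarrow> nat \<Rightarrow> real" and v_hat :: "nat \<Rightarrow> 'w \<Rightarrow> nat \<Rightarrow> L2"
    and d j :: nat
  assumes "prob_space M"
    and "\<And>n \<omega>. \<omega> \<in> space M \<Longrightarrow> square_integrable (X n \<omega>)"
    and "\<And>n. (\<lambda>(\<omega>, t). X n \<omega> t) \<in> borel_measurable (M \<Otimes>\<^sub>M unit_interval)"
    and "Lp_m_approximable M 4 S f \<epsilon> \<epsilon>' (\<lambda>n \<omega>. abs_L2 (X n \<omega>))"
    and "(SUP t\<in>{0..1}. \<integral>\<^sup>+\<omega>. ennreal (\<bar>X 1 \<omega> t\<bar>\<^sup>2) \<partial>M) < \<infinity>"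
    and "eigensystem (integral_operator (cov_kernel M (X 1))) lam v"
    and "\<And>i. 1 \<le> i \<Longrightarrow> i \<le> d \<Longrightarrow> lam (Suc i) < lam i"
    and "\<And>N \<omega>. 1 \<le> N \<Longrightarrow> \<omega> \<in> space M \<Longrightarrow>
           eigensystem (integral_operator (emp_cov_kernel X N \<omega>)) (lam_hat N \<omega>) (v_hat N \<omega>)"
    and "1 \<le> j" and "j \<le> d"
  shows "limsup (\<lambda>N. ennreal (real N) * (\<integral>\<^sup>+\<omega>. ennreal (\<bar>lam j - lam_hat N \<omega> j\<bar>\<^sup>2) \<partial>M)) < \<infinity> \<and>
         limsup (\<lambda>N. ennreal (real N) *
           (\<integral>\<^sup>+\<omega>. ennreal ((norm (sgn (inner (v_hat N \<omega> j) (v j)) *\<^sub>R v_hat N \<omega> j - v j))\<^sup>2) \<partial>M)) < \<infinity>"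
proof -
  interpret prob_space M by fact
  interpret functional_sample M S f \<epsilon> \<epsilon>' X
    by unfold_locales (use assms in auto)
  let ?C = "integral_operator (cov_kernel M (X 1))"
  let ?C' = "\<lambda>N \<omega>. integral_operator (emp_cov_kernel X N \<omega>)"
  define h where "h N \<omega> = kernel_norm (\<lambda>t s. cov_kernel M (X 1) t s - emp_cov_kernel X N \<omega> t s)" for N \<omega>
  note es = assms(6) and es' = assms(8) and j = assms(9)
  have C: "compact_selfadjoint ?C"
    by (rule compact_selfadjoint_integral_operator[OF L2_kernel_cov]) (simp add: cov_kernel_def mult.commute)
  have C': "compact_selfadjoint (?C' N \<omega>)" if "1 \<le> N" "\<omega> \<in> space M" for N \<omega>
    by (rule compact_selfadjoint_integral_operator[OF L2_kernel_emp_cov[OF that]])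
      (simp add: emp_cov_kernel_def mult.commute)
  have close: "norm (?C u - ?C' N \<omega> u) \<le> h N \<omega> * norm u" if "1 \<le> N" "\<omega> \<in> space M" for N \<omega> u
    using norm_integral_operator_le[OF L2_kernel_diff(1)[OF L2_kernel_cov L2_kernel_emp_cov[OF that]], of u]
    unfolding L2_kernel_diff(2)[OF L2_kernel_cov L2_kernel_emp_cov[OF that]] h_def .
  have eigenvalue: "\<bar>lam j - lam_hat N \<omega> j\<bar> \<le> h N \<omega>" if "1 \<le> N" "\<omega> \<in> space M" for N \<omega>
  proof -
    note linC = compact_selfadjoint.linear[OF C] and linC' = compact_selfadjoint.linear[OF C'[OF that]]
    have "lam j - lam_hat N \<omega> j \<le> h N \<omega>"
      by (rule eigenvalue_perturbation[OF linC es C'[OF that] es'[OF that] close[OF that] j])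
    moreover have "lam_hat N \<omega> j - lam j \<le> h N \<omega>"
      by (rule eigenvalue_perturbation[OF linC' es'[OF that] C es _ j])
        (use close[OF that] in \<open>simp add: norm_minus_commute\<close>)
    ultimately show ?thesis by linarith
  qed
  (* The distance from lam j to the neighbouring eigenvalues. *)
  define \<alpha> where "\<alpha> = (if j = 1 then lam j - lam (Suc j) else min (lam j - lam (Suc j)) (lam (j - 1) - lam j))"
  have gap: "0 < \<alpha>" "\<alpha> \<le> lam j - lam (Suc j)" "\<And>i. 1 \<le> i \<Longrightarrow> i < j \<Longrightarrow> \<alpha> \<le> lam i - lam j"
  proof -
    show "0 < \<alpha>" using assms(7)[of j] assms(7)[of "j - 1"] assms(9,10) by (auto simp: \<alpha>_def)
    show "\<alpha> \<le> lam j - lam (Suc j)" by (auto simp: \<alpha>_def)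
    fix i assume i: "1 \<le> i" "i < j"
    then have "lam (j - 1) \<le> lam i" by (intro eigensystem_decreasing[OF es]) auto
    then show "\<alpha> \<le> lam i - lam j" using i by (auto simp: \<alpha>_def)
  qed
  have eigenvector: "(norm (sgn (inner (v_hat N \<omega> j) (v j)) *\<^sub>R v_hat N \<omega> j - v j))\<^sup>2 \<le> 8 / \<alpha>\<^sup>2 * (h N \<omega>)\<^sup>2"
    if "1 \<le> N" "\<omega> \<in> space M" for N \<omega>
  proof (rule eigenvector_perturbation[OF C es j gap(1) gap(3) gap(2)])
    show "norm (v_hat N \<omega> j) = 1" by (rule eigensystemD(3)[OF es'[OF that] j])
    show "?C' N \<omega> (v_hat N \<omega> j) = lam_hat N \<omega> j *\<^sub>R v_hat N \<omega> j"
      by (rule eigensystemD(1)[OF es'[OF that] j])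
    then show "norm (?C (v_hat N \<omega> j) - ?C' N \<omega> (v_hat N \<omega> j)) \<le> h N \<omega>"
      using close[OF that, of "v_hat N \<omega> j"] eigensystemD(3)[OF es'[OF that] j] by simp
    show "\<bar>lam j - lam_hat N \<omega> j\<bar> \<le> h N \<omega>" by (rule eigenvalue[OF that])
  qed
  have h2: "(h N \<omega>)\<^sup>2 \<le> error_bound N \<omega>" if "1 \<le> N" "\<omega> \<in> space M" for N \<omega>
    unfolding h_def by (rule kernel_norm_error_le[OF that])
  show ?thesis
  proof (intro conjI limsup_scaled_expectation_finite)
    fix N :: nat and \<omega> assume N: "1 \<le> N" "\<omega> \<in> space M"
    have "\<bar>lam j - lam_hat N \<omega> j\<bar>\<^sup>2 \<le> (h N \<omega>)\<^sup>2" using eigenvalue[OF N] by (intro power_mono) auto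
    then show "\<bar>lam j - lam_hat N \<omega> j\<bar>\<^sup>2 \<le> 1 * error_bound N \<omega>" using h2[OF N] by simp
    have "8 / \<alpha>\<^sup>2 * (h N \<omega>)\<^sup>2 \<le> 8 / \<alpha>\<^sup>2 * error_bound N \<omega>" by (intro mult_left_mono h2 N) simp
    with eigenvector[OF N]
    show "(norm (sgn (inner (v_hat N \<omega> j) (v j)) *\<^sub>R v_hat N \<omega> j - v j))\<^sup>2 \<le> 8 / \<alpha>\<^sup>2 * error_bound N \<omega>"
      by (rule order_trans)
  qed auto
qed

end
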